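(* Let $p=p(k)$ satisfy $k^{-3/2}\ll p\le 10\frac{\ln k}{k}$ as $k\to\infty$ (i.e. $pk^{3/2}\to\infty$). Set $\lambda=(k-1)\frac{p}{1-(1-p)^k}$ and $\lambda^{R}=(k-1)\frac{p(1-p)^{k-1}}{1-(1-p)^k}$. Let $\mathrm{ESC}$ be the event that the leftwalk with i.i.d. steps $Z_i\sim\mathrm{Po}(\lambda)$ satisfies $Y_i>0$ for all $i\ge1$, and let $\mathrm{ESC}^R$ be the event that the rightwalk with i.i.d. steps $Z_i^R\sim\mathrm{Po}(\lambda^R)$ satisfies $Y^R_i>0$ for all $i\ge 1$. Then, as $k\to\infty$, $$\Pr[\mathrm{TREE}]\sim \Pr[\mathrm{ESC}]\,\Pr[\mathrm{ESC}^{R}].$$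
   Context: Tilted balls-into-bins model with tilt $p$ (for an integer $k\ge2$): $k-1$ balls are placed independently, each into bin $T\in\{1,\dots,k\}$ with $\Pr[T=i]=\frac{p(1-p)^{i-1}}{1-(1-p)^k}$. Let $Z_i$ be the number of balls in bin $i$, $Y_0=1$, $Y_i=Y_{i-1}+Z_i-1$; $\mathrm{TREE}$ is the event $Y_t>0$ for $1\le t\le k-1$. Leftwalk: given nonnegative integers $Z_1,Z_2,\dots$, $Y_0=1$, $Y_i=Y_{i-1}+Z_i-1$. Rightwalk: given nonnegative integers $Z_1^R,Z_2^R,\dots$, $Y^R_0=0$, $Y^R_i=Y^R_{i-1}+1-Z^R_i$. *)

theory Defs
  imports "HOL-Probability.Probability" "HOL-Library.Landau_Symbols"
begin

definition tilted_bin_pmf :: "real \<Rightarrow> nat \<Rightarrow> nat pmf" where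
  "tilted_bin_pmf p k =
     embed_pmf (\<lambda>i. if i \<in> {1..k} then p * (1 - p) ^ (i - 1) / (1 - (1 - p) ^ k) else 0)"

text \<open>The weights form a probability mass function when \<open>0 < p < 1\<close> and \<open>k \<ge> 1\<close>; otherwise
  \<^const>\<open>tilted_bin_pmf\<close> may be unspecified.\<close>

lemma pmf_tilted_bin:
  assumes "0 < p" "p < 1" "1 \<le> k"
  shows "pmf (tilted_bin_pmf p k) i =
    (if i \<in> {1..k} then p * (1 - p) ^ (i - 1) / (1 - (1 - p) ^ k) else 0)"
  unfolding tilted_bin_pmf_def
proof (rule pmf_embed_pmf)
  let ?f = "\<lambda>i. if i \<in> {1..k} then p * (1 - p) ^ (i - 1) / (1 - (1 - p) ^ k) else 0"
  have lt: "(1 - p) ^ k < 1"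
    using assms by (simp add: power_less_one_iff)
  show nonneg: "0 \<le> ?f x" for x
    using assms lt by simp
  have "(\<Sum>i=1..k. p * (1 - p) ^ (i - 1)) = p * (\<Sum>i<k. (1 - p) ^ i)"
    unfolding sum_distrib_left
    by (rule sum.reindex_bij_witness[where i = Suc and j = "\<lambda>i. i - 1"]) auto
  also have "\<dots> = 1 - (1 - p) ^ k"
    using assms by (simp add: one_diff_power_eq)
  finally have s: "(\<Sum>i=1..k. p * (1 - p) ^ (i - 1)) = 1 - (1 - p) ^ k" .
  have "(\<integral>\<^sup>+ x. ennreal (?f x) \<partial>count_space UNIV) = (\<Sum>x\<in>{1..k}. ennreal (?f x))"
    by (rule nn_integral_count_space'[where A = "{1..k}"]) auto
  also have "\<dots> = ennreal (\<Sum>x\<in>{1..k}. ?f x)"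
    by (rule sum_ennreal) (rule nonneg)
  also have "(\<Sum>x\<in>{1..k}. ?f x) = 1"
    using s lt by (simp flip: sum_divide_distrib)
  finally show "(\<integral>\<^sup>+ x. ennreal (?f x) \<partial>count_space UNIV) = 1" by simp
qed

text \<open>A placement \<open>T\<close> sends ball \<open>j < k - 1\<close> to bin \<open>T j\<close>; the value \<open>0\<close> is only the
  default of \<^const>\<open>Pi_pmf\<close> outside the index set.\<close>

definition placement_pmf :: "real \<Rightarrow> nat \<Rightarrow> (nat \<Rightarrow> nat) pmf" where
  "placement_pmf p k = Pi_pmf {..<k - 1} 0 (\<lambda>_. tilted_bin_pmf p k)"

definition bin_count :: "nat \<Rightarrow> (nat \<Rightarrow> nat) \<Rightarrow> nat \<Rightarrow> nat" where
  "bin_count k T i = card {j. j < k - 1 \<and> T j = i}"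

fun leftwalk :: "(nat \<Rightarrow> nat) \<Rightarrow> nat \<Rightarrow> int" where
  "leftwalk Z 0 = 1"
| "leftwalk Z (Suc i) = leftwalk Z i + int (Z (Suc i)) - 1"

fun rightwalk :: "(nat \<Rightarrow> nat) \<Rightarrow> nat \<Rightarrow> int" where
  "rightwalk Z 0 = 0"
| "rightwalk Z (Suc i) = rightwalk Z i + 1 - int (Z (Suc i))"

definition TREE :: "nat \<Rightarrow> (nat \<Rightarrow> nat) set" where
  "TREE k = {T. \<forall>t\<in>{1..k - 1}. leftwalk (bin_count k T) t > 0}"

text \<open>The law of an i.i.d. \<open>Po(l)\<close> sequence \<open>Z\<^sub>1, Z\<^sub>2, \<dots>\<close>, for \<open>l > 0\<close>.\<close>

definition poisson_steps :: "real \<Rightarrow> (nat \<Rightarrow> nat) measure" where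
  "poisson_steps l = PiM {1..} (\<lambda>_. measure_pmf (poisson_pmf l))"

definition ESC :: "real \<Rightarrow> (nat \<Rightarrow> nat) set" where
  "ESC l = {Z \<in> space (poisson_steps l). \<forall>i\<ge>1. leftwalk Z i > 0}"

definition ESC\<^sub>R :: "real \<Rightarrow> (nat \<Rightarrow> nat) set" where
  "ESC\<^sub>R l = {Z \<in> space (poisson_steps l). \<forall>i\<ge>1. rightwalk Z i > 0}"

lemma measurable_step:
  "(\<lambda>Z. Z (Suc i)) \<in> measurable (poisson_steps l) (count_space UNIV)"
  unfolding poisson_steps_def
  using measurable_component_singleton[of "Suc i" "{1..}" "\<lambda>_. measure_pmf (poisson_pmf l)"]
  by (simp add: measurable_def)

lemma measurable_leftwalk:
  "(\<lambda>Z. leftwalk Z i) \<in> measurable (poisson_steps l) (count_space UNIV)"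
proof (induction i)
  case (Suc i)
  note [measurable] = Suc measurable_step
  show ?case by simp
qed simp

lemma measurable_rightwalk:
  "(\<lambda>Z. rightwalk Z i) \<in> measurable (poisson_steps l) (count_space UNIV)"
proof (induction i)
  case (Suc i)
  note [measurable] = Suc measurable_step
  show ?case by simp
qed simp

lemma sets_ESC: "ESC l \<in> sets (poisson_steps l)"
proof -
  note [measurable] = measurable_leftwalk
  show ?thesis unfolding ESC_def by measurable
qed

lemma sets_ESC_R: "ESC\<^sub>R l \<in> sets (poisson_steps l)"
proof -
  note [measurable] = measurable_rightwalk
  show ?thesis unfolding ESC\<^sub>R_def by measurable
qed

definition rate_left :: "real \<Rightarrow> nat \<Rightarrow> real" where
  "rate_left p k = (real k - 1) * (p / (1 - (1 - p) ^ k))"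

definition rate_right :: "real \<Rightarrow> nat \<Rightarrow> real" where
  "rate_right p k = (real k - 1) * (p * (1 - p) ^ (k - 1) / (1 - (1 - p) ^ k))"

end

theory Submission
  imports Defs
begin

text \<open>
  Write \<open>q = 1 - p\<close> and \<open>r\<^sub>i = \<lambda> q\<^sup>i\<close> for \<open>0 \<le> i < k\<close>.  The bin counts are independent \<open>Po(r\<^sub>i)\<close>
  variables conditioned on having sum \<open>k - 1\<close>, so the probability of \<open>TREE\<close> is a Poisson walk
  probability divided by the weight \<open>\<pi>\<close> of \<open>Po(k - 1)\<close> at its mean.  Cut off a left block and a
  right block of \<open>m = \<delta>k\<close> bins.  Both ends of the walk have to stay positive, and the middle
  stretch contributes the weight of a Poisson variable of mean \<open>\<mu> \<approx> (1 - O(\<delta>)) k\<close>.  That weight is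
  at most \<open>sqrt (k / \<mu>) \<pi>\<close>, which gives the upper bound.  It is at least \<open>\<pi> exp (- d\<^sup>2 / \<mu>)\<close> at
  distance \<open>d\<close> from the mean, and the walk does not reach zero in the middle by Kolmogorov's
  inequality, run from both ends up to the index where the rates cross \<open>1\<close>; this gives the lower
  bound.

  On the left, optional stopping of \<open>x\<^sup>Y\<close> compares the probability of staying positive for \<open>m\<close>
  steps with the positive root \<open>y\<close> of \<open>1 - y = exp (- \<lambda> y)\<close>, which is the escape probability.  On
  the right, the induction that proves the ballot theorem still gives two-sided bounds for the
  monotone rates, and the escape probability is \<open>1 - \<lambda>\<^sup>R\<close>.  Both escape probabilities are of
  larger order than \<open>1 / sqrt k\<close>, the order of all the errors.

  This works while \<open>p k\<close> stays bounded.  A larger tilt makes every ball land further to the left,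
  so the probability of \<open>TREE\<close> increases with \<open>p\<close>; comparison with \<open>p = c / k\<close> for large \<open>c\<close> shows
  that both sides are close to \<open>1\<close> otherwise.
\<close>

section \<open>Poisson weights\<close>

definition poisson_weight :: "real \<Rightarrow> nat \<Rightarrow> real" where
  "poisson_weight l n = l ^ n / fact n * exp (- l)"

definition poisson_weight_int :: "real \<Rightarrow> int \<Rightarrow> real" where
  "poisson_weight_int l i = (if i < 0 then 0 else poisson_weight l (nat i))"

definition poisson_peak :: "nat \<Rightarrow> real" where
  "poisson_peak n = poisson_weight (real n) n"

lemma pmf_poisson_eq_weight: "0 < l \<Longrightarrow> pmf (poisson_pmf l) n = poisson_weight l n"
  by (simp add: poisson_weight_def)

lemma poisson_weight_nonneg: "0 \<le> l \<Longrightarrow> 0 \<le> poisson_weight l n"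
  by (simp add: poisson_weight_def)

lemma poisson_weight_int_nonneg: "0 \<le> l \<Longrightarrow> 0 \<le> poisson_weight_int l i"
  by (simp add: poisson_weight_int_def poisson_weight_nonneg)

lemma poisson_weight_int_of_nat [simp]: "poisson_weight_int l (int n) = poisson_weight l n"
  by (simp add: poisson_weight_int_def)

lemma poisson_weight_rate_0: "poisson_weight_int 0 i = (if i = 0 then 1 else 0)"
  by (simp add: poisson_weight_int_def poisson_weight_def)

lemma poisson_weight_Suc: "real (Suc n) * poisson_weight l (Suc n) = l * poisson_weight l n"
  by (simp add: poisson_weight_def del: of_nat_Suc)

lemma poisson_weight_convolution:
  "(\<Sum>i\<le>n. poisson_weight a i * poisson_weight b (n - i)) = poisson_weight (a + b) n"
proof -
  have "poisson_weight a i * poisson_weight b (n - i) =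
      real (n choose i) * a ^ i * b ^ (n - i) * (exp (- a - b) / fact n)" if "i \<le> n" for i
    using that by (simp add: poisson_weight_def binomial_fact exp_diff exp_minus field_simps)
  then have "(\<Sum>i\<le>n. poisson_weight a i * poisson_weight b (n - i)) =
      (\<Sum>i\<le>n. real (n choose i) * a ^ i * b ^ (n - i)) * (exp (- a - b) / fact n)"
    by (simp add: sum_distrib_right sum_divide_distrib)
  also have "\<dots> = poisson_weight (a + b) n"
    by (simp add: poisson_weight_def binomial_ring[of a b n])
  finally show ?thesis .
qed

lemma poisson_weight_int_convolution:
  assumes "finite I" "{0..n} \<subseteq> I"
  shows "(\<Sum>i\<in>I. poisson_weight_int a i * poisson_weight_int b (n - i)) =
    poisson_weight_int (a + b) n"
proof -
  have "(\<Sum>i\<in>I. poisson_weight_int a i * poisson_weight_int b (n - i)) =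
      (\<Sum>i\<in>{0..n}. poisson_weight_int a i * poisson_weight_int b (n - i))"
    using assms by (intro sum.mono_neutral_right) (auto simp: poisson_weight_int_def)
  also have "\<dots> = poisson_weight_int (a + b) n"
  proof (cases "0 \<le> n")
    case True
    have "(\<Sum>i\<in>{0..n}. poisson_weight_int a i * poisson_weight_int b (n - i)) =
        (\<Sum>i\<le>nat n. poisson_weight a i * poisson_weight b (nat n - i))"
      by (rule sum.reindex_bij_witness[where i = int and j = nat])
        (use True in \<open>auto simp: poisson_weight_int_def nat_diff_distrib\<close>)
    then show ?thesis
      using True by (simp add: poisson_weight_convolution poisson_weight_int_def)
  qed (simp add: poisson_weight_int_def)
  finally show ?thesis .
qed

lemma poisson_weight_int_convolution_le:
  assumes "finite I" "0 \<le> a" "0 \<le> b"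
  shows "(\<Sum>i\<in>I. poisson_weight_int a i * poisson_weight_int b (n - i)) \<le>
    poisson_weight_int (a + b) n"
proof -
  have "(\<Sum>i\<in>I. poisson_weight_int a i * poisson_weight_int b (n - i)) \<le>
      (\<Sum>i\<in>I \<union> {0..n}. poisson_weight_int a i * poisson_weight_int b (n - i))"
    using assms by (intro sum_mono2) (auto intro!: mult_nonneg_nonneg poisson_weight_int_nonneg)
  then show ?thesis
    using assms poisson_weight_int_convolution[of "I \<union> {0..n}" n a b] by simp
qed

text \<open>Conditionally on \<open>N + N' = n\<close>, the mean of \<open>N\<close> is \<open>n R / (R + r)\<close>.\<close>

lemma poisson_weight_convolution_affine:
  assumes "0 < R" "0 < r"
  shows "(\<Sum>i\<le>n. poisson_weight R i * (1 - a * real i) * poisson_weight r (n - i)) =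
    poisson_weight (R + r) n * (1 - a * real n * R / (R + r))"
proof -
  have mean: "(\<Sum>i\<le>n. real i * poisson_weight R i * poisson_weight r (n - i)) =
      real n * R / (R + r) * poisson_weight (R + r) n"
  proof (cases n)
    case (Suc n')
    have "(\<Sum>i\<le>n. real i * poisson_weight R i * poisson_weight r (n - i)) =
        (\<Sum>i\<le>n'. real (Suc i) * poisson_weight R (Suc i) * poisson_weight r (n' - i))"
      unfolding Suc by (subst sum.atMost_Suc_shift) simp
    also have "\<dots> = (\<Sum>i\<le>n'. R * (poisson_weight R i * poisson_weight r (n' - i)))"
      by (simp only: poisson_weight_Suc mult.assoc)
    also have "\<dots> = R * poisson_weight (R + r) n'"
      by (simp add: sum_distrib_left[symmetric] poisson_weight_convolution)
    also have "\<dots> = R / (R + r) * ((R + r) * poisson_weight (R + r) n')"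
      using assms by simp
    also have "\<dots> = R / (R + r) * (real n * poisson_weight (R + r) n)"
      by (simp only: Suc poisson_weight_Suc)
    finally show ?thesis by simp
  qed simp
  have "(\<Sum>i\<le>n. poisson_weight R i * (1 - a * real i) * poisson_weight r (n - i)) =
      (\<Sum>i\<le>n. poisson_weight R i * poisson_weight r (n - i)) -
      a * (\<Sum>i\<le>n. real i * poisson_weight R i * poisson_weight r (n - i))"
    by (simp add: sum_distrib_left sum_subtractf[symmetric] algebra_simps)
  then show ?thesis
    unfolding mean poisson_weight_convolution by (simp add: algebra_simps)
qed

subsection \<open>Moments\<close>

lemma poisson_weight_sums: "poisson_weight l sums 1"
proof -
  have "(\<lambda>n. l ^ n /\<^sub>R fact n * exp (- l)) sums (exp l * exp (- l))"
    by (intro sums_mult2 exp_converges)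
  then show ?thesis by (simp add: poisson_weight_def[abs_def] exp_minus field_simps)
qed

lemma poisson_weight_sums_mean: "(\<lambda>n. real n * poisson_weight l n) sums l"
proof -
  have "(\<lambda>n. real (Suc n) * poisson_weight l (Suc n)) sums l"
    unfolding poisson_weight_Suc using sums_mult[OF poisson_weight_sums, of l l] by simp
  then show ?thesis by (subst (asm) sums_Suc_iff) simp
qed

lemma poisson_weight_sums_square: "(\<lambda>n. (real n)\<^sup>2 * poisson_weight l n) sums (l + l\<^sup>2)"
proof -
  have shift: "(real (Suc n))\<^sup>2 * poisson_weight l (Suc n) =
      l * (real n * poisson_weight l n) + l * poisson_weight l n" for n
    using arg_cong[OF poisson_weight_Suc[of n l], of "\<lambda>t. real (Suc n) * t"]
    by (simp add: power2_eq_square algebra_simps)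
  have "(\<lambda>n. (real (Suc n))\<^sup>2 * poisson_weight l (Suc n)) sums (l * l + l * 1)"
    unfolding shift by (intro sums_add sums_mult poisson_weight_sums poisson_weight_sums_mean)
  then show ?thesis by (subst (asm) sums_Suc_iff) (simp add: power2_eq_square algebra_simps)
qed

lemma poisson_weight_sums_deviation:
  "(\<lambda>n. (a + b * (real n - l) + c * (real n - l)\<^sup>2) * poisson_weight l n) sums (a + c * l)"
proof -
  have "(\<lambda>n. (a - b * l + c * l\<^sup>2) * poisson_weight l n +
      (b - 2 * c * l) * (real n * poisson_weight l n) + c * ((real n)\<^sup>2 * poisson_weight l n)) sums
      ((a - b * l + c * l\<^sup>2) * 1 + (b - 2 * c * l) * l + c * (l + l\<^sup>2))"
    by (intro sums_add sums_mult poisson_weight_sums poisson_weight_sums_mean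
        poisson_weight_sums_square)
  then show ?thesis by (simp add: power2_eq_square algebra_simps)
qed

lemma poisson_weight_sum_ge:
  assumes "0 \<le> l" "finite A" "\<And>n. g n \<le> (if n \<in> A then f n else 0)"
    and "(\<lambda>n. g n * poisson_weight l n) sums s"
  shows "s \<le> (\<Sum>n\<in>A. f n * poisson_weight l n)"
proof (rule sums_le[OF _ assms(4)])
  show "g n * poisson_weight l n \<le> (if n \<in> A then f n * poisson_weight l n else 0)" for n
    using mult_right_mono[OF assms(3) poisson_weight_nonneg[OF assms(1), of n], of n] by auto
  show "(\<lambda>n. if n \<in> A then f n * poisson_weight l n else 0) sums (\<Sum>n\<in>A. f n * poisson_weight l n)"
    by (rule sums_If_finite_set[OF assms(2)])
qed

lemma poisson_weight_sum_le:
  assumes "0 \<le> l" "finite A" "\<And>n. (if n \<in> A then f n else 0) \<le> g n"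
    and "(\<lambda>n. g n * poisson_weight l n) sums s"
  shows "(\<Sum>n\<in>A. f n * poisson_weight l n) \<le> s"
proof -
  have "(\<lambda>n. - g n * poisson_weight l n) sums - s"
    using sums_minus[OF assms(4)] by simp
  moreover have "- g n \<le> (if n \<in> A then - f n else 0)" for n
    using assms(3)[of n] by (simp split: if_splits)
  ultimately have "- s \<le> (\<Sum>n\<in>A. - f n * poisson_weight l n)"
    by (intro poisson_weight_sum_ge assms)
  then show ?thesis by (simp add: sum_negf)
qed

lemma poisson_weight_deficit_sum_le:
  assumes "0 < l" "finite A"
  shows "(\<Sum>n\<in>A. (l - real n) * poisson_weight l n) \<le> sqrt l"
proof (rule poisson_weight_sum_le)
  define g where "g = (\<lambda>n. sqrt l / 2 + 0 * (real n - l) + 1 / (2 * sqrt l) * (real n - l)\<^sup>2)"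
  have amgm: "l - real n \<le> g n" for n
  proof -
    have "0 \<le> (sqrt (sqrt l) - (l - real n) / sqrt (sqrt l))\<^sup>2" by simp
    also have "\<dots> = sqrt l + (real n - l)\<^sup>2 / sqrt l - 2 * (l - real n)"
      using assms by (simp add: power2_diff power_divide power2_commute)
    finally show ?thesis by (simp add: g_def)
  qed
  have "0 \<le> g n" for n
    using assms by (simp add: g_def)
  then show "(if n \<in> A then l - real n else 0) \<le> g n" for n
    using amgm by simp
  have "1 / (2 * sqrt l) * l = l / sqrt l / 2" by simp
  also have "\<dots> = sqrt l / 2" using assms by (simp only: real_div_sqrt less_imp_le)
  finally have mean: "sqrt l / 2 + 1 / (2 * sqrt l) * l = sqrt l" by simp
  show "(\<lambda>n. g n * poisson_weight l n) sums sqrt l"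
    unfolding g_def
    using poisson_weight_sums_deviation[of "sqrt l / 2" 0 l "1 / (2 * sqrt l)"] unfolding mean .
qed (use assms in auto)

lemma finite_real_interval_nat: "finite {n::nat. \<bar>real n - l\<bar> \<le> x}"
  by (rule finite_subset[of _ "{..nat \<lceil>l + x\<rceil>}"]) (auto simp: le_nat_iff, linarith)

lemma poisson_weight_chebyshev:
  assumes "0 \<le> l" "0 < x"
  shows "1 - l / x\<^sup>2 \<le> (\<Sum>n\<in>{n. \<bar>real n - l\<bar> \<le> x}. poisson_weight l n)"
proof -
  have "1 + - 1 / x\<^sup>2 * l \<le> (\<Sum>n\<in>{n. \<bar>real n - l\<bar> \<le> x}. 1 * poisson_weight l n)"
  proof (rule poisson_weight_sum_ge[OF assms(1) finite_real_interval_nat])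
    show "1 + 0 * (real n - l) + - 1 / x\<^sup>2 * (real n - l)\<^sup>2 \<le>
        (if n \<in> {n. \<bar>real n - l\<bar> \<le> x} then 1 else 0)" for n
    proof (cases "\<bar>real n - l\<bar> \<le> x")
      case False
      then have "x\<^sup>2 \<le> (real n - l)\<^sup>2"
        using assms by (simp add: abs_le_square_iff[symmetric])
      then show ?thesis using False assms by (simp add: field_simps)
    qed (simp add: divide_le_0_iff)
  qed (rule poisson_weight_sums_deviation)
  then show ?thesis by simp
qed

lemma poisson_weight_deficit_sum_ge:
  assumes "0 \<le> l" "0 < x"
  shows "- (l / x) \<le> (\<Sum>n\<in>{n. \<bar>real n - l\<bar> \<le> x}. (l - real n) * poisson_weight l n)"
proof -
  have "0 + - 1 / x * l \<le> (\<Sum>n\<in>{n. \<bar>real n - l\<bar> \<le> x}. (l - real n) * poisson_weight l n)"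
  proof (rule poisson_weight_sum_ge[OF assms(1) finite_real_interval_nat])
    show "0 + - 1 * (real n - l) + - 1 / x * (real n - l)\<^sup>2 \<le>
        (if n \<in> {n. \<bar>real n - l\<bar> \<le> x} then l - real n else 0)" for n
    proof (cases "\<bar>real n - l\<bar> \<le> x")
      case False
      then have "\<bar>real n - l\<bar> * x \<le> \<bar>real n - l\<bar> * \<bar>real n - l\<bar>"
        by (intro mult_left_mono) auto
      then have "\<bar>real n - l\<bar> \<le> (real n - l)\<^sup>2 / x"
        using assms by (simp add: pos_le_divide_eq power2_eq_square)
      then show ?thesis using False by simp
    qed (use assms in simp)
  qed (rule poisson_weight_sums_deviation)
  then show ?thesis by simp
qed

lemma nn_integral_poisson_sums:
  assumes "0 < l" "\<And>n. 0 \<le> f n" "(\<lambda>n. f n * poisson_weight l n) sums s"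
  shows "(\<integral>\<^sup>+z. ennreal (f z) \<partial>poisson_pmf l) = ennreal s"
proof -
  have "(\<integral>\<^sup>+z. ennreal (f z) \<partial>poisson_pmf l) = (\<Sum>n. ennreal (f n * poisson_weight l n))"
    using assms
    by (simp add: nn_integral_measure_pmf nn_integral_count_space_nat poisson_weight_def
        ennreal_mult[symmetric] mult.commute)
  also have "\<dots> = ennreal s"
    using assms(1,3)
    by (intro suminf_ennreal_eq) (auto intro!: mult_nonneg_nonneg assms(2) poisson_weight_nonneg)
  finally show ?thesis .
qed

lemma nn_integral_poisson_variance:
  assumes "0 < l"
  shows "(\<integral>\<^sup>+z. ennreal ((a + (real z - l))\<^sup>2) \<partial>poisson_pmf l) = ennreal (a\<^sup>2 + l)"
proof (rule nn_integral_poisson_sums[OF assms])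
  show "(\<lambda>z. (a + (real z - l))\<^sup>2 * poisson_weight l z) sums (a\<^sup>2 + l)"
    using poisson_weight_sums_deviation[of "a\<^sup>2" "2 * a" l 1] by (simp add: power2_sum add_ac)
qed simp

lemma nn_integral_poisson_power:
  assumes "0 < l" "0 \<le> x"
  shows "(\<integral>\<^sup>+z. ennreal (x ^ z) \<partial>poisson_pmf l) = ennreal (exp (l * (x - 1)))"
proof (rule nn_integral_poisson_sums)
  have "(\<lambda>n. (x * l) ^ n /\<^sub>R fact n * exp (- l)) sums (exp (x * l) * exp (- l))"
    by (intro sums_mult2 exp_converges)
  then show "(\<lambda>n. x ^ n * poisson_weight l n) sums exp (l * (x - 1))"
    by (simp add: poisson_weight_def exp_minus exp_diff field_simps power_mult_distrib)
qed (use assms in auto)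

subsection \<open>The weight at the mean\<close>

lemma poisson_peak_pos: "0 < poisson_peak n"
  by (cases "n = 0") (simp_all add: poisson_peak_def poisson_weight_def)

lemma poisson_peak_Suc:
  assumes "0 < n"
  shows "poisson_peak (Suc n) = poisson_peak n * ((1 + 1 / real n) ^ n * exp (- 1))"
proof -
  have "real n ^ n * (1 + 1 / real n) ^ n = (real n + 1) ^ n"
    using assms by (simp add: power_mult_distrib[symmetric] field_simps)
  then have "poisson_peak n * ((1 + 1 / real n) ^ n * exp (- 1)) =
      (real n + 1) ^ n / fact n * (exp (- real n) * exp (- 1))"
    by (simp add: poisson_peak_def poisson_weight_def)
  also have "\<dots> = poisson_peak (Suc n)"
    by (simp add: poisson_peak_def poisson_weight_def mult_exp_exp add.commute)
  finally show ?thesis by simp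
qed

lemma poisson_peak_antimono: "m \<le> n \<Longrightarrow> poisson_peak n \<le> poisson_peak m"
proof (rule lift_Suc_antimono_le[of poisson_peak])
  show "poisson_peak (Suc n) \<le> poisson_peak n" for n
  proof (cases "n = 0")
    case False
    have "(1 + 1 / real n) ^ n \<le> exp 1"
      using exp_ge_one_plus_x_over_n_power_n[of n 1] False by simp
    then have "(1 + 1 / real n) ^ n * exp (- 1) \<le> 1"
      by (simp add: exp_minus field_simps)
    then show ?thesis
      using False poisson_peak_pos[of n] by (simp add: poisson_peak_Suc mult_left_le)
  qed (simp add: poisson_peak_def poisson_weight_def)
qed

lemma exp_1_le_power_sqrt:
  assumes "0 < n"
  shows "exp 1 \<le> (1 + 1 / real n) ^ n * sqrt (1 + 1 / real n)"
proof -
  have pos: "0 < 1 + 1 / real n" by (simp add: add_pos_nonneg)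
  have "2 / (2 * real n + 1) \<le> ln (real n + 1) - ln (real n)"
    using ln_inverse_approx_ge[of "real n" "real n + 1"] assms by simp
  also have "\<dots> = ln (1 + 1 / real n)"
    using assms ln_div[of "real n + 1" "real n"] by (simp add: add_divide_distrib)
  finally have "1 \<le> (real n + 1 / 2) * ln (1 + 1 / real n)"
    by (simp add: field_simps)
  then have "exp 1 \<le> exp (real n * ln (1 + 1 / real n) + 1 / 2 * ln (1 + 1 / real n))"
    by (simp add: distrib_right)
  also have "\<dots> = (1 + 1 / real n) ^ n * sqrt (1 + 1 / real n)"
    using pos powr_half_sqrt[of "1 + 1 / real n"]
    by (simp add: exp_add exp_of_nat_mult powr_def)
  finally show ?thesis .
qed

lemma sqrt_poisson_peak_mono:
  assumes "0 < m" "m \<le> n"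
  shows "sqrt (real m) * poisson_peak m \<le> sqrt (real n) * poisson_peak n"
  using assms(2)
proof (induction n rule: dec_induct)
  case (step n)
  then have n_pos: "0 < n" using assms(1) by simp
  have "1 \<le> (1 + 1 / real n) ^ n * sqrt (1 + 1 / real n) * exp (- 1)"
    using exp_1_le_power_sqrt[OF n_pos] by (simp add: exp_minus field_simps)
  then have "sqrt n * poisson_peak n * 1 \<le>
      sqrt n * poisson_peak n * ((1 + 1 / real n) ^ n * sqrt (1 + 1 / real n) * exp (- 1))"
    using poisson_peak_pos[of n] by (intro mult_left_mono) auto
  also have "\<dots> = (sqrt n * sqrt (1 + 1 / real n)) *
      (poisson_peak n * ((1 + 1 / real n) ^ n * exp (- 1)))"
    by simp
  also have "sqrt n * sqrt (1 + 1 / real n) = sqrt (real (Suc n))"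
    using n_pos by (simp add: real_sqrt_mult[symmetric] field_simps)
  finally show ?case
    using step.IH n_pos by (simp add: poisson_peak_Suc)
qed simp

lemma poisson_weight_le_peak:
  assumes "0 < l"
  shows "poisson_weight l n \<le> poisson_peak n"
proof (cases "n = 0")
  case False
  have "ln (l / n) \<le> l / n - 1" using assms False by (intro ln_le_minus_one) auto
  then have "n * ln (l / n) \<le> l - n" using False by (simp add: field_simps)
  then have "exp (n * ln (l / n)) \<le> exp (l - n)" by simp
  then have "(l / n) ^ n \<le> exp (l - n)" using assms False by (simp add: exp_of_nat_mult)
  then have "l ^ n * exp (- l) \<le> real n ^ n * exp (- real n)"
    using False by (simp add: power_divide exp_diff exp_minus field_simps)
  then have "l ^ n * exp (- l) / fact n \<le> real n ^ n * exp (- real n) / fact n"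
    by (rule divide_right_mono) simp
  then show ?thesis by (simp add: poisson_peak_def poisson_weight_def field_simps)
qed (use assms in \<open>simp add: poisson_peak_def poisson_weight_def\<close>)

lemma poisson_weight_ge_peak:
  assumes "0 < l"
  shows "poisson_peak n * exp (- (l - n)\<^sup>2 / l) \<le> poisson_weight l n"
proof (cases "n = 0")
  case False
  have "ln (n / l) \<le> n / l - 1" using assms False by (intro ln_le_minus_one) auto
  then have "n * (1 - n / l) \<le> n * ln (l / n)" using assms False
    by (intro mult_left_mono) (auto simp: ln_div)
  moreover have "l - n - (l - n)\<^sup>2 / l = n * (1 - n / l)"
    using assms by (simp add: field_simps power2_eq_square)
  ultimately have "exp (l - n - (l - n)\<^sup>2 / l) \<le> exp (n * ln (l / n))" by simp
  also have "\<dots> = (l / n) ^ n" using assms False by (simp add: exp_of_nat_mult)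
  finally have "exp (- real n) * exp (- (l - n)\<^sup>2 / l) * exp l \<le> l ^ n / real n ^ n"
    by (simp add: power_divide mult_exp_exp add.commute algebra_simps)
  then have "real n ^ n * exp (- real n) * exp (- (l - n)\<^sup>2 / l) \<le> l ^ n * exp (- l)"
    using False by (simp add: exp_minus field_simps)
  then have "real n ^ n * exp (- real n) * exp (- (l - n)\<^sup>2 / l) / fact n \<le>
      l ^ n * exp (- l) / fact n"
    by (rule divide_right_mono) simp
  then show ?thesis by (simp add: poisson_peak_def poisson_weight_def field_simps)
qed (use assms in \<open>simp add: poisson_peak_def poisson_weight_def power2_eq_square\<close>)

lemma poisson_weight_ge_peak_near_mean:
  assumes "0 < l" "0 \<le> d" "d \<le> int n" "\<bar>l - real_of_int d\<bar> \<le> x"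
  shows "poisson_peak n * exp (- x\<^sup>2 / l) \<le> poisson_weight_int l d"
proof -
  have nat_d: "real (nat d) = real_of_int d" "nat d \<le> n" using assms by auto
  have "(l - real_of_int d)\<^sup>2 \<le> x\<^sup>2"
    using assms by (subst abs_le_square_iff[symmetric]) auto
  then have "poisson_peak n * exp (- x\<^sup>2 / l) \<le>
      poisson_peak (nat d) * exp (- (l - real (nat d))\<^sup>2 / l)"
    using assms nat_d poisson_peak_pos[of "nat d"]
    by (intro mult_mono poisson_peak_antimono) (auto simp: divide_right_mono)
  also have "\<dots> \<le> poisson_weight_int l d"
    using poisson_weight_ge_peak[of l "nat d"] assms by (simp add: poisson_weight_int_def)
  finally show ?thesis .
qed

lemma poisson_weight_le_peak_floor:
  assumes "real N \<le> l" "0 < l"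
  shows "poisson_weight l n \<le> poisson_peak N"
proof (cases "N \<le> n")
  case True
  then show ?thesis
    using poisson_weight_le_peak[OF assms(2), of n] poisson_peak_antimono[of N n] by simp
next
  case False
  then have "n \<le> N" by simp
  then have "poisson_weight l n \<le> poisson_weight l N"
  proof (induction n rule: inc_induct)
    case (step n)
    have "real (Suc n) * poisson_weight l n \<le> l * poisson_weight l n"
      using step assms by (intro mult_right_mono poisson_weight_nonneg) auto
    also have "\<dots> = real (Suc n) * poisson_weight l (Suc n)"
      by (rule poisson_weight_Suc[symmetric])
    finally have "poisson_weight l n \<le> poisson_weight l (Suc n)"
      by (simp only: mult_le_cancel_left_pos of_nat_0_less_iff zero_less_Suc)
    then show ?case using step by simp
  qed simp
  then show ?thesis using poisson_weight_le_peak[OF assms(2), of N] by simp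
qed

lemma poisson_weight_int_le_peak:
  assumes "1 \<le> N" "real N \<le> l" "l \<le> real n"
  shows "poisson_weight_int l i \<le> sqrt (real n / real N) * poisson_peak n"
proof -
  have "poisson_weight_int l i \<le> poisson_peak N"
    using assms poisson_weight_le_peak_floor[of N l "nat i"] poisson_peak_pos[of N]
    by (auto simp: poisson_weight_int_def)
  also have "\<dots> = sqrt N * poisson_peak N / sqrt N" using assms by simp
  also have "\<dots> \<le> sqrt n * poisson_peak n / sqrt N"
    using assms by (intro divide_right_mono sqrt_poisson_peak_mono) auto
  also have "\<dots> = sqrt (real n / real N) * poisson_peak n" by (simp add: real_sqrt_divide)
  finally show ?thesis .
qed

section \<open>Killed Poisson walks\<close>

primrec poisson_chain ::
  "(nat \<Rightarrow> 's \<Rightarrow> nat \<Rightarrow> 's) \<Rightarrow> (nat \<Rightarrow> real) \<Rightarrow> 's \<Rightarrow> nat \<Rightarrow> 's pmf" where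
  "poisson_chain F r s 0 = return_pmf s"
| "poisson_chain F r s (Suc n) =
    bind_pmf (poisson_chain F r s n) (\<lambda>g. map_pmf (F n g) (poisson_pmf (r n)))"

text \<open>The walks live on \<open>nat\<close>; the absorbing state \<open>0\<close> records that the leftwalk (\<open>\<sigma> = 1\<close>) or the
  rightwalk (\<open>\<sigma> = - 1\<close>) has stopped being positive.  A rightwalk starts at \<open>0\<close> but is alive there,
  so its first step is not subject to killing.\<close>

definition killed_step :: "int \<Rightarrow> nat \<Rightarrow> nat \<Rightarrow> nat" where
  "killed_step \<sigma> g z = (if g = 0 then 0 else nat (int g + \<sigma> * (int z - 1)))"

definition free_first_step :: "nat \<Rightarrow> nat \<Rightarrow> nat \<Rightarrow> nat" where
  "free_first_step i = (if i = 0 then (\<lambda>_ z. 1 - z) else killed_step (- 1))"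

abbreviation killed_law :: "int \<Rightarrow> (nat \<Rightarrow> real) \<Rightarrow> nat \<Rightarrow> nat \<Rightarrow> nat pmf" where
  "killed_law \<sigma> \<equiv> poisson_chain (\<lambda>_. killed_step \<sigma>)"

abbreviation left_law :: "(nat \<Rightarrow> real) \<Rightarrow> nat \<Rightarrow> nat pmf" where
  "left_law r \<equiv> killed_law 1 r 1"

abbreviation right_law :: "(nat \<Rightarrow> real) \<Rightarrow> nat \<Rightarrow> nat pmf" where
  "right_law r \<equiv> poisson_chain free_first_step r 0"

definition alive_prob :: "nat pmf \<Rightarrow> real" where
  "alive_prob M = measure_pmf.prob M {0<..}"

definition walk_mean :: "int \<Rightarrow> (nat \<Rightarrow> real) \<Rightarrow> nat \<Rightarrow> nat \<Rightarrow> real" where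
  "walk_mean \<sigma> r h n = real h + of_int \<sigma> * (\<Sum>i<n. r i - 1)"

lemma alive_prob_eq: "alive_prob M = 1 - pmf M 0"
proof -
  have "alive_prob M = measure_pmf.prob M (UNIV - {0})"
    unfolding alive_prob_def by (rule arg_cong[where f = "measure_pmf.prob M"]) auto
  then show ?thesis using measure_pmf.prob_compl[of "{0}" M] by (simp add: measure_pmf_single)
qed

lemma alive_prob_nonneg: "0 \<le> alive_prob M"
  by (simp add: alive_prob_def)

lemma alive_prob_le_1: "alive_prob M \<le> 1"
  by (simp add: alive_prob_def)

lemma killed_step_0 [simp]: "killed_step \<sigma> 0 = (\<lambda>_. 0)"
  by (simp add: killed_step_def fun_eq_iff)

lemma killed_step_up: "0 < g \<Longrightarrow> killed_step 1 g z = g - 1 + z"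
  by (auto simp: killed_step_def nat_eq_iff of_nat_diff)

lemma real_killed_step:
  assumes "killed_step \<sigma> g z \<noteq> 0"
  shows "real (killed_step \<sigma> g z) = real g + of_int \<sigma> * (real z - 1)"
proof -
  have "int (killed_step \<sigma> g z) = int g + \<sigma> * (int z - 1)"
    using assms by (auto simp: killed_step_def split: if_splits)
  from arg_cong[OF this, of real_of_int] show ?thesis by simp
qed

lemma killed_step_eq_0D:
  assumes "killed_step \<sigma> g z = 0" "0 < g"
  shows "real g + of_int \<sigma> * (real z - 1) \<le> 0"
proof -
  have "int g + \<sigma> * (int z - 1) \<le> 0"
    using assms by (simp add: killed_step_def)
  then have "real_of_int (int g + \<sigma> * (int z - 1)) \<le> 0" by (simp only: of_int_le_0_iff)
  then show ?thesis by simp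
qed

lemma poisson_chain_add:
  "poisson_chain F r s (m + n) = bind_pmf (poisson_chain F r s m)
     (\<lambda>g. poisson_chain (\<lambda>i. F (m + i)) (\<lambda>i. r (m + i)) g n)"
  by (induction n) (simp_all add: bind_return_pmf' bind_assoc_pmf)

lemma killed_law_0: "killed_law \<sigma> r 0 n = return_pmf 0"
  by (induction n) (simp_all add: bind_return_pmf)

lemma poisson_chain_supermartingale:
  assumes "\<And>n g. n < m \<Longrightarrow> (\<integral>\<^sup>+z. f (Suc n) (F n g z) \<partial>poisson_pmf (r n)) \<le> f n g + d n g"
  shows "(\<integral>\<^sup>+g. f m g \<partial>poisson_chain F r s m) \<le>
    f 0 s + (\<Sum>n<m. \<integral>\<^sup>+g. d n g \<partial>poisson_chain F r s n)"
  using assms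
proof (induction m)
  case (Suc m)
  have "(\<integral>\<^sup>+g. f (Suc m) g \<partial>poisson_chain F r s (Suc m)) \<le>
      (\<integral>\<^sup>+g. f m g + d m g \<partial>poisson_chain F r s m)"
    by (simp add: nn_integral_mono Suc.prems)
  also have "\<dots> = (\<integral>\<^sup>+g. f m g \<partial>poisson_chain F r s m) + (\<integral>\<^sup>+g. d m g \<partial>poisson_chain F r s m)"
    by (rule nn_integral_add) auto
  also have "\<dots> \<le> f 0 s + (\<Sum>n<m. \<integral>\<^sup>+g. d n g \<partial>poisson_chain F r s n) +
      (\<integral>\<^sup>+g. d m g \<partial>poisson_chain F r s m)"
    using Suc by (intro add_right_mono) auto
  finally show ?case by (simp add: add.assoc)
qed simp

lemma poisson_chain_submartingale:
  assumes "\<And>n g. n < m \<Longrightarrow> f n g \<le> (\<integral>\<^sup>+z. f (Suc n) (F n g z) \<partial>poisson_pmf (r n))"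
  shows "f 0 s \<le> (\<integral>\<^sup>+g. f m g \<partial>poisson_chain F r s m)"
  using assms
proof (induction m)
  case (Suc m)
  then have "f 0 s \<le> (\<integral>\<^sup>+g. f m g \<partial>poisson_chain F r s m)" by simp
  also have "\<dots> \<le> (\<integral>\<^sup>+g. f (Suc m) g \<partial>poisson_chain F r s (Suc m))"
    by (simp add: nn_integral_mono Suc.prems)
  finally show ?case .
qed simp

lemma nn_integral_alive:
  "(\<integral>\<^sup>+g. (if g = 0 then 0 else c) \<partial>measure_pmf M) = c * ennreal (alive_prob M)"
proof -
  have "(\<integral>\<^sup>+g. (if g = 0 then 0 else c) \<partial>measure_pmf M) =
      (\<integral>\<^sup>+g. c * indicator {0<..} g \<partial>measure_pmf M)"
    by (intro nn_integral_cong) auto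
  then show ?thesis
    by (simp add: nn_integral_cmult alive_prob_def measure_pmf.emeasure_eq_measure)
qed

lemma nn_integral_dead:
  "(\<integral>\<^sup>+g. (if g = 0 then c else 0) \<partial>measure_pmf M) = c * ennreal (pmf M 0)"
proof -
  have "(\<integral>\<^sup>+g. (if g = 0 then c else 0) \<partial>measure_pmf M) =
      (\<integral>\<^sup>+g. c * indicator {0} g \<partial>measure_pmf M)"
    by (intro nn_integral_cong) auto
  then show ?thesis by (simp add: nn_integral_cmult emeasure_pmf_single)
qed

subsection \<open>Survival of the leftwalk\<close>

lemma nn_integral_killed_step_power:
  assumes "0 < l" "0 < x" "0 < g"
  shows "(\<integral>\<^sup>+z. ennreal (x ^ killed_step 1 g z) \<partial>poisson_pmf l) =
    ennreal (x ^ (g - 1) * exp (l * (x - 1)))"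
proof -
  have "x ^ killed_step 1 g z = x ^ (g - 1) * x ^ z" for z
    using assms by (simp only: killed_step_up power_add)
  then show ?thesis
    using assms by (simp add: ennreal_mult nn_integral_cmult nn_integral_poisson_power)
qed

lemma alive_prob_left_law_ge:
  assumes rates: "\<And>i. i < m \<Longrightarrow> 0 < r i" "\<And>i. i < m \<Longrightarrow> l \<le> r i"
    and x_range: "0 < x" "x \<le> 1" "exp (l * (x - 1)) \<le> x"
  shows "1 - x \<le> alive_prob (left_law r m)"
proof -
  have "(\<integral>\<^sup>+g. ennreal (x ^ g) \<partial>left_law r m) \<le>
      ennreal (x ^ 1) + (\<Sum>n<m. \<integral>\<^sup>+g. 0 \<partial>left_law r n)"
  proof (rule poisson_chain_supermartingale)
    fix n g assume n_less: "n < m"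
    show "(\<integral>\<^sup>+z. ennreal (x ^ killed_step 1 g z) \<partial>poisson_pmf (r n)) \<le> ennreal (x ^ g) + 0"
    proof (cases "g = 0")
      case False
      have "exp (r n * (x - 1)) \<le> exp (l * (x - 1))"
        using rates(2)[OF n_less] x_range by (simp add: mult_right_mono_neg)
      then have "x ^ (g - 1) * exp (r n * (x - 1)) \<le> x ^ (g - 1) * x"
        using x_range by (intro mult_left_mono order_trans[OF _ x_range(3)]) auto
      also have "\<dots> = x ^ g" using False by (simp add: power_eq_if)
      finally show ?thesis
        using nn_integral_killed_step_power[of "r n" x g] rates(1)[OF n_less] x_range False
        by (simp add: ennreal_leI)
    qed simp
  qed
  then have mean: "(\<integral>\<^sup>+g. ennreal (x ^ g) \<partial>left_law r m) \<le> ennreal x" by simp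
  have "1 * ennreal (pmf (left_law r m) 0) \<le> (\<integral>\<^sup>+g. ennreal (x ^ g) \<partial>left_law r m)"
    unfolding nn_integral_dead[symmetric] using x_range by (intro nn_integral_mono) auto
  then have "ennreal (pmf (left_law r m) 0) \<le> ennreal x" using mean by simp
  then have "pmf (left_law r m) 0 \<le> x" using x_range by simp
  then show ?thesis by (simp add: alive_prob_eq)
qed

text \<open>Discounting by \<open>\<beta>\<close> makes \<open>x\<^sup>Y\<close> a submartingale, and bounds its contribution from surviving
  walks by \<open>\<beta>\<^sup>m\<close>.\<close>

lemma discounted_power_submartingale:
  assumes rate_le: "0 < l'" "l' \<le> l" and x_range: "0 < x" "x \<le> 1" and discount: "0 < \<beta>" "\<beta> \<le> 1"
    and fixpoint: "x \<le> \<beta> * exp (l * (x - 1))"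
  shows "ennreal (if g = 0 then 1 else x ^ g * \<beta> ^ n) \<le>
    (\<integral>\<^sup>+z. ennreal (if killed_step 1 g z = 0 then 1 else x ^ killed_step 1 g z * \<beta> ^ Suc n)
      \<partial>poisson_pmf l')"
proof (cases "g = 0")
  case False
  have "exp (l * (x - 1)) \<le> exp (l' * (x - 1))"
    using rate_le x_range by (simp add: mult_right_mono_neg)
  then have "x \<le> \<beta> * exp (l' * (x - 1))"
    using discount fixpoint by (meson mult_le_cancel_left_pos order_trans)
  then have "x ^ (g - 1) * \<beta> ^ n * x \<le> x ^ (g - 1) * \<beta> ^ n * (\<beta> * exp (l' * (x - 1)))"
    using x_range discount by (intro mult_left_mono) auto
  then have "x ^ g * \<beta> ^ n \<le> \<beta> ^ Suc n * (x ^ (g - 1) * exp (l' * (x - 1)))"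
    using False by (simp add: power_eq_if mult_ac)
  then have "ennreal (if g = 0 then 1 else x ^ g * \<beta> ^ n) \<le>
      ennreal (\<beta> ^ Suc n) * ennreal (x ^ (g - 1) * exp (l' * (x - 1)))"
    using False x_range discount by (simp add: ennreal_mult[symmetric] ennreal_leI del: power_Suc)
  also have "\<dots> = (\<integral>\<^sup>+z. ennreal (\<beta> ^ Suc n) * ennreal (x ^ killed_step 1 g z) \<partial>poisson_pmf l')"
    using nn_integral_killed_step_power[of l' x g] rate_le x_range False
    by (simp add: nn_integral_cmult del: power_Suc)
  also have "\<dots> \<le> (\<integral>\<^sup>+z. ennreal (if killed_step 1 g z = 0 then 1
      else x ^ killed_step 1 g z * \<beta> ^ Suc n) \<partial>poisson_pmf l')"
  proof (rule nn_integral_mono)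
    fix z
    have "\<beta> ^ Suc n \<le> 1" using discount by (intro power_le_one) auto
    then show "ennreal (\<beta> ^ Suc n) * ennreal (x ^ killed_step 1 g z) \<le>
        ennreal (if killed_step 1 g z = 0 then 1 else x ^ killed_step 1 g z * \<beta> ^ Suc n)"
      using x_range discount
      by (auto simp: ennreal_mult[symmetric] mult.commute simp del: power_Suc)
  qed
  finally show ?thesis .
qed simp

lemma alive_prob_left_law_le:
  assumes rates: "\<And>i. i < m \<Longrightarrow> 0 < r i" "\<And>i. i < m \<Longrightarrow> r i \<le> l"
    and x_range: "0 < x" "x \<le> 1" and discount: "0 < \<beta>" "\<beta> \<le> 1"
    and fixpoint: "x \<le> \<beta> * exp (l * (x - 1))"
  shows "alive_prob (left_law r m) * (1 - \<beta> ^ m) \<le> 1 - x"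
proof -
  define f where "f = (\<lambda>n g. ennreal (if g = 0 then 1 else x ^ g * \<beta> ^ n))"
  have "f 0 1 \<le> (\<integral>\<^sup>+g. f m g \<partial>left_law r m)"
    by (rule poisson_chain_submartingale)
      (use discounted_power_submartingale[OF _ _ x_range discount fixpoint] rates in
        \<open>simp add: f_def\<close>)
  also have "\<dots> \<le> (\<integral>\<^sup>+g. (if g = 0 then 1 else 0) + (if g = 0 then 0 else ennreal (\<beta> ^ m))
      \<partial>left_law r m)"
    using x_range discount
    by (intro nn_integral_mono)
      (auto simp: f_def power_le_one intro!: ennreal_leI mult_left_le_one_le)
  also have "\<dots> = ennreal (pmf (left_law r m) 0) +
      ennreal (\<beta> ^ m) * ennreal (alive_prob (left_law r m))"
    by (subst nn_integral_add) (auto simp: nn_integral_dead nn_integral_alive)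
  also have "\<dots> = ennreal (pmf (left_law r m) 0 + \<beta> ^ m * alive_prob (left_law r m))"
    using discount alive_prob_nonneg by (simp add: ennreal_mult[symmetric])
  finally have "x \<le> pmf (left_law r m) 0 + \<beta> ^ m * alive_prob (left_law r m)"
    using discount alive_prob_nonneg
    by (subst (asm) f_def, subst (asm) ennreal_le_iff)
      (auto intro!: add_nonneg_nonneg mult_nonneg_nonneg)
  then show ?thesis by (simp add: alive_prob_eq algebra_simps)
qed

subsection \<open>Second moments\<close>

lemma walk_mean_Suc: "walk_mean \<sigma> r h (Suc n) = walk_mean \<sigma> r h n + of_int \<sigma> * (r n - 1)"
  by (simp add: walk_mean_def algebra_simps)

lemma nn_integral_walk_variance:
  assumes "0 < r n" "\<bar>\<sigma>\<bar> = 1"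
  shows "(\<integral>\<^sup>+z. ennreal ((real g + of_int \<sigma> * (real z - 1) - walk_mean \<sigma> r h (Suc n))\<^sup>2)
      \<partial>poisson_pmf (r n)) = ennreal ((real g - walk_mean \<sigma> r h n)\<^sup>2) + ennreal (r n)"
proof -
  have sign: "\<sigma> = 1 \<or> \<sigma> = - 1" using assms by linarith
  define a where "a = of_int \<sigma> * (real g - walk_mean \<sigma> r h n)"
  have square: "(real g + of_int \<sigma> * (real z - 1) - walk_mean \<sigma> r h (Suc n))\<^sup>2 =
      (a + (real z - r n))\<^sup>2" for z
    using sign by (auto simp: a_def walk_mean_Suc power2_eq_square algebra_simps)
  have "a\<^sup>2 = (real g - walk_mean \<sigma> r h n)\<^sup>2"
    using sign by (auto simp: a_def power_mult_distrib)
  then show ?thesis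
    using assms nn_integral_poisson_variance[OF assms(1), of a] by (simp only: square) simp
qed

lemma alive_second_moment_le:
  assumes rates: "\<And>i. i < m \<Longrightarrow> 0 < r i" and "\<bar>\<sigma>\<bar> = 1" "0 < h"
  shows "(\<integral>\<^sup>+g. (if g = 0 then 0 else ennreal ((real g - walk_mean \<sigma> r h m)\<^sup>2)) \<partial>killed_law \<sigma> r h m)
    \<le> ennreal (\<Sum>i<m. r i * alive_prob (killed_law \<sigma> r h i))"
proof -
  define f where
    "f = (\<lambda>n g. if g = 0 then 0 else ennreal ((real g - walk_mean \<sigma> r h n)\<^sup>2))"
  have "(\<integral>\<^sup>+g. f m g \<partial>killed_law \<sigma> r h m) \<le>
      f 0 h + (\<Sum>n<m. \<integral>\<^sup>+g. (if g = 0 then 0 else ennreal (r n)) \<partial>killed_law \<sigma> r h n)"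
  proof (rule poisson_chain_supermartingale)
    fix n g assume n_less: "n < m"
    show "(\<integral>\<^sup>+z. f (Suc n) (killed_step \<sigma> g z) \<partial>poisson_pmf (r n)) \<le>
        f n g + (if g = 0 then 0 else ennreal (r n))"
    proof (cases "g = 0")
      case False
      have "(\<integral>\<^sup>+z. f (Suc n) (killed_step \<sigma> g z) \<partial>poisson_pmf (r n)) \<le>
          (\<integral>\<^sup>+z. ennreal ((real g + of_int \<sigma> * (real z - 1) - walk_mean \<sigma> r h (Suc n))\<^sup>2)
            \<partial>poisson_pmf (r n))"
        by (intro nn_integral_mono) (auto simp: f_def real_killed_step)
      then show ?thesis
        using nn_integral_walk_variance[of r n, OF rates[OF n_less] assms(2)] False
        by (simp add: f_def)
    qed (simp add: f_def)
  qed
  also have "\<dots> = (\<Sum>n<m. ennreal (r n * alive_prob (killed_law \<sigma> r h n)))"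
    using rates alive_prob_nonneg assms(3)
    by (simp add: f_def walk_mean_def nn_integral_alive ennreal_mult less_imp_le)
  also have "\<dots> = ennreal (\<Sum>n<m. r n * alive_prob (killed_law \<sigma> r h n))"
    using rates alive_prob_nonneg by (intro sum_ennreal) (auto simp: less_imp_le)
  finally show ?thesis by (simp only: f_def)
qed

definition alive_near :: "nat pmf \<Rightarrow> real \<Rightarrow> real \<Rightarrow> real" where
  "alive_near M c x = measure_pmf.prob M {g. 0 < g \<and> \<bar>real g - c\<bar> \<le> x}"

lemma alive_near_ge:
  assumes rates: "\<And>i. i < m \<Longrightarrow> 0 < r i" and "\<bar>\<sigma>\<bar> = 1" "0 < h" and x_pos: "0 < x"
  shows "alive_prob (killed_law \<sigma> r h m) - (\<Sum>i<m. r i * alive_prob (killed_law \<sigma> r h i)) / x\<^sup>2 \<le>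
    alive_near (killed_law \<sigma> r h m) (walk_mean \<sigma> r h m) x"
proof -
  define far where "far = {g. 0 < g \<and> x < \<bar>real g - walk_mean \<sigma> r h m\<bar>}"
  let ?M = "killed_law \<sigma> r h m" and ?S = "\<Sum>i<m. r i * alive_prob (killed_law \<sigma> r h i)"
  have "ennreal (x\<^sup>2 * measure ?M far) = (\<integral>\<^sup>+g. ennreal (x\<^sup>2) * indicator far g \<partial>?M)"
    by (simp add: nn_integral_cmult measure_pmf.emeasure_eq_measure ennreal_mult)
  also have "\<dots> \<le> (\<integral>\<^sup>+g. (if g = 0 then 0 else ennreal ((real g - walk_mean \<sigma> r h m)\<^sup>2)) \<partial>?M)"
    using x_pos
    by (intro nn_integral_mono)
      (auto simp: far_def indicator_def abs_le_square_iff[symmetric] intro!: ennreal_leI)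
  also have "\<dots> \<le> ennreal ?S"
    by (rule alive_second_moment_le[OF assms(1-3)])
  finally have "x\<^sup>2 * measure ?M far \<le> ?S"
    using rates alive_prob_nonneg
    by (subst (asm) ennreal_le_iff) (auto intro!: sum_nonneg mult_nonneg_nonneg simp: less_imp_le)
  then have "measure ?M far \<le> ?S / x\<^sup>2"
    using x_pos by (simp add: field_simps)
  moreover have "alive_prob ?M =
      measure ?M ({g. 0 < g \<and> \<bar>real g - walk_mean \<sigma> r h m\<bar> \<le> x} \<union> far)"
    unfolding alive_prob_def by (rule arg_cong[where f = "measure_pmf.prob _"]) (auto simp: far_def)
  moreover have "\<dots> = alive_near ?M (walk_mean \<sigma> r h m) x + measure ?M far"
    unfolding alive_near_def by (rule measure_pmf.finite_measure_Union) (auto simp: far_def)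
  ultimately show ?thesis by simp
qed

text \<open>Kolmogorov's maximal inequality: the dead state is given the weight \<open>X\<^sup>2\<close>, a lower bound for
  the squared deviation from the mean at the moment of death.\<close>

lemma stopped_square_supermartingale:
  assumes rate: "0 < r n" and sign: "\<bar>\<sigma>\<bar> = 1"
    and X_range: "0 < X" "X \<le> walk_mean \<sigma> r h (Suc n)"
  shows "(\<integral>\<^sup>+z. ennreal (if killed_step \<sigma> g z = 0 then X\<^sup>2
      else (real (killed_step \<sigma> g z) - walk_mean \<sigma> r h (Suc n))\<^sup>2) \<partial>poisson_pmf (r n)) \<le>
    ennreal (if g = 0 then X\<^sup>2 else (real g - walk_mean \<sigma> r h n)\<^sup>2) + ennreal (r n)"
proof (cases "g = 0")
  case False
  have "ennreal (if killed_step \<sigma> g z = 0 then X\<^sup>2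
        else (real (killed_step \<sigma> g z) - walk_mean \<sigma> r h (Suc n))\<^sup>2) \<le>
      ennreal ((real g + of_int \<sigma> * (real z - 1) - walk_mean \<sigma> r h (Suc n))\<^sup>2)" for z
  proof (cases "killed_step \<sigma> g z = 0")
    case True
    then have "X \<le> \<bar>real g + of_int \<sigma> * (real z - 1) - walk_mean \<sigma> r h (Suc n)\<bar>"
      using killed_step_eq_0D[of \<sigma> g z] X_range False by linarith
    then show ?thesis
      using True X_range by (auto simp: abs_le_square_iff[symmetric] intro!: ennreal_leI)
  qed (simp add: real_killed_step)
  then have "(\<integral>\<^sup>+z. ennreal (if killed_step \<sigma> g z = 0 then X\<^sup>2
        else (real (killed_step \<sigma> g z) - walk_mean \<sigma> r h (Suc n))\<^sup>2) \<partial>poisson_pmf (r n)) \<le>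
      (\<integral>\<^sup>+z. ennreal ((real g + of_int \<sigma> * (real z - 1) - walk_mean \<sigma> r h (Suc n))\<^sup>2)
        \<partial>poisson_pmf (r n))"
    by (intro nn_integral_mono)
  then show ?thesis
    using nn_integral_walk_variance[of r n, OF rate sign] False by simp
qed simp

lemma killed_law_dead_le:
  assumes rates: "\<And>i. i < n \<Longrightarrow> 0 < r i" and drift: "\<And>i. i < n \<Longrightarrow> 0 \<le> of_int \<sigma> * (r i - 1)"
    and sign: "\<bar>\<sigma>\<bar> = 1" and X_range: "0 < X" "X \<le> real h"
  shows "pmf (killed_law \<sigma> r h n) 0 \<le> (\<Sum>i<n. r i) / X\<^sup>2"
proof -
  define f where
    "f = (\<lambda>n g. ennreal (if g = 0 then X\<^sup>2 else (real g - walk_mean \<sigma> r h n)\<^sup>2))"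
  have mean_ge: "X \<le> walk_mean \<sigma> r h i" if "i \<le> n" for i
    using X_range drift that sum_nonneg[of "{..<i}" "\<lambda>i. of_int \<sigma> * (r i - 1)"]
    by (auto simp: walk_mean_def sum_distrib_left[symmetric])
  have "(\<integral>\<^sup>+g. f n g \<partial>killed_law \<sigma> r h n) \<le>
      f 0 h + (\<Sum>i<n. \<integral>\<^sup>+g. ennreal (r i) \<partial>killed_law \<sigma> r h i)"
    unfolding f_def using rates mean_ge
    by (intro poisson_chain_supermartingale stopped_square_supermartingale sign X_range(1)) auto
  also have "\<dots> = (\<Sum>i<n. ennreal (r i))"
    using X_range by (simp add: f_def walk_mean_def)
  also have "\<dots> = ennreal (\<Sum>i<n. r i)"
    using rates by (intro sum_ennreal) (simp add: less_imp_le)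
  finally have "(\<integral>\<^sup>+g. f n g \<partial>killed_law \<sigma> r h n) \<le> ennreal (\<Sum>i<n. r i)" .
  moreover have "ennreal (X\<^sup>2) * ennreal (pmf (killed_law \<sigma> r h n) 0) \<le>
      (\<integral>\<^sup>+g. f n g \<partial>killed_law \<sigma> r h n)"
    unfolding nn_integral_dead[symmetric] by (intro nn_integral_mono) (auto simp: f_def)
  ultimately have "ennreal (X\<^sup>2 * pmf (killed_law \<sigma> r h n) 0) \<le> ennreal (\<Sum>i<n. r i)"
    by (auto simp: ennreal_mult)
  then have "X\<^sup>2 * pmf (killed_law \<sigma> r h n) 0 \<le> (\<Sum>i<n. r i)"
    using rates by (subst (asm) ennreal_le_iff) (auto intro!: sum_nonneg simp: less_imp_le)
  then show ?thesis using X_range by (simp add: field_simps)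
qed

section \<open>Transition weights and the ballot theorem\<close>

lemma pmf_bind_eq_sum:
  assumes "finite A" "\<And>f. pmf M f \<noteq> 0 \<Longrightarrow> pmf (K f) g \<noteq> 0 \<Longrightarrow> f \<in> A"
  shows "pmf (bind_pmf M K) g = (\<Sum>f\<in>A. pmf M f * pmf (K f) g)"
proof -
  have "pmf (bind_pmf M K) g = (\<Sum>f\<in>A. pmf (K f) g * pmf M f)"
    unfolding pmf_bind
    by (rule integral_measure_pmf_real[OF assms(1)]) (use assms(2) in \<open>simp add: set_pmf_iff\<close>)
  then show ?thesis by (simp add: mult.commute)
qed

lemma pmf_map_killed_step:
  assumes "0 < l" "0 < g" "\<bar>\<sigma>\<bar> = 1"
  shows "pmf (map_pmf (killed_step \<sigma> f) (poisson_pmf l)) g =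
    (if f = 0 then 0 else poisson_weight_int l (1 + \<sigma> * (int g - int f)))"
proof -
  have "\<sigma> = 1 \<or> \<sigma> = - 1" using assms by linarith
  then have "killed_step \<sigma> f -` {g} = (if f = 0 \<or> 1 + \<sigma> * (int g - int f) < 0 then {}
      else {nat (1 + \<sigma> * (int g - int f))})"
    using assms by (auto simp: killed_step_def split: if_splits)
  then show ?thesis
    using assms
    by (simp add: pmf_map measure_pmf_single poisson_weight_int_def pmf_poisson_eq_weight
        del: pmf_poisson)
qed

lemma pmf_killed_law_down_above:
  assumes "h + n < g"
  shows "pmf (killed_law (- 1) r h n) g = 0"
proof -
  have "set_pmf (killed_law (- 1) r h n) \<subseteq> {..h + n}"
    by (induction n) (auto simp: killed_step_def split: if_splits)
  then show ?thesis using assms by (auto simp: pmf_eq_0_set_pmf)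
qed

lemma pmf_killed_law_Suc:
  assumes "0 < r n" "0 < g" "\<bar>\<sigma>\<bar> = 1"
    and "\<sigma> = 1 \<Longrightarrow> g < N" "\<sigma> = - 1 \<Longrightarrow> h + n \<le> N"
  shows "pmf (killed_law \<sigma> r h (Suc n)) g =
    (\<Sum>f\<in>{1..N}. pmf (killed_law \<sigma> r h n) f * poisson_weight_int (r n) (1 + \<sigma> * (int g - int f)))"
proof -
  have sign: "\<sigma> = 1 \<or> \<sigma> = - 1" using assms by linarith
  have "pmf (killed_law \<sigma> r h (Suc n)) g = (\<Sum>f\<in>{1..N}. pmf (killed_law \<sigma> r h n) f *
      pmf (map_pmf (killed_step \<sigma> f) (poisson_pmf (r n))) g)"
    unfolding poisson_chain.simps
  proof (rule pmf_bind_eq_sum)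
    fix f
    assume "pmf (killed_law \<sigma> r h n) f \<noteq> 0"
      and step: "pmf (map_pmf (killed_step \<sigma> f) (poisson_pmf (r n))) g \<noteq> 0"
    then have "\<sigma> = - 1 \<Longrightarrow> f \<le> h + n"
      using pmf_killed_law_down_above[of h n f r] by (cases "h + n < f") auto
    moreover have "f \<noteq> 0 \<and> 0 \<le> 1 + \<sigma> * (int g - int f)"
      using step assms(1-3)
      by (auto simp: pmf_map_killed_step poisson_weight_int_def split: if_splits)
    ultimately show "f \<in> {1..N}"
      using sign assms(4,5) by auto
  qed simp
  then show ?thesis using assms by (simp add: pmf_map_killed_step)
qed

lemma pmf_killed_law_le:
  assumes "\<And>i. i < n \<Longrightarrow> 0 < r i" "0 < g" "\<bar>\<sigma>\<bar> = 1"
  shows "pmf (killed_law \<sigma> r h n) g \<le>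
    poisson_weight_int (\<Sum>i<n. r i) (int n + \<sigma> * (int g - int h))"
  using assms(1,2)
proof (induction n arbitrary: g)
  case 0
  then show ?case using assms(3) by (auto simp: poisson_weight_rate_0 indicator_def)
next
  case (Suc n)
  define N where "N = max (Suc g) (h + n)"
  define R where "R = (\<Sum>i<n. r i)"
  have "0 \<le> R" unfolding R_def using Suc.prems by (intro sum_nonneg) (auto simp: less_imp_le)
  have position_inj: "inj_on (\<lambda>f. int n + \<sigma> * (int f - int h)) {1..N}"
    using assms(3) by (auto simp: inj_on_def)
  have "pmf (killed_law \<sigma> r h (Suc n)) g =
      (\<Sum>f\<in>{1..N}. pmf (killed_law \<sigma> r h n) f * poisson_weight_int (r n) (1 + \<sigma> * (int g - int f)))"
    using Suc.prems assms(3) by (intro pmf_killed_law_Suc) (auto simp: N_def)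
  also have "\<dots> \<le> (\<Sum>f\<in>{1..N}. poisson_weight_int R (int n + \<sigma> * (int f - int h)) *
      poisson_weight_int (r n) (1 + \<sigma> * (int g - int f)))"
    unfolding R_def using Suc.prems
    by (intro sum_mono mult_right_mono poisson_weight_int_nonneg Suc.IH) (auto simp: less_imp_le)
  also have "\<dots> = (\<Sum>i\<in>(\<lambda>f. int n + \<sigma> * (int f - int h)) ` {1..N}. poisson_weight_int R i *
      poisson_weight_int (r n) (int (Suc n) + \<sigma> * (int g - int h) - i))"
    by (subst sum.reindex[OF position_inj]) (simp add: algebra_simps)
  also have "\<dots> \<le> poisson_weight_int (R + r n) (int (Suc n) + \<sigma> * (int g - int h))"
    using Suc.prems \<open>0 \<le> R\<close> by (intro poisson_weight_int_convolution_le) (auto simp: less_imp_le)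
  finally show ?case by (simp add: R_def)
qed

lemma pmf_right_law_above:
  assumes "n < g"
  shows "pmf (right_law r n) g = 0"
proof -
  have "set_pmf (right_law r n) \<subseteq> {..n}"
    by (induction n) (auto simp: free_first_step_def killed_step_def split: if_splits)
  then show ?thesis using assms by (auto simp: pmf_eq_0_set_pmf)
qed

lemma pmf_right_law_Suc:
  assumes "0 < r n" "0 < g" "0 < n"
  shows "pmf (right_law r (Suc n)) g =
    (\<Sum>f\<in>{1..n}. pmf (right_law r n) f * poisson_weight_int (r n) (1 + int f - int g))"
proof -
  have "pmf (right_law r (Suc n)) g =
      pmf (bind_pmf (right_law r n) (\<lambda>f. map_pmf (killed_step (- 1) f) (poisson_pmf (r n)))) g"
    using assms by (simp add: free_first_step_def)
  also have "\<dots> = (\<Sum>f\<in>{1..n}. pmf (right_law r n) f *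
      pmf (map_pmf (killed_step (- 1) f) (poisson_pmf (r n))) g)"
  proof (rule pmf_bind_eq_sum)
    fix f
    assume "pmf (right_law r n) f \<noteq> 0"
      and "pmf (map_pmf (killed_step (- 1) f) (poisson_pmf (r n))) g \<noteq> 0"
    then show "f \<in> {1..n}"
      using pmf_right_law_above[of n f r] assms
      by (cases "n < f") (auto simp: pmf_map_killed_step split: if_splits)
  qed simp
  finally show ?thesis using assms by (simp add: pmf_map_killed_step add_diff_eq)
qed

lemma pmf_right_law_1:
  assumes "0 < r 0" "0 < g"
  shows "pmf (right_law r 1) g = (if g = 1 then exp (- r 0) else 0)"
proof -
  have "(-) (Suc 0) -` {g} = (if g = 1 then {0} else {})"
    using assms by auto
  then show ?thesis
    using assms by (simp add: bind_return_pmf free_first_step_def pmf_map measure_pmf_single)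
qed

text \<open>The weight of the rightwalks that survive \<open>m\<close> steps and receive \<open>n\<close> balls in total.\<close>

definition ballot_weight :: "(nat \<Rightarrow> real) \<Rightarrow> nat \<Rightarrow> nat \<Rightarrow> real" where
  "ballot_weight r m n = (if n < m then pmf (right_law r m) (m - n) else 0)"

lemma ballot_weight_1: "0 < r 0 \<Longrightarrow> ballot_weight r 1 n = (if n = 0 then exp (- r 0) else 0)"
  using pmf_right_law_1[of r 1] by (simp add: ballot_weight_def)

lemma ballot_weight_Suc:
  assumes "0 < r m" "0 < m" "n \<le> m"
  shows "ballot_weight r (Suc m) n = (\<Sum>i\<le>n. ballot_weight r m i * poisson_weight (r m) (n - i))"
proof -
  have "ballot_weight r (Suc m) n =
      (\<Sum>f\<in>{1..m}. pmf (right_law r m) f * poisson_weight_int (r m) (1 + int f - int (Suc m - n)))"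
    using assms unfolding ballot_weight_def by (subst pmf_right_law_Suc) auto
  also have "\<dots> = (\<Sum>f\<in>{1..m} \<inter> {m - n..m}. pmf (right_law r m) f *
      poisson_weight_int (r m) (1 + int f - int (Suc m - n)))"
    using assms by (intro sum.mono_neutral_right) (auto simp: poisson_weight_int_def)
  also have "\<dots> = (\<Sum>i\<in>{i. i \<le> n \<and> i < m}. ballot_weight r m i * poisson_weight (r m) (n - i))"
  proof (rule sum.reindex_bij_witness[where i = "\<lambda>i. m - i" and j = "\<lambda>f. m - f"])
    fix f assume f_range: "f \<in> {1..m} \<inter> {m - n..m}"
    have "1 + int f - int (Suc m - n) = int (n - (m - f))" using f_range assms by auto
    then show "ballot_weight r m (m - f) * poisson_weight (r m) (n - (m - f)) =
        pmf (right_law r m) f * poisson_weight_int (r m) (1 + int f - int (Suc m - n))"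
      using f_range by (simp only: poisson_weight_int_of_nat) (simp add: ballot_weight_def)
  qed (use assms in auto)
  also have "\<dots> = (\<Sum>i\<le>n. ballot_weight r m i * poisson_weight (r m) (n - i))"
    by (intro sum.mono_neutral_left) (auto simp: ballot_weight_def)
  finally show ?thesis .
qed

lemma ballot_weight_le:
  assumes rates: "\<And>i. i < m \<Longrightarrow> 0 < r i" "\<And>i. i < m \<Longrightarrow> r 0 \<le> r i" and m_bounds: "0 < m" "n \<le> m"
  shows "ballot_weight r m n \<le> poisson_weight (\<Sum>i<m. r i) n * (1 - r 0 / (\<Sum>i<m. r i) * real n)"
  using m_bounds rates
proof (induction m arbitrary: n rule: nat_induct_non_zero)
  case 1
  then show ?case
    by (cases "n = 0") (auto simp: ballot_weight_1[simplified] poisson_weight_def le_Suc_eq)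
next
  case (Suc m)
  define R where "R = (\<Sum>i<m. r i)"
  have R_pos: "0 < R" unfolding R_def using Suc by (intro sum_pos) auto
  show ?case
  proof (cases "n \<le> m")
    case True
    have "ballot_weight r (Suc m) n = (\<Sum>i\<le>n. ballot_weight r m i * poisson_weight (r m) (n - i))"
      using Suc True by (intro ballot_weight_Suc) auto
    also have "\<dots> \<le>
        (\<Sum>i\<le>n. poisson_weight R i * (1 - r 0 / R * real i) * poisson_weight (r m) (n - i))"
      unfolding R_def using Suc.prems True
      by (intro sum_mono mult_right_mono Suc.IH poisson_weight_nonneg) (auto simp: less_imp_le)
    also have "\<dots> = poisson_weight (R + r m) n * (1 - r 0 / R * real n * R / (R + r m))"
      using R_pos Suc.prems by (intro poisson_weight_convolution_affine) auto
    finally show ?thesis using R_pos by (simp add: R_def)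
  next
    case False
    then have n_eq: "n = Suc m" using Suc.prems by simp
    have "r 0 * real n \<le> R + r m"
      using sum_mono[of "{..<Suc m}" "\<lambda>_. r 0" r] Suc.prems by (simp add: n_eq R_def algebra_simps)
    moreover have "0 < r m" using Suc.prems by simp
    ultimately show ?thesis
      using R_pos by (simp add: ballot_weight_def n_eq poisson_weight_nonneg flip: R_def)
  qed
qed

lemma poisson_weight_convolution_affine_ge:
  assumes "0 < R" "0 < l" "R \<le> real m * l" "0 < m"
  shows "poisson_weight (R + l) n * (1 - real n / real (Suc m)) \<le>
    (\<Sum>i\<le>n. poisson_weight R i * (1 - real i / real m) * poisson_weight l (n - i))"
proof -
  have "R / (real m * (R + l)) \<le> 1 / real (Suc m)"
    using assms by (simp add: divide_simps) (simp add: algebra_simps)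
  then have "real n * (R / (real m * (R + l))) \<le> real n * (1 / real (Suc m))"
    by (intro mult_left_mono) auto
  then have "poisson_weight (R + l) n * (1 - real n / real (Suc m)) \<le>
      poisson_weight (R + l) n * (1 - 1 / real m * real n * R / (R + l))"
    using assms by (intro mult_left_mono poisson_weight_nonneg) auto
  also have "\<dots> = (\<Sum>i\<le>n. poisson_weight R i * (1 - 1 / real m * real i) * poisson_weight l (n - i))"
    using assms by (intro poisson_weight_convolution_affine[symmetric]) auto
  finally show ?thesis by simp
qed

lemma ballot_weight_ge:
  assumes rates: "\<And>i. i < m \<Longrightarrow> 0 < r i" "\<And>i j. i \<le> j \<Longrightarrow> j < m \<Longrightarrow> r i \<le> r j"
    and "0 < m" "n \<le> m"
  shows "poisson_weight (\<Sum>i<m. r i) n * (1 - real n / real m) \<le> ballot_weight r m n"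
  using assms(3,4) rates
proof (induction m arbitrary: n rule: nat_induct_non_zero)
  case 1
  then show ?case
    by (cases "n = 0") (auto simp: ballot_weight_1[simplified] poisson_weight_def le_Suc_eq)
next
  case (Suc m)
  define R where "R = (\<Sum>i<m. r i)"
  have R_pos: "0 < R" unfolding R_def using Suc by (intro sum_pos) auto
  have R_le: "R \<le> real m * r m"
    unfolding R_def using sum_mono[of "{..<m}" r "\<lambda>_. r m"] Suc.prems by simp
  have last_pos: "0 < r m" using Suc.prems by simp
  show ?case
  proof (cases "n \<le> m")
    case True
    have "poisson_weight (R + r m) n * (1 - real n / real (Suc m)) \<le>
        (\<Sum>i\<le>n. poisson_weight R i * (1 - real i / real m) * poisson_weight (r m) (n - i))"
      using R_pos last_pos R_le Suc.hyps by (rule poisson_weight_convolution_affine_ge)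
    also have "\<dots> \<le> (\<Sum>i\<le>n. ballot_weight r m i * poisson_weight (r m) (n - i))"
      unfolding R_def using Suc.prems True last_pos
      by (intro sum_mono mult_right_mono Suc.IH poisson_weight_nonneg) (auto simp: less_imp_le)
    also have "\<dots> = ballot_weight r (Suc m) n"
      using Suc.hyps last_pos True by (intro ballot_weight_Suc[symmetric]) auto
    finally show ?thesis by (simp add: R_def)
  next
    case False
    then have "n = Suc m" using Suc.prems by simp
    then show ?thesis by (simp add: ballot_weight_def)
  qed
qed

lemma prob_right_law_Int_atMost:
  "measure_pmf.prob (right_law r m) A = measure_pmf.prob (right_law r m) (A \<inter> {..m})"
proof -
  have "A \<inter> set_pmf (right_law r m) = (A \<inter> {..m}) \<inter> set_pmf (right_law r m)"
    using pmf_right_law_above[of m _ r] by (auto simp: set_pmf_iff) (metis not_le)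
  then show ?thesis by (metis measure_Int_set_pmf)
qed

lemma prob_right_law_eq:
  assumes "0 \<notin> A"
  shows "measure_pmf.prob (right_law r m) A = (\<Sum>n\<in>{n. n < m \<and> m - n \<in> A}. ballot_weight r m n)"
proof -
  have "measure_pmf.prob (right_law r m) A = (\<Sum>g\<in>A \<inter> {..m}. pmf (right_law r m) g)"
    unfolding prob_right_law_Int_atMost[of r m A] by (rule measure_measure_pmf_finite) simp
  also have "\<dots> = (\<Sum>n\<in>{n. n < m \<and> m - n \<in> A}. ballot_weight r m n)"
    by (rule sum.reindex_bij_witness[where i = "\<lambda>n. m - n" and j = "\<lambda>g. m - g"])
      (use assms in \<open>auto simp: ballot_weight_def intro!: gr0I diff_less\<close>)
  finally show ?thesis .
qed

subsection \<open>Survival of the rightwalk\<close>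

lemma alive_prob_right_law_eq: "alive_prob (right_law r m) = (\<Sum>n<m. ballot_weight r m n)"
  unfolding alive_prob_def by (subst prob_right_law_eq) (auto intro!: sum.cong)

lemma alive_prob_right_law_le:
  assumes rates: "\<And>i. i < m \<Longrightarrow> 0 < r i" "\<And>i. i < m \<Longrightarrow> r 0 \<le> r i" and first_le_1: "r 0 \<le> 1"
    and m_pos: "0 < m"
  shows "alive_prob (right_law r m) \<le> 1 - r 0 + 1 / sqrt (real m)"
proof -
  define R where "R = (\<Sum>i<m. r i)"
  have first_pos: "0 < r 0" using rates m_pos by simp
  have R_ge: "r 0 * real m \<le> R"
    unfolding R_def using sum_mono[of "{..<m}" "\<lambda>_. r 0" r] rates by (simp add: mult.commute)
  have R_pos: "0 < R" using R_ge first_pos m_pos by (smt (verit) mult_pos_pos of_nat_0_less_iff)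
  have "alive_prob (right_law r m) \<le> (\<Sum>n<m. poisson_weight R n * (1 - r 0 / R * real n))"
    unfolding alive_prob_right_law_eq R_def using rates m_pos
    by (intro sum_mono ballot_weight_le) auto
  also have "\<dots> = (1 - r 0) * (\<Sum>n<m. 1 * poisson_weight R n) +
      r 0 / R * (\<Sum>n<m. (R - real n) * poisson_weight R n)"
    unfolding sum_distrib_left sum.distrib[symmetric] using R_pos
    by (intro sum.cong refl) (simp add: field_simps)
  also have "\<dots> \<le> (1 - r 0) * 1 + r 0 / R * sqrt R"
  proof (intro add_mono mult_left_mono poisson_weight_deficit_sum_le)
    show "(\<Sum>n<m. 1 * poisson_weight R n) \<le> 1"
      by (rule poisson_weight_sum_le[where g = "\<lambda>_. 1"]) (use R_pos poisson_weight_sums in auto)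
  qed (use R_pos first_le_1 first_pos in auto)
  also have "r 0 / R * sqrt R = r 0 / sqrt R"
    using R_pos real_div_sqrt[of R] by (simp add: field_simps)
  also have "r 0 / sqrt R \<le> 1 / sqrt (real m)"
  proof -
    have "r 0 * sqrt (real m) \<le> sqrt (r 0) * sqrt (real m)"
      using first_le_1 first_pos
      by (intro mult_right_mono) (auto simp: real_le_rsqrt power2_eq_square mult_left_le)
    also have "\<dots> \<le> sqrt R" using R_ge by (simp add: real_sqrt_mult[symmetric])
    finally show ?thesis using R_pos m_pos by (simp add: field_simps)
  qed
  finally show ?thesis by simp
qed

lemma alive_prob_right_law_ge:
  assumes rates: "\<And>i. i < m \<Longrightarrow> 0 < r i" "\<And>i j. i \<le> j \<Longrightarrow> j < m \<Longrightarrow> r i \<le> r j" and m_pos: "0 < m"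
  shows "1 - (\<Sum>i<m. r i) / m \<le> alive_prob (right_law r m)"
proof -
  define R where "R = (\<Sum>i<m. r i)"
  have R_pos: "0 < R" unfolding R_def using rates m_pos by (intro sum_pos) auto
  have "1 - R / m + 0 * R \<le> (\<Sum>n<m. (1 - real n / m) * poisson_weight R n)"
  proof (rule poisson_weight_sum_ge)
    show "1 - R / m + - 1 / m * (real n - R) + 0 * (real n - R)\<^sup>2 \<le>
        (if n \<in> {..<m} then 1 - real n / m else 0)" for n
      using m_pos by (simp add: field_simps)
  qed (use R_pos poisson_weight_sums_deviation[of "1 - R / m" "- 1 / m" R 0] in auto)
  also have "\<dots> \<le> alive_prob (right_law r m)"
    unfolding alive_prob_right_law_eq R_def using ballot_weight_ge[of m r] rates m_pos
    by (intro sum_mono) (auto simp: mult.commute)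
  finally show ?thesis by (simp add: R_def)
qed

lemma alive_near_right_law_ge:
  assumes rates: "\<And>i. i < m \<Longrightarrow> 0 < r i" "\<And>i j. i \<le> j \<Longrightarrow> j < m \<Longrightarrow> r i \<le> r j" and m_pos: "0 < m"
    and total_le: "(\<Sum>i<m. r i) \<le> real m" and x_pos: "0 < x"
  shows "(1 - (\<Sum>i<m. r i) / m) * (1 - (\<Sum>i<m. r i) / x\<^sup>2) - 1 / x \<le>
    alive_near (right_law r m) (walk_mean (- 1) r 0 m) x"
proof -
  define R where "R = (\<Sum>i<m. r i)"
  define near where "near = {n. \<bar>real n - R\<bar> \<le> x}"
  have R_bounds: "0 \<le> R" "R \<le> real m"
    unfolding R_def using rates total_le by (auto intro!: sum_nonneg simp: less_imp_le)
  have deviation: "\<bar>real m - real n - walk_mean (- 1) r 0 m\<bar> = \<bar>real n - R\<bar>" for n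
    by (simp add: walk_mean_def R_def sum_subtractf)
  have "1 / x * (R / m) \<le> 1 / x * 1" using R_bounds x_pos m_pos by (intro mult_left_mono) auto
  then have "(1 - R / m) * (1 - R / x\<^sup>2) - 1 / x \<le> (1 - R / m) * (1 - R / x\<^sup>2) + 1 / m * - (R / x)"
    by (simp add: mult.commute)
  also have "\<dots> \<le> (1 - R / m) * (\<Sum>n\<in>near. poisson_weight R n) +
      1 / m * (\<Sum>n\<in>near. (R - real n) * poisson_weight R n)"
    unfolding near_def using R_bounds x_pos m_pos
    by (intro add_mono mult_left_mono poisson_weight_chebyshev poisson_weight_deficit_sum_ge) auto
  also have "\<dots> = (\<Sum>n\<in>near. poisson_weight R n * (1 - real n / m))"
    unfolding sum_distrib_left sum.distrib[symmetric]
    by (intro sum.cong refl) (simp add: algebra_simps diff_divide_distrib)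
  also have "\<dots> = (\<Sum>n\<in>near - {n. n < m \<and> n \<in> near}. poisson_weight R n * (1 - real n / m)) +
      (\<Sum>n\<in>{n. n < m \<and> n \<in> near}. poisson_weight R n * (1 - real n / m))"
    by (rule sum.subset_diff) (auto simp: near_def finite_real_interval_nat)
  also have "(\<Sum>n\<in>near - {n. n < m \<and> n \<in> near}. poisson_weight R n * (1 - real n / m)) \<le> 0"
    using R_bounds m_pos
    by (intro sum_nonpos mult_nonneg_nonpos poisson_weight_nonneg) (auto simp: field_simps)
  also have "0 + (\<Sum>n\<in>{n. n < m \<and> n \<in> near}. poisson_weight R n * (1 - real n / m)) =
      (\<Sum>n\<in>{n. n < m \<and> n \<in> near}. poisson_weight R n * (1 - real n / m))"
    by simp
  also have "\<dots> \<le> (\<Sum>n\<in>{n. n < m \<and> n \<in> near}. ballot_weight r m n)"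
    unfolding R_def using rates m_pos by (intro sum_mono ballot_weight_ge) auto
  also have "\<dots> = alive_near (right_law r m) (walk_mean (- 1) r 0 m) x"
    unfolding alive_near_def
    by (subst prob_right_law_eq) (auto simp: near_def deviation intro!: sum.cong)
  finally show ?thesis by (simp only: R_def)
qed

subsection \<open>Duality\<close>

definition rev_rates :: "nat \<Rightarrow> (nat \<Rightarrow> real) \<Rightarrow> nat \<Rightarrow> real" where
  "rev_rates k r i = r (k - 1 - i)"

text \<open>The leftwalk with \<open>k\<close> steps hits zero exactly at its last step.\<close>

definition first_passage_weight :: "(nat \<Rightarrow> real) \<Rightarrow> nat \<Rightarrow> real" where
  "first_passage_weight r k = pmf (left_law r (k - 1)) 1 * exp (- r (k - 1))"

lemma sum_rev_rates:
  "n \<le> k \<Longrightarrow> (\<Sum>i<n. rev_rates k r i) = (\<Sum>i\<in>{k - n..<k}. r i)"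
  unfolding rev_rates_def
  by (rule sum.reindex_bij_witness[where i = "\<lambda>i. k - 1 - i" and j = "\<lambda>i. k - 1 - i"]) auto

lemma first_passage_weight_eq_sum:
  assumes rates: "\<And>i. i < k \<Longrightarrow> 0 < r i" and "t + j = k" "0 < j"
  shows "first_passage_weight r k =
    (\<Sum>g\<in>{1..j}. pmf (left_law r t) g * pmf (right_law (rev_rates k r) j) g)"
  using assms(3,2)
proof (induction j arbitrary: t rule: nat_induct_non_zero)
  case 1
  then have "t = k - 1" "0 < k" by auto
  then show ?case
    using pmf_right_law_1[of "rev_rates k r" 1] rates[of "k - 1"]
    by (simp add: first_passage_weight_def rev_rates_def)
next
  case (Suc j)
  let ?left = "left_law r" and ?right = "right_law (rev_rates k r)"
  let ?w = "\<lambda>g f. poisson_weight_int (r t) (1 + int f - int g)"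
  have rate_t: "rev_rates k r j = r t" "0 < r t"
    using Suc rates by (auto simp: rev_rates_def intro!: arg_cong[where f = r])
  have "first_passage_weight r k = (\<Sum>f\<in>{1..j}. pmf (?left (Suc t)) f * pmf (?right j) f)"
    using Suc.prems by (intro Suc.IH) auto
  also have "\<dots> = (\<Sum>f\<in>{1..j}. (\<Sum>g\<in>{1..Suc j}. pmf (?left t) g * ?w g f) * pmf (?right j) f)"
    using rate_t
    by (intro sum.cong refl) (subst pmf_killed_law_Suc[where N = "Suc j"], auto simp: add_diff_eq)
  also have "\<dots> = (\<Sum>f\<in>{1..j}. \<Sum>g\<in>{1..Suc j}. pmf (?left t) g * (pmf (?right j) f * ?w g f))"
    unfolding sum_distrib_right by (simp only: mult_ac)
  also have "\<dots> = (\<Sum>g\<in>{1..Suc j}. \<Sum>f\<in>{1..j}. pmf (?left t) g * (pmf (?right j) f * ?w g f))"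
    by (rule sum.swap)
  also have "\<dots> = (\<Sum>g\<in>{1..Suc j}. pmf (?left t) g * pmf (?right (Suc j)) g)"
    unfolding sum_distrib_left[symmetric] using rate_t Suc.hyps
    by (intro sum.cong refl) (subst pmf_right_law_Suc, auto)
  finally show ?case .
qed

section \<open>Bounds for the first passage weight\<close>

lemma left_law_add:
  "left_law r (m + n) = bind_pmf (left_law r m) (\<lambda>h. killed_law 1 (\<lambda>i. r (m + i)) h n)"
  by (rule poisson_chain_add)

lemma right_law_add:
  assumes "0 < m"
  shows "right_law r (m + n) =
    bind_pmf (right_law r m) (\<lambda>h. killed_law (- 1) (\<lambda>i. r (m + i)) h n)"
proof -
  have "(\<lambda>i. free_first_step (m + i)) = (\<lambda>_. killed_step (- 1))"
    using assms by (simp add: free_first_step_def fun_eq_iff)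
  then show ?thesis by (subst poisson_chain_add) simp
qed

lemma rev_rates_shift: "(\<lambda>i. rev_rates k r (m + i)) = rev_rates (k - m) r"
  by (simp add: rev_rates_def fun_eq_iff)

lemma sum_shifted_rates:
  fixes r :: "nat \<Rightarrow> real"
  assumes "m \<le> n"
  shows "(\<Sum>i<n - m. r (m + i)) = (\<Sum>i\<in>{m..<n}. r i)"
  by (simp add: sum.atLeastLessThan_shift_0[of r m n] atLeast0LessThan)

lemma pmf_bind_le_alive_prob:
  assumes "pmf (K 0) g = 0" "\<And>h. 0 < h \<Longrightarrow> pmf (K h) g \<le> S"
  shows "pmf (bind_pmf M K) g \<le> S * alive_prob M"
proof -
  have "(\<integral>h. pmf (K h) g \<partial>measure_pmf M) \<le> (\<integral>h. S * indicator {0<..} h \<partial>measure_pmf M)"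
  proof (rule integral_mono)
    show "integrable (measure_pmf M) (\<lambda>h. pmf (K h) g)"
      by (rule measure_pmf.integrable_const_bound[where B = 1]) (auto simp: pmf_le_1)
    show "integrable (measure_pmf M) (\<lambda>h. S * indicator {0<..} h)"
      by (rule measure_pmf.integrable_const_bound[where B = "\<bar>S\<bar>"]) (auto split: split_indicator)
    show "pmf (K h) g \<le> S * indicator {0<..} h" for h
      using assms by (cases "h = 0") auto
  qed
  then show ?thesis by (simp add: pmf_bind alive_prob_def)
qed

lemma sum_rates_segment_le:
  fixes r :: "nat \<Rightarrow> real"
  assumes "\<And>i. i < k \<Longrightarrow> 0 < r i" "b \<le> k"
  shows "(\<Sum>i\<in>{a..<b}. r i) \<le> (\<Sum>i<k. r i)"
  using assms by (intro sum_mono2) (auto simp: less_imp_le)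

lemma pmf_left_law_add_le:
  assumes rates: "\<And>i. i < m + n \<Longrightarrow> 0 < r i" and "0 < g"
    and bounded: "\<And>i. poisson_weight_int (\<Sum>i<n. r (m + i)) i \<le> S"
  shows "pmf (left_law r (m + n)) g \<le> S * alive_prob (left_law r m)"
  unfolding left_law_add
proof (rule pmf_bind_le_alive_prob)
  show "pmf (killed_law 1 (\<lambda>i. r (m + i)) 0 n) g = 0"
    using assms(2) by (simp add: killed_law_0)
  fix h :: nat
  have "pmf (killed_law 1 (\<lambda>i. r (m + i)) h n) g \<le>
      poisson_weight_int (\<Sum>i<n. r (m + i)) (int n + 1 * (int g - int h))"
    using assms(2) rates by (intro pmf_killed_law_le) auto
  also have "\<dots> \<le> S" by (rule bounded)
  finally show "pmf (killed_law 1 (\<lambda>i. r (m + i)) h n) g \<le> S" .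
qed

lemma first_passage_weight_le:
  assumes rates: "\<And>i. i < k \<Longrightarrow> 0 < r i" and total: "(\<Sum>i<k. r i) = real (k - 1)"
    and block: "0 < m" "2 * m \<le> k" and mass: "1 \<le> N" "real N \<le> (\<Sum>i\<in>{m..<k - m}. r i)"
  shows "first_passage_weight r k \<le> sqrt (real (k - 1) / real N) * poisson_peak (k - 1) *
    alive_prob (left_law r m) * alive_prob (right_law (rev_rates k r) m)"
proof -
  let ?right = "right_law (rev_rates k r) m"
  define S where "S = sqrt (real (k - 1) / real N) * poisson_peak (k - 1)"
  have S_nonneg: "0 \<le> S" using poisson_peak_pos[of "k - 1"] by (simp add: S_def)
  have "(\<Sum>i<k - m - m. r (m + i)) = (\<Sum>i\<in>{m..<k - m}. r i)"
    using block by (intro sum_shifted_rates) auto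
  then have "poisson_weight_int (\<Sum>i<k - m - m. r (m + i)) i \<le> S" for i
    unfolding S_def using mass rates total sum_rates_segment_le[of k r "k - m" m]
    by (intro poisson_weight_int_le_peak) auto
  then have left: "pmf (left_law r (k - m)) g \<le> S * alive_prob (left_law r m)" if "0 < g" for g
    using pmf_left_law_add_le[of m "k - m - m" r g S] rates block that by simp
  have "first_passage_weight r k = (\<Sum>g\<in>{1..m}. pmf (left_law r (k - m)) g * pmf ?right g)"
    using block rates by (intro first_passage_weight_eq_sum) auto
  also have "\<dots> \<le> (\<Sum>g\<in>{1..m}. (S * alive_prob (left_law r m)) * pmf ?right g)"
    by (intro sum_mono mult_right_mono left) auto
  also have "\<dots> = S * alive_prob (left_law r m) * measure_pmf.prob ?right {1..m}"
    by (simp add: sum_distrib_left measure_measure_pmf_finite)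
  also have "\<dots> \<le> S * alive_prob (left_law r m) * alive_prob ?right"
    unfolding alive_prob_def[of ?right] using S_nonneg
    by (intro mult_left_mono measure_pmf.finite_measure_mono mult_nonneg_nonneg
        alive_prob_nonneg) auto
  finally show ?thesis by (simp only: S_def)
qed

subsection \<open>Bridges between killed walks\<close>

definition alive_weight :: "nat pmf \<Rightarrow> int \<Rightarrow> real" where
  "alive_weight K g = (if 0 < g then pmf K (nat g) else 0)"

definition free_law :: "int \<Rightarrow> real \<Rightarrow> nat \<Rightarrow> nat \<Rightarrow> int pmf" where
  "free_law \<sigma> R h n = map_pmf (\<lambda>z. int h + \<sigma> * (int z - int n)) (poisson_pmf R)"

lemma pmf_free_law:
  assumes "0 < R" "\<bar>\<sigma>\<bar> = 1"
  shows "pmf (free_law \<sigma> R h n) g = poisson_weight_int R (int n + \<sigma> * (g - int h))"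
proof -
  have "\<sigma> = 1 \<or> \<sigma> = - 1" using assms by linarith
  then have "(\<lambda>z. int h + \<sigma> * (int z - int n)) -` {g} =
      (if int n + \<sigma> * (g - int h) < 0 then {} else {nat (int n + \<sigma> * (g - int h))})"
    by auto
  then show ?thesis
    using assms
    by (simp add: free_law_def pmf_map measure_pmf_single poisson_weight_int_def
        pmf_poisson_eq_weight del: pmf_poisson)
qed

lemma sum_lost_weight_le:
  assumes dominated: "\<And>g. 0 < g \<Longrightarrow> pmf K g \<le> pmf Q (int g)" and "finite I"
  shows "(\<Sum>g\<in>I. pmf Q g - alive_weight K g) \<le> pmf K 0"
proof -
  let ?K = "map_pmf int K" and ?pos = "{g. 0 < g \<and> g \<in> I}" and ?out = "{g. 0 < g \<and> g \<notin> I}"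
  have pmf_K: "pmf ?K g = pmf K (nat g)" if "0 \<le> g" for g
    using pmf_map_inj'[of int K "nat g"] that by simp
  have K_le_Q: "pmf ?K g \<le> pmf Q g" if "0 < g" for g
    using pmf_K[of g] dominated[of "nat g"] that by simp
  have "emeasure ?K ?out \<le> emeasure Q ?out"
    unfolding nn_integral_pmf[symmetric]
    by (intro nn_integral_mono ennreal_leI) (auto simp: K_le_Q)
  then have out: "measure ?K ?out \<le> measure Q (- I)"
    unfolding measure_pmf.emeasure_eq_measure
    using measure_pmf.finite_measure_mono[of ?out "- I" Q] by (auto intro: order_trans)
  have free: "(\<Sum>g\<in>I. pmf Q g) = 1 - measure Q (- I)"
    using assms(2) measure_pmf.prob_compl[of I Q]
    by (simp add: measure_measure_pmf_finite Compl_eq_Diff_UNIV)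
  have "(\<Sum>g\<in>I. alive_weight K g) = (\<Sum>g\<in>?pos. pmf ?K g)"
    using assms(2)
    by (auto simp: alive_weight_def pmf_K intro!: sum.mono_neutral_cong_right split: if_splits)
  also have "\<dots> = measure ?K ?pos"
    using assms(2) by (simp add: measure_measure_pmf_finite del: measure_map_pmf)
  also have "\<dots> = measure ?K (?pos \<union> ?out) - measure ?K ?out"
    by (subst measure_pmf.finite_measure_Union) auto
  also have "measure ?K (?pos \<union> ?out) = alive_prob K"
    by (auto simp: alive_prob_def intro!: arg_cong[where f = "measure_pmf.prob K"])
  finally show ?thesis
    using free out by (simp add: sum_subtractf alive_prob_eq)
qed

lemma sum_alive_weight_product_ge:
  assumes K_bounds: "\<And>g. 0 < g \<Longrightarrow> pmf K g \<le> pmf Q (int g)" "\<And>g. pmf Q g \<le> S"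
    and K'_bounds: "\<And>g. 0 < g \<Longrightarrow> pmf K' g \<le> pmf Q' (int g)" "\<And>g. pmf Q' g \<le> S"
    and finite_I: "finite I"
  shows "(\<Sum>g\<in>I. pmf Q g * pmf Q' g) - S * (pmf K 0 + pmf K' 0) \<le>
    (\<Sum>g\<in>I. alive_weight K g * alive_weight K' g)"
proof -
  have S_nonneg: "0 \<le> S" using K_bounds(2)[of 0] pmf_nonneg[of Q 0] by linarith
  have alive_weight_le: "alive_weight K g \<le> pmf Q g" "alive_weight K' g \<le> pmf Q' g" for g
    using K_bounds(1)[of "nat g"] K'_bounds(1)[of "nat g"] by (auto simp: alive_weight_def)
  have "pmf Q g * pmf Q' g - alive_weight K g * alive_weight K' g \<le>
      S * (pmf Q g - alive_weight K g) + S * (pmf Q' g - alive_weight K' g)" for g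
  proof -
    have "pmf Q' g * (pmf Q g - alive_weight K g) \<le> S * (pmf Q g - alive_weight K g)"
      using K'_bounds(2) alive_weight_le by (intro mult_right_mono) auto
    moreover have "alive_weight K g * (pmf Q' g - alive_weight K' g) \<le>
        S * (pmf Q' g - alive_weight K' g)"
      using K_bounds(2)[of g] alive_weight_le[of g] by (intro mult_right_mono) auto
    ultimately show ?thesis by (simp add: algebra_simps)
  qed
  then have "(\<Sum>g\<in>I. pmf Q g * pmf Q' g - alive_weight K g * alive_weight K' g) \<le>
      (\<Sum>g\<in>I. S * (pmf Q g - alive_weight K g) + S * (pmf Q' g - alive_weight K' g))"
    by (intro sum_mono)
  also have "\<dots> = S * ((\<Sum>g\<in>I. pmf Q g - alive_weight K g) + (\<Sum>g\<in>I. pmf Q' g - alive_weight K' g))"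
    by (simp add: sum.distrib sum_distrib_left distrib_left)
  also have "\<dots> \<le> S * (pmf K 0 + pmf K' 0)"
    using S_nonneg finite_I K_bounds(1) K'_bounds(1)
    by (intro mult_left_mono add_mono sum_lost_weight_le)
  finally show ?thesis by (simp add: sum_subtractf)
qed

lemma sum_alive_weight_product_le:
  assumes "finite I" "I \<subseteq> {..int N}"
  shows "(\<Sum>g\<in>I. alive_weight K g * alive_weight K' g) \<le> (\<Sum>g\<in>{1..N}. pmf K g * pmf K' g)"
proof -
  have "I \<inter> {0<..} \<subseteq> int ` {1..N}"
  proof
    fix g assume "g \<in> I \<inter> {0<..}"
    then show "g \<in> int ` {1..N}"
      using assms(2) by (intro image_eqI[of g int "nat g"]) auto
  qed
  moreover have "(\<Sum>g\<in>I. alive_weight K g * alive_weight K' g) =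
      (\<Sum>g\<in>I \<inter> {0<..}. alive_weight K g * alive_weight K' g)"
    using assms(1) by (intro sum.mono_neutral_right) (auto simp: alive_weight_def)
  ultimately have "(\<Sum>g\<in>I. alive_weight K g * alive_weight K' g) \<le>
      (\<Sum>g\<in>int ` {1..N}. alive_weight K g * alive_weight K' g)"
    by (simp, intro sum_mono2) (auto simp: alive_weight_def)
  also have "\<dots> = (\<Sum>g\<in>{1..N}. pmf K g * pmf K' g)"
    by (subst sum.reindex) (auto simp: alive_weight_def)
  finally show ?thesis .
qed

lemma sum_pmf_free_law_product:
  assumes "0 < R" "0 < R'"
  shows "(\<Sum>g\<in>{int h - int n..int h' + int n'}.
      pmf (free_law 1 R h n) g * pmf (free_law (- 1) R' h' n') g) =
    poisson_weight_int (R + R') (int n + int n' + int h' - int h)"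
proof -
  have "(\<Sum>g\<in>{int h - int n..int h' + int n'}.
      pmf (free_law 1 R h n) g * pmf (free_law (- 1) R' h' n') g) =
      (\<Sum>i\<in>{0..int n + int n' + int h' - int h}.
        poisson_weight_int R i * poisson_weight_int R' (int n + int n' + int h' - int h - i))"
    by (rule sum.reindex_bij_witness[where
          i = "\<lambda>i. i + int h - int n" and j = "\<lambda>g. int n + g - int h"])
      (auto simp: pmf_free_law assms algebra_simps)
  then show ?thesis by (simp add: poisson_weight_int_convolution)
qed

lemma killed_bridge_ge:
  assumes rates: "\<And>i. i < n \<Longrightarrow> 1 \<le> r i"
    and rates': "\<And>i. i < n' \<Longrightarrow> 0 < r' i" "\<And>i. i < n' \<Longrightarrow> r' i \<le> 1"
    and steps: "0 < n" "0 < n'" and X_range: "0 < X" "X \<le> real h" "X \<le> real h'"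
    and bounded: "\<And>i. poisson_weight_int (\<Sum>i<n. r i) i \<le> S"
      "\<And>i. poisson_weight_int (\<Sum>i<n'. r' i) i \<le> S"
  shows "poisson_weight_int ((\<Sum>i<n. r i) + (\<Sum>i<n'. r' i)) (int n + int n' + int h' - int h) -
      S * (((\<Sum>i<n. r i) + (\<Sum>i<n'. r' i)) / X\<^sup>2) \<le>
    (\<Sum>g\<in>{1..h' + n'}. pmf (killed_law 1 r h n) g * pmf (killed_law (- 1) r' h' n') g)"
proof -
  define R R' where "R = (\<Sum>i<n. r i)" and "R' = (\<Sum>i<n'. r' i)"
  have rates_pos: "0 < r i" if "i < n" for i using rates[OF that] by simp
  have R_pos: "0 < R" "0 < R'"
    unfolding R_def R'_def using rates_pos rates' steps by (auto intro!: sum_pos)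
  let ?K = "killed_law 1 r h n" and ?K' = "killed_law (- 1) r' h' n'"
  let ?Q = "free_law 1 R h n" and ?Q' = "free_law (- 1) R' h' n'"
  define I where "I = {int h - int n..int h' + int n'}"
  have "0 \<le> S"
    using bounded(1)[of 0] poisson_weight_int_nonneg[of R 0] R_pos by (simp add: R_def)
  then have "S * (pmf ?K 0 + pmf ?K' 0) \<le> S * ((R + R') / X\<^sup>2)"
    unfolding R_def R'_def add_divide_distrib using rates rates_pos rates' X_range
    by (intro mult_left_mono add_mono killed_law_dead_le) auto
  moreover have "(\<Sum>g\<in>I. pmf ?Q g * pmf ?Q' g) - S * (pmf ?K 0 + pmf ?K' 0) \<le>
      (\<Sum>g\<in>I. alive_weight ?K g * alive_weight ?K' g)"
  proof (rule sum_alive_weight_product_ge)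
    show "pmf ?K g \<le> pmf ?Q (int g)" if "0 < g" for g
      using pmf_killed_law_le[of n r g 1 h] rates_pos that R_pos by (simp add: pmf_free_law R_def)
    show "pmf ?K' g \<le> pmf ?Q' (int g)" if "0 < g" for g
      using pmf_killed_law_le[of n' r' g "- 1" h'] rates' that R_pos
      by (simp add: pmf_free_law R'_def)
  qed (use bounded R_pos in \<open>auto simp: pmf_free_law I_def R_def R'_def\<close>)
  moreover have "(\<Sum>g\<in>I. alive_weight ?K g * alive_weight ?K' g) \<le>
      (\<Sum>g\<in>{1..h' + n'}. pmf ?K g * pmf ?K' g)"
    by (rule sum_alive_weight_product_le) (auto simp: I_def)
  ultimately show ?thesis
    unfolding I_def sum_pmf_free_law_product[OF R_pos] unfolding R_def R'_def by linarith
qed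

lemma pmf_bind_ge_sum:
  assumes "finite H"
  shows "(\<Sum>h\<in>H. pmf M h * pmf (K h) g) \<le> pmf (bind_pmf M K) g"
proof -
  have "(\<Sum>h\<in>H. pmf M h * pmf (K h) g) = (\<integral>h. pmf (K h) g * indicator H h \<partial>measure_pmf M)"
    using assms
    by (subst integral_measure_pmf_real[of H])
      (auto simp: mult.commute indicator_def split: if_splits)
  also have "\<dots> \<le> (\<integral>h. pmf (K h) g \<partial>measure_pmf M)"
    by (intro integral_mono measure_pmf.integrable_const_bound[where B = 1])
      (auto simp: pmf_le_1 split: split_indicator)
  finally show ?thesis by (simp add: pmf_bind)
qed

lemma sum_bind_pmf_product_ge:
  assumes "finite H" "finite H'"
    and E_le: "\<And>h h'. h \<in> H \<Longrightarrow> h' \<in> H' \<Longrightarrow> E \<le> (\<Sum>g\<in>A. pmf (K h) g * pmf (K' h') g)"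
  shows "measure_pmf.prob M H * measure_pmf.prob M' H' * E \<le>
    (\<Sum>g\<in>A. pmf (bind_pmf M K) g * pmf (bind_pmf M' K') g)"
proof -
  have "measure_pmf.prob M H * measure_pmf.prob M' H' * E =
      (\<Sum>h\<in>H. \<Sum>h'\<in>H'. pmf M h * pmf M' h' * E)"
    unfolding measure_measure_pmf_finite[OF assms(1)] measure_measure_pmf_finite[OF assms(2)]
      sum_product by (simp only: sum_distrib_right)
  also have "\<dots> \<le> (\<Sum>h\<in>H. \<Sum>h'\<in>H'. pmf M h * pmf M' h' * (\<Sum>g\<in>A. pmf (K h) g * pmf (K' h') g))"
    by (intro sum_mono mult_left_mono E_le) auto
  also have "\<dots> = (\<Sum>h\<in>H. \<Sum>h'\<in>H'. \<Sum>g\<in>A. (pmf M h * pmf (K h) g) * (pmf M' h' * pmf (K' h') g))"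
    by (simp add: sum_distrib_left mult_ac)
  also have "\<dots> = (\<Sum>h\<in>H. \<Sum>g\<in>A. \<Sum>h'\<in>H'. (pmf M h * pmf (K h) g) * (pmf M' h' * pmf (K' h') g))"
    by (intro sum.cong refl sum.swap)
  also have "\<dots> = (\<Sum>g\<in>A. \<Sum>h\<in>H. \<Sum>h'\<in>H'. (pmf M h * pmf (K h) g) * (pmf M' h' * pmf (K' h') g))"
    by (rule sum.swap)
  also have "\<dots> = (\<Sum>g\<in>A. (\<Sum>h\<in>H. pmf M h * pmf (K h) g) * (\<Sum>h'\<in>H'. pmf M' h' * pmf (K' h') g))"
    by (simp only: sum_product)
  also have "\<dots> \<le> (\<Sum>g\<in>A. pmf (bind_pmf M K) g * pmf (bind_pmf M' K') g)"
    using assms(1,2) by (intro sum_mono mult_mono pmf_bind_ge_sum sum_nonneg) auto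
  finally show ?thesis .
qed

lemma sum_middle_rates_eq:
  assumes "(\<Sum>i<k. r i) = real (k - 1)" "2 * m \<le> k" "1 \<le> k"
  shows "(\<Sum>i\<in>{m..<k - m}. r i) =
    real k - 2 * real m - walk_mean 1 r 1 m + walk_mean (- 1) (rev_rates k r) 0 m"
proof -
  have "(\<Sum>i\<in>{0..<m}. r i) + (\<Sum>i\<in>{m..<k - m}. r i) + (\<Sum>i\<in>{k - m..<k}. r i) = (\<Sum>i\<in>{0..<k}. r i)"
    using assms by (simp add: sum.atLeastLessThan_concat)
  moreover have "(\<Sum>i<m. rev_rates k r i) = (\<Sum>i\<in>{k - m..<k}. r i)"
    using assms by (intro sum_rev_rates) auto
  ultimately show ?thesis
    using assms by (simp add: walk_mean_def sum_subtractf atLeast0LessThan of_nat_diff)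
qed

context
  fixes r :: "nat \<Rightarrow> real" and k m s N :: nat and x X :: real
  assumes rates_pos: "\<And>i. i < k \<Longrightarrow> 0 < r i" and total: "(\<Sum>i<k. r i) = real (k - 1)"
    and block: "0 < m" "m \<le> s" "s \<le> k - m" "m \<le> k"
    and rates_ge_1: "\<And>i. i < s \<Longrightarrow> 1 \<le> r i" and rates_le_1: "\<And>i. s \<le> i \<Longrightarrow> i < k \<Longrightarrow> r i \<le> 1"
    and mass: "1 \<le> N" "real N \<le> (\<Sum>i\<in>{m..<s}. r i)" "real N \<le> (\<Sum>i\<in>{s..<k - m}. r i)"
    and x_range: "0 < x" "2 * x \<le> (\<Sum>i\<in>{m..<k - m}. r i)"
    and X_range: "0 < X" "X + x \<le> walk_mean 1 r 1 m"
      "X + x \<le> walk_mean (- 1) (rev_rates k r) 0 m"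
begin

lemma sum_up_rates: "(\<Sum>i<s - m. r (m + i)) = (\<Sum>i\<in>{m..<s}. r i)"
  using block by (intro sum_shifted_rates) auto

lemma sum_down_rates: "(\<Sum>i<k - s - m. rev_rates (k - m) r i) = (\<Sum>i\<in>{s..<k - m}. r i)"
proof -
  have "k - m - (k - s - m) = s" using block by auto
  then show ?thesis using sum_rev_rates[of "k - s - m" "k - m" r] block by simp
qed

lemma sum_up_down_rates:
  "(\<Sum>i<s - m. r (m + i)) + (\<Sum>i<k - s - m. rev_rates (k - m) r i) = (\<Sum>i\<in>{m..<k - m}. r i)"
  unfolding sum_up_rates sum_down_rates
  using block by (intro sum.atLeastLessThan_concat) auto

lemma segment_le_total: "b \<le> k \<Longrightarrow> (\<Sum>i\<in>{a..<b}. r i) \<le> real (k - 1)"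
  using sum_rates_segment_le[of k r b a] rates_pos total by simp

lemma free_bridge_ge:
  assumes left_end: "0 < h" "\<bar>real h - walk_mean 1 r 1 m\<bar> \<le> x"
    and right_end: "h' \<le> m" "\<bar>real h' - walk_mean (- 1) (rev_rates k r) 0 m\<bar> \<le> x"
  shows "poisson_peak (k - 1) * exp (- (2 * x)\<^sup>2 / (\<Sum>i\<in>{m..<k - m}. r i)) \<le>
    poisson_weight_int (\<Sum>i\<in>{m..<k - m}. r i)
      (int (s - m) + int (k - s - m) + int h' - int h)"
proof -
  define d where "d = int (s - m) + int (k - s - m) + int h' - int h"
  have d_eq: "d = int k - 2 * int m + int h' - int h"
    unfolding d_def using block by auto
  have d_le: "d \<le> int (k - 1)" unfolding d_eq using left_end(1) right_end(1) block by auto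
  have "(\<Sum>i\<in>{m..<k - m}. r i) =
      real k - 2 * real m - walk_mean 1 r 1 m + walk_mean (- 1) (rev_rates k r) 0 m"
    using total block by (intro sum_middle_rates_eq) auto
  then have d_near: "\<bar>(\<Sum>i\<in>{m..<k - m}. r i) - real_of_int d\<bar> \<le> 2 * x"
    unfolding d_eq using left_end(2) right_end(2) by simp
  then have "0 \<le> real_of_int d" using x_range(2) by linarith
  then show ?thesis
    unfolding d_def[symmetric] using d_near d_le x_range
    by (intro poisson_weight_ge_peak_near_mean) auto
qed

lemma middle_bridge_ge:
  assumes left_end: "0 < h" "\<bar>real h - walk_mean 1 r 1 m\<bar> \<le> x"
    and right_end: "h' \<le> m" "\<bar>real h' - walk_mean (- 1) (rev_rates k r) 0 m\<bar> \<le> x"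
  shows "poisson_peak (k - 1) * (exp (- (2 * x)\<^sup>2 / (\<Sum>i\<in>{m..<k - m}. r i)) -
      real (k - 1) / X\<^sup>2 * sqrt (real (k - 1) / real N)) \<le>
    (\<Sum>g\<in>{1..k - s}. pmf (killed_law 1 (\<lambda>i. r (m + i)) h (s - m)) g *
      pmf (killed_law (- 1) (rev_rates (k - m) r) h' (k - s - m)) g)"
proof -
  let ?K = "killed_law 1 (\<lambda>i. r (m + i)) h (s - m)"
  let ?K' = "killed_law (- 1) (rev_rates (k - m) r) h' (k - s - m)"
  define \<mu> where "\<mu> = (\<Sum>i\<in>{m..<k - m}. r i)"
  define S where "S = sqrt (real (k - 1) / real N) * poisson_peak (k - 1)"
  have S_nonneg: "0 \<le> S" using poisson_peak_pos[of "k - 1"] by (simp add: S_def)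
  have "m \<noteq> s" "s \<noteq> k - m" using mass by (intro notI; simp)+
  then have steps: "0 < s - m" "0 < k - s - m" using block by auto
  have "poisson_weight_int ((\<Sum>i<s - m. r (m + i)) + (\<Sum>i<k - s - m. rev_rates (k - m) r i))
        (int (s - m) + int (k - s - m) + int h' - int h) -
      S * (((\<Sum>i<s - m. r (m + i)) + (\<Sum>i<k - s - m. rev_rates (k - m) r i)) / X\<^sup>2) \<le>
      (\<Sum>g\<in>{1..h' + (k - s - m)}. pmf ?K g * pmf ?K' g)"
  proof (rule killed_bridge_ge)
    show "poisson_weight_int (\<Sum>i<s - m. r (m + i)) i \<le> S"
      "poisson_weight_int (\<Sum>i<k - s - m. rev_rates (k - m) r i) i \<le> S" for i
      unfolding S_def sum_up_rates sum_down_rates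
      using mass block segment_le_total[of s m] segment_le_total[of "k - m" s]
      by (intro poisson_weight_int_le_peak; simp)+
    show "X \<le> real h" "X \<le> real h'" using X_range left_end(2) right_end(2) by auto
  qed (use rates_ge_1 rates_le_1 rates_pos X_range block steps in \<open>auto simp: rev_rates_def\<close>)
  also have "\<dots> \<le> (\<Sum>g\<in>{1..k - s}. pmf ?K g * pmf ?K' g)"
    using right_end(1) block by (intro sum_mono2) auto
  finally have "poisson_weight_int \<mu> (int (s - m) + int (k - s - m) + int h' - int h) -
      S * (\<mu> / X\<^sup>2) \<le> (\<Sum>g\<in>{1..k - s}. pmf ?K g * pmf ?K' g)"
    by (simp only: sum_up_down_rates \<mu>_def)
  moreover have "S * (\<mu> / X\<^sup>2) \<le> S * (real (k - 1) / X\<^sup>2)"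
    unfolding \<mu>_def using S_nonneg block
    by (intro mult_left_mono divide_right_mono segment_le_total) auto
  ultimately show ?thesis
    using free_bridge_ge[OF assms] unfolding \<mu>_def[symmetric]
    by (simp add: S_def algebra_simps)
qed

lemma first_passage_weight_ge:
  "alive_near (left_law r m) (walk_mean 1 r 1 m) x *
      alive_near (right_law (rev_rates k r) m) (walk_mean (- 1) (rev_rates k r) 0 m) x *
      (poisson_peak (k - 1) * (exp (- (2 * x)\<^sup>2 / (\<Sum>i\<in>{m..<k - m}. r i)) -
        real (k - 1) / X\<^sup>2 * sqrt (real (k - 1) / real N)))
    \<le> first_passage_weight r k"
proof -
  define H where "H = {h. 0 < h \<and> \<bar>real h - walk_mean 1 r 1 m\<bar> \<le> x}"
  define H' where
    "H' = {h. 0 < h \<and> \<bar>real h - walk_mean (- 1) (rev_rates k r) 0 m\<bar> \<le> x} \<inter> {..m}"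
  have finite: "finite H" "finite H'"
    using finite_subset[OF _ finite_real_interval_nat[of "walk_mean 1 r 1 m" x], of H]
    by (auto simp: H_def H'_def)
  have near: "alive_near (left_law r m) (walk_mean 1 r 1 m) x = measure_pmf.prob (left_law r m) H"
    "alive_near (right_law (rev_rates k r) m) (walk_mean (- 1) (rev_rates k r) 0 m) x =
      measure_pmf.prob (right_law (rev_rates k r) m) H'"
    unfolding alive_near_def H_def H'_def by (simp, rule prob_right_law_Int_atMost)
  have left: "left_law r s =
      bind_pmf (left_law r m) (\<lambda>h. killed_law 1 (\<lambda>i. r (m + i)) h (s - m))"
    using left_law_add[of r m "s - m"] block by simp
  have right: "right_law (rev_rates k r) (k - s) = bind_pmf (right_law (rev_rates k r) m)
      (\<lambda>h. killed_law (- 1) (rev_rates (k - m) r) h (k - s - m))"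
    using right_law_add[of m "rev_rates k r" "k - s - m"] block by (simp add: rev_rates_shift)
  have "first_passage_weight r k =
      (\<Sum>g\<in>{1..k - s}. pmf (left_law r s) g * pmf (right_law (rev_rates k r) (k - s)) g)"
    using block rates_pos by (intro first_passage_weight_eq_sum) auto
  then show ?thesis
    unfolding near left right
    by (simp only:) (intro sum_bind_pmf_product_ge finite middle_bridge_ge; simp add: H_def H'_def)
qed

end

section \<open>Trees and parking functions\<close>

definition parking :: "nat \<Rightarrow> 'a set \<Rightarrow> ('a \<Rightarrow> nat) set" where
  "parking t J = {T \<in> PiE_dflt J 0 (\<lambda>_. {1..t}). \<forall>u\<in>{1..t}. u \<le> card {j \<in> J. T j \<le> u}}"

lemma finite_parking: "finite J \<Longrightarrow> finite (parking t J)"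
  unfolding parking_def
  by (intro finite_Collect_conjI disjI1 finite_PiE_dflt) (auto simp: Collect_mem_eq)

lemma parking_0: "parking 0 J = (if J = {} then {\<lambda>_. 0} else {})"
  by (auto simp: parking_def PiE_dflt_def)

lemma parking_eq_empty:
  assumes "finite J" "card J < t"
  shows "parking t J = {}"
proof -
  have "T \<notin> parking t J" for T
  proof
    assume "T \<in> parking t J"
    then have "t \<le> card {j \<in> J. T j \<le> t}" using assms by (simp add: parking_def)
    also have "\<dots> \<le> card J" using assms by (intro card_mono) auto
    finally show False using assms by simp
  qed
  then show ?thesis by auto
qed

definition fill_bin :: "nat \<Rightarrow> 'a set \<Rightarrow> ('a \<Rightarrow> nat) \<Rightarrow> 'a \<Rightarrow> nat" where
  "fill_bin t I T = (\<lambda>j. if j \<in> I then t else T j)"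

lemma parkingD:
  assumes "T \<in> parking t J"
  shows "j \<in> J \<Longrightarrow> 1 \<le> T j \<and> T j \<le> t" "j \<notin> J \<Longrightarrow> T j = 0"
  using assms by (auto simp: parking_def PiE_dflt_def)

lemma fill_bin_parking:
  assumes balls: "finite J" "Suc t \<le> card J" "I \<subseteq> J" and T_mem: "T \<in> parking t (J - I)"
  shows "fill_bin (Suc t) I T \<in> parking (Suc t) J"
    and "{j \<in> J. fill_bin (Suc t) I T j = Suc t} = I"
proof -
  have "u \<le> card {j \<in> J. fill_bin (Suc t) I T j \<le> u}" if u_range: "u \<in> {1..Suc t}" for u
  proof (cases "u \<le> t")
    case True
    then have "{j \<in> J. fill_bin (Suc t) I T j \<le> u} = {j \<in> J - I. T j \<le> u}"
      by (auto simp: fill_bin_def)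
    then show ?thesis using T_mem u_range True by (auto simp: parking_def)
  next
    case False
    then have "{j \<in> J. fill_bin (Suc t) I T j \<le> u} = J"
      using parkingD(1)[OF T_mem] u_range by (force simp: fill_bin_def)
    then show ?thesis using u_range balls by simp
  qed
  then show "fill_bin (Suc t) I T \<in> parking (Suc t) J"
    using parkingD[OF T_mem] balls(3)
    by (auto simp: parking_def PiE_dflt_def fill_bin_def le_SucI)
  have "T j \<noteq> Suc t" for j
    using parkingD[OF T_mem, of j] by (cases "j \<in> J - I") auto
  then show "{j \<in> J. fill_bin (Suc t) I T j = Suc t} = I"
    using balls(3) by (auto simp: fill_bin_def)
qed

lemma parking_Suc_fibre:
  assumes balls: "finite J" "Suc t \<le> card J" "I \<subseteq> J"
  shows "{T \<in> parking (Suc t) J. {j \<in> J. T j = Suc t} = I} =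
    fill_bin (Suc t) I ` parking t (J - I)"
proof (intro equalityI subsetI)
  fix T assume "T \<in> {T \<in> parking (Suc t) J. {j \<in> J. T j = Suc t} = I}"
  then have T_mem: "T \<in> parking (Suc t) J" "{j \<in> J. T j = Suc t} = I" by auto
  then have bins: "j \<in> I \<Longrightarrow> T j = Suc t" "j \<in> J - I \<Longrightarrow> 1 \<le> T j \<and> T j \<le> t" for j
    using parkingD(1)[OF T_mem(1), of j] by (auto simp: le_Suc_eq)
  have "{j \<in> J - I. fill_bin 0 I T j \<le> u} = {j \<in> J. T j \<le> u}" if "u \<in> {1..t}" for u
    using that bins(1) by (force simp: fill_bin_def)
  then have "fill_bin 0 I T \<in> parking t (J - I)"
    using T_mem(1) bins parkingD(2)[OF T_mem(1)] balls(3)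
    by (auto simp: parking_def PiE_dflt_def fill_bin_def)
  moreover have "T = fill_bin (Suc t) I (fill_bin 0 I T)"
    using bins(1) by (auto simp: fill_bin_def fun_eq_iff)
  ultimately show "T \<in> fill_bin (Suc t) I ` parking t (J - I)"
    by (intro image_eqI[of T _ "fill_bin 0 I T"])
qed (use fill_bin_parking[OF balls] in auto)

lemma inj_on_fill_bin: "inj_on (fill_bin s I) (parking t (J - I))"
proof (intro inj_onI ext)
  fix T T' j
  assume T_mem: "T \<in> parking t (J - I)" "T' \<in> parking t (J - I)"
    and maps_eq: "fill_bin s I T = fill_bin s I T'"
  show "T j = T' j"
    using fun_cong[OF maps_eq, of j] parkingD(2)[OF T_mem(1)] parkingD(2)[OF T_mem(2)]
    by (cases "j \<in> I") (auto simp: fill_bin_def)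
qed

lemma sum_parking_Suc:
  fixes w :: "nat \<Rightarrow> real"
  assumes balls: "finite J" "Suc t \<le> card J"
  shows "(\<Sum>T\<in>parking (Suc t) J. \<Prod>j\<in>J. w (T j)) =
    (\<Sum>I\<in>Pow J. w (Suc t) ^ card I * (\<Sum>T\<in>parking t (J - I). \<Prod>j\<in>J - I. w (T j)))"
proof -
  have fibre: "(\<Sum>T\<in>{T \<in> parking (Suc t) J. {j \<in> J. T j = Suc t} = I}. \<Prod>j\<in>J. w (T j)) =
      w (Suc t) ^ card I * (\<Sum>T\<in>parking t (J - I). \<Prod>j\<in>J - I. w (T j))" if I_subset: "I \<subseteq> J" for I
  proof -
    have "(\<Prod>j\<in>J. w (fill_bin (Suc t) I T j)) = w (Suc t) ^ card I * (\<Prod>j\<in>J - I. w (T j))" for T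
      using prod.subset_diff[OF I_subset balls(1), of "\<lambda>j. w (fill_bin (Suc t) I T j)"]
      by (simp add: fill_bin_def mult.commute)
    then show ?thesis
      unfolding parking_Suc_fibre[OF balls I_subset] sum.reindex[OF inj_on_fill_bin]
      by (simp add: sum_distrib_left)
  qed
  have "(\<Sum>T\<in>parking (Suc t) J. \<Prod>j\<in>J. w (T j)) =
      (\<Sum>I\<in>Pow J. \<Sum>T\<in>{T \<in> parking (Suc t) J. {j \<in> J. T j = Suc t} = I}. \<Prod>j\<in>J. w (T j))"
    using balls by (intro sum.group[symmetric]) (auto simp: finite_parking)
  then show ?thesis using fibre by simp
qed

lemma sum_Pow_card:
  fixes f :: "nat \<Rightarrow> real"
  assumes "finite J"
  shows "(\<Sum>I\<in>Pow J. f (card I)) = (\<Sum>z\<le>card J. real (card J choose z) * f z)"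
proof -
  have "(\<Sum>I\<in>Pow J. f (card I)) = (\<Sum>z\<le>card J. \<Sum>I\<in>{I \<in> Pow J. card I = z}. f (card I))"
    using assms by (intro sum.group[symmetric]) (auto intro: card_mono)
  also have "\<dots> = (\<Sum>z\<le>card J. real (card J choose z) * f z)"
    using n_subsets[OF assms] by (simp add: Pow_def)
  finally show ?thesis .
qed

lemma sum_parking_Suc_card:
  fixes w :: "nat \<Rightarrow> real" and J :: "'a set"
  assumes balls: "finite J" "Suc t \<le> card J"
    and parking_sum: "\<And>J'. J' \<subseteq> J \<Longrightarrow> (\<Sum>T\<in>parking t J'. \<Prod>j\<in>J'. w (T j)) = G (card J')"
  shows "(\<Sum>T\<in>parking (Suc t) J. \<Prod>j\<in>J. w (T j)) =
    (\<Sum>z\<le>card J. real (card J choose z) * (w (Suc t) ^ z * G (card J - z)))"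
proof -
  have "(\<Sum>T\<in>parking (Suc t) J. \<Prod>j\<in>J. w (T j)) =
      (\<Sum>I\<in>Pow J. w (Suc t) ^ card I * G (card J - card I))"
    unfolding sum_parking_Suc[OF balls] using balls(1)
    by (intro sum.cong refl) (simp add: parking_sum card_Diff_subset finite_subset)
  also have "\<dots> = (\<Sum>z\<le>card J. real (card J choose z) * (w (Suc t) ^ z * G (card J - z)))"
    by (rule sum_Pow_card[OF balls(1), of "\<lambda>z. w (Suc t) ^ z * G (card J - z)"])
  finally show ?thesis .
qed

lemma pmf_left_law_Suc_balls:
  assumes "0 < r t" "Suc t \<le> n"
  shows "pmf (left_law r (Suc t)) (n - t) =
    (\<Sum>z\<le>n - t. poisson_weight (r t) z * pmf (left_law r t) (Suc (n - z) - t))"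
proof -
  have "pmf (left_law r (Suc t)) (n - t) = (\<Sum>f\<in>{1..Suc n - t}. pmf (left_law r t) f *
      poisson_weight_int (r t) (1 + 1 * (int (n - t) - int f)))"
    using assms by (intro pmf_killed_law_Suc) auto
  also have "\<dots> = (\<Sum>z\<le>n - t. poisson_weight (r t) z * pmf (left_law r t) (Suc (n - z) - t))"
  proof (rule sum.reindex_bij_witness[where i = "\<lambda>z. Suc n - t - z" and j = "\<lambda>f. Suc n - t - f"])
    fix f assume f_range: "f \<in> {1..Suc n - t}"
    then have "1 + 1 * (int (n - t) - int f) = int (Suc n - t - f)"
      "Suc (n - (Suc n - t - f)) - t = f"
      using assms by auto
    then show "poisson_weight (r t) (Suc n - t - f) *
        pmf (left_law r t) (Suc (n - (Suc n - t - f)) - t) =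
        pmf (left_law r t) f * poisson_weight_int (r t) (1 + 1 * (int (n - t) - int f))"
      by (simp only: poisson_weight_int_of_nat mult.commute)
  qed (use assms in auto)
  finally show ?thesis .
qed

lemma binomial_poisson_weight:
  assumes "0 < c" "z \<le> n"
  shows "real (n choose z) * (w ^ z * (a * fact (n - z) / c ^ (n - z) * exp R)) *
    (c ^ n / fact n * exp (- (R + c * w))) = poisson_weight (c * w) z * a"
proof -
  have "c ^ n = c ^ z * c ^ (n - z)" using assms by (simp add: power_add[symmetric])
  then show ?thesis
    using assms
    by (simp add: binomial_fact poisson_weight_def power_mult_distrib exp_diff exp_minus
        field_simps)
qed

text \<open>Poissonisation: given a total of \<open>n\<close> balls, independent \<open>Po(c w\<^sub>i)\<close> bin counts are
  distributed like the counts of \<open>n\<close> independent balls placed with weights \<open>w\<close>.\<close>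

lemma sum_parking_eq_left_law:
  fixes J :: "'a set"
  assumes "0 < c" "\<And>i. i < t \<Longrightarrow> 0 < w (Suc i)" "\<And>i. i < t \<Longrightarrow> r i = c * w (Suc i)"
    and "finite J" "t \<le> card J"
  shows "(\<Sum>T\<in>parking t J. \<Prod>j\<in>J. w (T j)) * (c ^ card J / fact (card J)) * exp (- (\<Sum>i<t. r i)) =
    pmf (left_law r t) (Suc (card J) - t)"
  using assms(2-)
proof (induction t arbitrary: J)
  case 0
  then show ?case by (simp add: parking_0 card_eq_0_iff indicator_def)
next
  case (Suc t)
  define n where "n = card J"
  define R where "R = (\<Sum>i<t. r i)"
  define a where "a = (\<lambda>n. pmf (left_law r t) (Suc n - t))"
  define G where "G = (\<lambda>n. if t \<le> n then a n * fact n / c ^ n * exp R else 0)"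
  have n_ge: "Suc t \<le> n" using Suc.prems by (simp add: n_def)
  have rate_t: "r t = c * w (Suc t)" "0 < c * w (Suc t)" using Suc.prems assms(1) by auto
  have parking_t: "(\<Sum>T\<in>parking t J'. \<Prod>j\<in>J'. w (T j)) = G (card J')" if "J' \<subseteq> J" for J'
  proof (cases "t \<le> card J'")
    case True
    then have "a (card J') =
        (\<Sum>T\<in>parking t J'. \<Prod>j\<in>J'. w (T j)) * (c ^ card J' / fact (card J')) * exp (- R)"
      unfolding a_def R_def using Suc.IH[of J'] Suc.prems finite_subset[OF that] by simp
    then show ?thesis using True assms(1) by (simp add: G_def exp_minus)
  qed (use Suc.prems finite_subset[OF that] in \<open>simp add: G_def parking_eq_empty\<close>)
  have "(\<Sum>T\<in>parking (Suc t) J. \<Prod>j\<in>J. w (T j)) * (c ^ n / fact n) * exp (- (\<Sum>i<Suc t. r i)) =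
      (\<Sum>z\<le>n. real (n choose z) * (w (Suc t) ^ z * G (n - z))) *
      (c ^ n / fact n * exp (- (R + c * w (Suc t))))"
    using sum_parking_Suc_card[of J t w G] Suc.prems parking_t by (simp add: n_def R_def)
  also have "\<dots> = (\<Sum>z\<le>n. if z \<le> n - t then poisson_weight (r t) z * a (n - z) else 0)"
    unfolding sum_distrib_right rate_t using n_ge binomial_poisson_weight[OF assms(1)]
    by (intro sum.cong refl) (simp add: G_def, linarith)
  also have "\<dots> = (\<Sum>z\<le>n - t. poisson_weight (r t) z * a (n - z))"
    by (intro sum.mono_neutral_cong_right) auto
  also have "\<dots> = pmf (left_law r (Suc t)) (n - t)"
    unfolding a_def using rate_t n_ge by (intro pmf_left_law_Suc_balls[symmetric]) simp_all
  finally show ?case by (simp add: n_def)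
qed

subsection \<open>The tree event\<close>

lemma leftwalk_bin_count:
  assumes "\<And>j. j < k - 1 \<Longrightarrow> 1 \<le> T j"
  shows "leftwalk (bin_count k T) u = 1 + int (card {j. j < k - 1 \<and> T j \<le> u}) - int u"
proof (induction u)
  case 0
  have "{j. j < k - 1 \<and> T j = 0} = {}" using assms by fastforce
  then show ?case by simp
next
  case (Suc u)
  have "{j. j < k - 1 \<and> T j \<le> Suc u} =
      {j. j < k - 1 \<and> T j \<le> u} \<union> {j. j < k - 1 \<and> T j = Suc u}"
    by auto
  then have "card {j. j < k - 1 \<and> T j \<le> Suc u} =
      card {j. j < k - 1 \<and> T j \<le> u} + bin_count k T (Suc u)"
    by (simp add: bin_count_def card_Un_disjoint disjoint_iff)
  then show ?case using Suc by simp
qed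

lemma set_tilted_bin:
  assumes "0 < p" "p < 1" "1 \<le> k"
  shows "set_pmf (tilted_bin_pmf p k) = {1..k}"
proof -
  have "(1 - p) ^ k < 1" using assms by (simp add: power_less_one_iff)
  then show ?thesis using assms by (auto simp: set_pmf_eq pmf_tilted_bin)
qed

lemma set_placement:
  assumes "0 < p" "p < 1" "1 \<le> k"
  shows "set_pmf (placement_pmf p k) = PiE_dflt {..<k - 1} 0 (\<lambda>_. {1..k})"
  unfolding placement_pmf_def by (simp add: set_Pi_pmf set_tilted_bin[OF assms] o_def)

lemma TREE_iff:
  assumes "0 < p" "p < 1" "1 \<le> k" "T \<in> set_pmf (placement_pmf p k)"
  shows "T \<in> TREE k \<longleftrightarrow> (\<forall>u\<in>{1..k - 1}. u \<le> card {j. j < k - 1 \<and> T j \<le> u})"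
proof -
  have "leftwalk (bin_count k T) u = 1 + int (card {j. j < k - 1 \<and> T j \<le> u}) - int u" for u
    using assms(4) set_placement[OF assms(1-3)]
    by (intro leftwalk_bin_count) (auto simp: PiE_dflt_def)
  then show ?thesis by (auto simp: TREE_def)
qed

lemma TREE_Int_set_placement:
  assumes tilt: "0 < p" "p < 1" and k_ge_1: "1 \<le> k"
  shows "TREE k \<inter> set_pmf (placement_pmf p k) = parking (k - 1) {..<k - 1}"
proof (intro equalityI subsetI)
  fix T assume T_mem: "T \<in> TREE k \<inter> set_pmf (placement_pmf p k)"
  have balls: "\<forall>u\<in>{1..k - 1}. u \<le> card {j. j < k - 1 \<and> T j \<le> u}"
    using TREE_iff[OF tilt k_ge_1] T_mem by auto
  have "card {..<k - 1} \<le> card {j. j < k - 1 \<and> T j \<le> k - 1}"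
    using balls k_ge_1 by (cases "k = 1") auto
  then have "{j. j < k - 1 \<and> T j \<le> k - 1} = {..<k - 1}"
    by (intro card_seteq) auto
  then have "j < k - 1 \<Longrightarrow> T j \<le> k - 1" for j by auto
  then show "T \<in> parking (k - 1) {..<k - 1}"
    using T_mem balls set_placement[OF tilt k_ge_1] by (auto simp: parking_def PiE_dflt_def)
next
  fix T assume T_mem: "T \<in> parking (k - 1) {..<k - 1}"
  then have "T \<in> set_pmf (placement_pmf p k)"
    using set_placement[OF tilt k_ge_1] by (fastforce simp: parking_def PiE_dflt_def)
  then show "T \<in> TREE k \<inter> set_pmf (placement_pmf p k)"
    using T_mem TREE_iff[OF tilt k_ge_1] by (simp add: parking_def)
qed

abbreviation (input) tree_prob :: "real \<Rightarrow> nat \<Rightarrow> real" where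
  "tree_prob p k \<equiv> measure_pmf.prob (placement_pmf p k) (TREE k)"

definition tilted_rate :: "real \<Rightarrow> nat \<Rightarrow> nat \<Rightarrow> real" where
  "tilted_rate p k i = rate_left p k * (1 - p) ^ i"

lemma tilted_rate_eq_pmf:
  assumes "0 < p" "p < 1" "i < k"
  shows "tilted_rate p k i = real (k - 1) * pmf (tilted_bin_pmf p k) (Suc i)"
  using assms by (simp add: tilted_rate_def pmf_tilted_bin rate_left_def of_nat_diff)

lemma sum_tilted_rate:
  assumes "0 < p" "p < 1" "1 \<le> k"
  shows "(\<Sum>i<k. tilted_rate p k i) = real (k - 1)"
proof -
  have "(\<Sum>i<k. tilted_rate p k i) = real (k - 1) * (\<Sum>i<k. pmf (tilted_bin_pmf p k) (Suc i))"
    using assms by (simp add: tilted_rate_eq_pmf sum_distrib_left)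
  also have "(\<Sum>i<k. pmf (tilted_bin_pmf p k) (Suc i)) = (\<Sum>i\<in>{1..k}. pmf (tilted_bin_pmf p k) i)"
    unfolding image_Suc_lessThan[symmetric] by (subst sum.reindex) auto
  also have "\<dots> = 1"
    using set_tilted_bin[OF assms] by (intro sum_pmf_eq_1) auto
  finally show ?thesis by simp
qed

lemma rate_left_pos:
  assumes "0 < p" "p < 1" "2 \<le> k"
  shows "0 < rate_left p k"
proof -
  have "(1 - p) ^ k < 1" using assms by (simp add: power_less_one_iff)
  then show ?thesis using assms by (simp add: rate_left_def)
qed

lemma prob_TREE_eq_first_passage_weight:
  assumes tilt: "0 < p" "p < 1" and k_ge_2: "2 \<le> k"
  shows "tree_prob p k * poisson_peak (k - 1) = first_passage_weight (tilted_rate p k) k"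
proof -
  let ?w = "pmf (tilted_bin_pmf p k)" and ?r = "tilted_rate p k" and ?n = "k - 1"
  have "(\<Sum>i<Suc ?n. ?r i) = real ?n"
    using sum_tilted_rate[OF tilt, of k] k_ge_2 by simp
  then have total: "exp (- (\<Sum>i<?n. ?r i)) * exp (- ?r ?n) = exp (- real ?n)"
    by (simp add: exp_add[symmetric] del: of_nat_diff)
  have "tree_prob p k = measure_pmf.prob (placement_pmf p k) (parking ?n {..<?n})"
    using TREE_Int_set_placement[OF tilt, of k] k_ge_2
      measure_Int_set_pmf[of "placement_pmf p k" "TREE k"] by simp
  also have "\<dots> = (\<Sum>T\<in>parking ?n {..<?n}. pmf (placement_pmf p k) T)"
    by (rule measure_measure_pmf_finite) (simp add: finite_parking)
  also have "\<dots> = (\<Sum>T\<in>parking ?n {..<?n}. \<Prod>j\<in>{..<?n}. ?w (T j))"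
    unfolding placement_pmf_def
    by (intro sum.cong refl) (auto simp: pmf_Pi parking_def PiE_dflt_def)
  finally have "tree_prob p k * poisson_peak ?n =
      (\<Sum>T\<in>parking ?n {..<?n}. \<Prod>j\<in>{..<?n}. ?w (T j)) * (real ?n ^ ?n / fact ?n) *
      exp (- (\<Sum>i<?n. ?r i)) * exp (- ?r ?n)"
    unfolding poisson_peak_def poisson_weight_def total[symmetric] by (simp only: mult.assoc)
  also have "\<dots> = pmf (left_law ?r ?n) (Suc ?n - ?n) * exp (- ?r ?n)"
  proof -
    have "0 < ?w (Suc i)" "?r i = real ?n * ?w (Suc i)" if "i < ?n" for i
      using that tilt k_ge_2 set_tilted_bin[of p k]
      by (auto simp: pmf_positive_iff tilted_rate_eq_pmf)
    then show ?thesis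
      using sum_parking_eq_left_law[of "real ?n" ?n ?w ?r "{..<?n}"] k_ge_2 by simp
  qed
  finally show ?thesis by (simp add: first_passage_weight_def)
qed

subsection \<open>Monotonicity in the tilt\<close>

definition stochastically_le :: "'a::order pmf \<Rightarrow> 'a pmf \<Rightarrow> bool" where
  "stochastically_le M N \<longleftrightarrow> (\<forall>f. antimono f \<longrightarrow> (\<forall>x. f x \<le> 1) \<longrightarrow>
     (\<integral>\<^sup>+x. f x \<partial>N) \<le> (\<integral>\<^sup>+x. (f x :: ennreal) \<partial>M))"

lemma stochastically_le_Pi_pmf:
  fixes v w :: "'a \<Rightarrow> 'b::order pmf"
  assumes "finite A" "\<And>x. x \<in> A \<Longrightarrow> stochastically_le (v x) (w x)"
  shows "stochastically_le (Pi_pmf A d v) (Pi_pmf A d w)"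
  using assms
proof (induction A rule: finite_induct)
  case (insert x A)
  have IH: "(\<integral>\<^sup>+T. f T \<partial>Pi_pmf A d w) \<le> (\<integral>\<^sup>+T. f T \<partial>Pi_pmf A d v)"
    if "antimono f" "\<And>T. f T \<le> 1" for f :: "('a \<Rightarrow> 'b) \<Rightarrow> ennreal"
    using insert that by (simp add: stochastically_le_def)
  have coordinate: "(\<integral>\<^sup>+y. f y \<partial>w x) \<le> (\<integral>\<^sup>+y. f y \<partial>v x)"
    if "antimono f" "\<And>y. f y \<le> 1" for f :: "'b \<Rightarrow> ennreal"
    using insert.prems[of x] that by (simp add: stochastically_le_def)
  show ?case
    unfolding stochastically_le_def
  proof (intro allI impI)
    fix f :: "('a \<Rightarrow> 'b) \<Rightarrow> ennreal"
    assume f_antimono: "antimono f" "\<forall>T. f T \<le> 1"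
    then have anti: "f (T'(x := y')) \<le> f (T(x := y))" if "T \<le> T'" "y \<le> y'" for T T' y y'
      using that by (intro antimonoD[of f]) (auto simp: le_fun_def)
    have "(\<integral>\<^sup>+T. f T \<partial>Pi_pmf (insert x A) d w) =
        (\<integral>\<^sup>+y. \<integral>\<^sup>+T. f (T(x := y)) \<partial>Pi_pmf A d w \<partial>w x)"
      using insert.hyps by (subst Pi_pmf_insert') auto
    also have "\<dots> \<le> (\<integral>\<^sup>+y. \<integral>\<^sup>+T. f (T(x := y)) \<partial>Pi_pmf A d v \<partial>w x)"
      using f_antimono anti by (intro nn_integral_mono IH antimonoI) auto
    also have "\<dots> \<le> (\<integral>\<^sup>+y. \<integral>\<^sup>+T. f (T(x := y)) \<partial>Pi_pmf A d v \<partial>v x)"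
    proof (rule coordinate)
      show "antimono (\<lambda>y. \<integral>\<^sup>+T. f (T(x := y)) \<partial>Pi_pmf A d v)"
        by (intro antimonoI nn_integral_mono anti) auto
      show "(\<integral>\<^sup>+T. f (T(x := y)) \<partial>Pi_pmf A d v) \<le> 1" for y
        using nn_integral_mono[of "Pi_pmf A d v" "\<lambda>T. f (T(x := y))" "\<lambda>_. 1"] f_antimono by simp
    qed
    also have "\<dots> = (\<integral>\<^sup>+T. f T \<partial>Pi_pmf (insert x A) d v)"
      using insert.hyps by (subst Pi_pmf_insert') auto
    finally show "(\<integral>\<^sup>+T. f T \<partial>Pi_pmf (insert x A) d w) \<le> (\<integral>\<^sup>+T. f T \<partial>Pi_pmf (insert x A) d v)" .
  qed
qed (simp add: stochastically_le_def)

lemma stochastically_le_prob: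
  assumes "stochastically_le M N" "\<And>x y. x \<le> y \<Longrightarrow> y \<in> S \<Longrightarrow> x \<in> S"
  shows "measure_pmf.prob N S \<le> measure_pmf.prob M S"
proof -
  have "antimono (indicator S :: 'a \<Rightarrow> ennreal)"
    using assms(2) by (auto intro!: antimonoI split: split_indicator)
  moreover have "indicator S x \<le> (1 :: ennreal)" for x
    by (auto split: split_indicator)
  ultimately have "(\<integral>\<^sup>+x. indicator S x \<partial>N) \<le> (\<integral>\<^sup>+x. indicator S x \<partial>M)"
    using assms(1)[unfolded stochastically_le_def, rule_format, of "indicator S"] by blast
  then show ?thesis by (simp add: measure_pmf.emeasure_eq_measure)
qed

lemma sum_single_crossing_mono:
  fixes v w f :: "'a::linorder \<Rightarrow> real"
  assumes finite_A: "finite A" and sums: "sum v A = sum w A"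
    and cross: "\<And>i j. i \<in> A \<Longrightarrow> j \<in> A \<Longrightarrow> i < j \<Longrightarrow> v j \<le> w j \<Longrightarrow> v i \<le> w i"
    and f_antimono: "\<And>i j. i \<in> A \<Longrightarrow> j \<in> A \<Longrightarrow> i \<le> j \<Longrightarrow> f j \<le> f i"
  shows "(\<Sum>i\<in>A. f i * v i) \<le> (\<Sum>i\<in>A. f i * w i)"
proof (cases "\<exists>i\<in>A. v i \<le> w i")
  case False
  then have "A = {}" using sum_strict_mono[OF finite_A, of w v] sums by force
  then show ?thesis by simp
next
  case True
  define c where "c = Max {i \<in> A. v i \<le> w i}"
  have c_mem: "c \<in> A" "v c \<le> w c"
    using Max_in[of "{i \<in> A. v i \<le> w i}"] finite_A True by (auto simp: c_def)
  have "0 \<le> (w i - v i) * (f i - f c)" if i_mem: "i \<in> A" for i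
  proof (cases "i \<le> c")
    case True
    then have "v i \<le> w i" using c_mem cross[of i c] i_mem by (cases "i = c") auto
    then show ?thesis using f_antimono[OF i_mem c_mem(1) True] by (intro mult_nonneg_nonneg) auto
  next
    case False
    then have "w i < v i"
      using Max_ge[of "{i \<in> A. v i \<le> w i}" i] finite_A i_mem by (force simp: c_def)
    then show ?thesis using f_antimono[OF c_mem(1) i_mem] False by (intro mult_nonpos_nonpos) auto
  qed
  then have "0 \<le> (\<Sum>i\<in>A. (w i - v i) * (f i - f c))" by (intro sum_nonneg)
  also have "\<dots> = (\<Sum>i\<in>A. f i * w i) - (\<Sum>i\<in>A. f i * v i) - f c * (sum w A - sum v A)"
    by (simp add: algebra_simps sum.distrib sum_subtractf sum_distrib_left)
  finally show ?thesis using sums by simp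
qed

lemma pmf_tilted_bin_single_crossing:
  assumes tilts: "0 < p" "p \<le> p'" "p' < 1" and indices: "1 \<le> i" "i < j" "j \<le> k"
    and weight_le: "pmf (tilted_bin_pmf p k) j \<le> pmf (tilted_bin_pmf p' k) j"
  shows "pmf (tilted_bin_pmf p k) i \<le> pmf (tilted_bin_pmf p' k) i"
proof -
  define a where "a = (\<lambda>p::real. p / (1 - (1 - p) ^ k))"
  have a_pos: "0 < a p'"
    using tilts indices by (simp add: a_def power_less_one_iff)
  have pmf_eq: "pmf (tilted_bin_pmf x k) l = a x * (1 - x) ^ (l - 1)"
    if "0 < x" "x < 1" "l \<in> {1..k}" for x l
    using that by (simp add: pmf_tilted_bin a_def)
  have split: "x ^ (j - 1) = x ^ (i - 1) * x ^ (j - i)" for x :: real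
    using indices by (simp add: power_add[symmetric])
  have "a p * (1 - p) ^ (j - 1) \<le> a p' * (1 - p') ^ (j - 1)"
    using weight_le tilts indices pmf_eq[of p j] pmf_eq[of p' j] by simp
  then have "a p * (1 - p) ^ (i - 1) * (1 - p) ^ (j - i) \<le>
      a p' * (1 - p') ^ (i - 1) * (1 - p') ^ (j - i)"
    unfolding split by (simp only: mult.assoc)
  also have "\<dots> \<le> a p' * (1 - p') ^ (i - 1) * (1 - p) ^ (j - i)"
    using tilts a_pos by (intro mult_left_mono power_mono) auto
  finally have "a p * (1 - p) ^ (i - 1) \<le> a p' * (1 - p') ^ (i - 1)"
    using tilts by (simp add: mult_le_cancel_right_pos)
  then show ?thesis using tilts indices by (simp add: pmf_eq)
qed

lemma stochastically_le_tilted_bin: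
  assumes tilts: "0 < p" "p \<le> p'" "p' < 1" and k_ge_1: "1 \<le> k"
  shows "stochastically_le (tilted_bin_pmf p' k) (tilted_bin_pmf p k)"
  unfolding stochastically_le_def
proof (intro allI impI)
  fix f :: "nat \<Rightarrow> ennreal" assume f_antimono: "antimono f" "\<forall>i. f i \<le> 1"
  let ?v = "pmf (tilted_bin_pmf p k)" and ?w = "pmf (tilted_bin_pmf p' k)"
  have supports: "set_pmf (tilted_bin_pmf p k) = {1..k}" "set_pmf (tilted_bin_pmf p' k) = {1..k}"
    using set_tilted_bin[of p k] set_tilted_bin[of p' k] tilts k_ge_1 by simp_all
  define g where "g = (\<lambda>i. enn2real (f i))"
  have finite: "f i < \<top>" for i
    using f_antimono(2) le_less_trans ennreal_one_less_top by blast
  have f_eq: "f i = ennreal (g i)" for i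
    using finite[of i] by (simp add: g_def)
  have g_nonneg: "0 \<le> g i" for i by (simp add: g_def)
  have g_anti: "g j \<le> g i" if "i \<le> j" for i j
    unfolding g_def using antimonoD[OF f_antimono(1) that] finite by (intro enn2real_mono) auto
  have integral_eq: "(\<integral>\<^sup>+i. f i \<partial>measure_pmf M) = ennreal (\<Sum>i\<in>{1..k}. g i * pmf M i)"
    if "set_pmf M = {1..k}" for M
    using that
    by (subst nn_integral_measure_pmf_finite)
      (auto simp: f_eq g_nonneg ennreal_mult[symmetric] sum_ennreal)
  have "(\<Sum>i\<in>{1..k}. g i * ?v i) \<le> (\<Sum>i\<in>{1..k}. g i * ?w i)"
  proof (rule sum_single_crossing_mono)
    show "sum ?v {1..k} = sum ?w {1..k}"
      using sum_pmf_eq_1[of "{1..k}" "tilted_bin_pmf p k"]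
        sum_pmf_eq_1[of "{1..k}" "tilted_bin_pmf p' k"] supports by simp
    show "?v i \<le> ?w i" if "i \<in> {1..k}" "j \<in> {1..k}" "i < j" "?v j \<le> ?w j" for i j
      using pmf_tilted_bin_single_crossing[OF tilts, of i j k] that by simp
  qed (use g_anti in auto)
  then show "(\<integral>\<^sup>+i. f i \<partial>tilted_bin_pmf p k) \<le> (\<integral>\<^sup>+i. f i \<partial>tilted_bin_pmf p' k)"
    unfolding integral_eq[OF supports(1)] integral_eq[OF supports(2)] by (rule ennreal_leI)
qed

lemma prob_TREE_mono:
  assumes tilts: "0 < p" "p \<le> p'" "p' < 1" and k_ge_1: "1 \<le> k"
  shows "tree_prob p k \<le> tree_prob p' k"
proof -
  define S where "S = {T. \<forall>u\<in>{1..k - 1}. u \<le> card {j. j < k - 1 \<and> T j \<le> u}}"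
  have TREE_eq: "tree_prob x k = measure_pmf.prob (placement_pmf x k) S" if "0 < x" "x < 1" for x
  proof -
    have "TREE k \<inter> set_pmf (placement_pmf x k) = S \<inter> set_pmf (placement_pmf x k)"
      using TREE_iff[OF that k_ge_1] by (auto simp: S_def)
    then show ?thesis by (metis measure_Int_set_pmf)
  qed
  have "measure_pmf.prob (placement_pmf p k) S \<le> measure_pmf.prob (placement_pmf p' k) S"
    unfolding placement_pmf_def
  proof (rule stochastically_le_prob)
    show "stochastically_le (Pi_pmf {..<k - 1} 0 (\<lambda>_. tilted_bin_pmf p' k))
        (Pi_pmf {..<k - 1} 0 (\<lambda>_. tilted_bin_pmf p k))"
      by (intro stochastically_le_Pi_pmf stochastically_le_tilted_bin tilts k_ge_1) simp
    fix T T' :: "nat \<Rightarrow> nat" assume placement_le: "T \<le> T'" and T'_mem: "T' \<in> S"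
    show "T \<in> S"
      unfolding S_def
    proof (intro CollectI ballI)
      fix u assume "u \<in> {1..k - 1}"
      then have "u \<le> card {j. j < k - 1 \<and> T' j \<le> u}" using T'_mem by (simp add: S_def)
      also have "\<dots> \<le> card {j. j < k - 1 \<and> T j \<le> u}"
        using placement_le by (intro card_mono) (auto simp: le_fun_def intro: order_trans)
      finally show "u \<le> card {j. j < k - 1 \<and> T j \<le> u}" .
    qed
  qed
  then show ?thesis using TREE_eq tilts by simp
qed

section \<open>Escape probabilities\<close>

lemma exp_minus_le_quadratic: "0 \<le> t \<Longrightarrow> exp (- t) \<le> 1 - t + t\<^sup>2 / 2" for t :: real
proof -
  assume t_nonneg: "0 \<le> t"
  have "(1 - t + t\<^sup>2 / 2) * (1 + t + t\<^sup>2 / 2) = 1 + t ^ 4 / 4"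
    by (simp add: power2_eq_square power4_eq_xxxx algebra_simps)
  then have "1 \<le> (1 - t + t\<^sup>2 / 2) * (1 + t + t\<^sup>2 / 2)" by simp
  also have "\<dots> \<le> (1 - t + t\<^sup>2 / 2) * exp t"
  proof (intro mult_left_mono exp_lower_Taylor_quadratic t_nonneg)
    have "0 \<le> (1 - t)\<^sup>2 / 2 + 1 / 2" by (intro add_nonneg_nonneg) auto
    then show "0 \<le> 1 - t + t\<^sup>2 / 2" by (simp add: power2_diff field_simps)
  qed
  finally show ?thesis by (simp add: exp_minus field_simps)
qed

lemma one_minus_le_exp_quadratic:
  fixes w :: real
  assumes "0 \<le> w" "w \<le> 1"
  shows "1 - w \<le> exp (- w - w\<^sup>2 / 2)"
proof -
  define f where "f = (\<lambda>w::real. - (exp (w + w\<^sup>2 / 2) * (1 - w)))"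
  have "f 0 \<le> f w"
  proof (rule DERIV_nonneg_imp_nondecreasing[OF assms(1)])
    fix t :: real
    have "(f has_real_derivative (exp (t + t\<^sup>2 / 2) * t\<^sup>2)) (at t)"
      unfolding f_def by (auto intro!: derivative_eq_intros simp: power2_eq_square algebra_simps)
    then show "\<exists>y. (f has_real_derivative y) (at t) \<and> 0 \<le> y" by (intro exI conjI) auto
  qed
  then have "exp (w + w\<^sup>2 / 2) * (1 - w) \<le> 1" by (simp add: f_def)
  then have "1 - w \<le> inverse (exp (w + w\<^sup>2 / 2))" by (simp add: field_simps)
  also have "inverse (exp (w + w\<^sup>2 / 2)) = exp (- w - w\<^sup>2 / 2)"
    by (simp add: exp_minus[symmetric])
  finally show ?thesis .
qed

definition survival_root :: "real \<Rightarrow> real \<Rightarrow> bool" where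
  "survival_root l y \<longleftrightarrow> 0 < y \<and> y < 1 \<and> 1 - y = exp (- l * y)"

lemma survival_root_exists:
  assumes "1 < l"
  obtains y where "survival_root l y" "2 * (l - 1) / l\<^sup>2 \<le> y"
proof -
  define f where "f = (\<lambda>y. exp (- l * y) - (1 - y))"
  define a where "a = 2 * (l - 1) / l\<^sup>2"
  have a_pos: "0 < a" using assms by (simp add: a_def)
  have "0 \<le> (l - 1)\<^sup>2" by simp
  then have "2 * (l - 1) \<le> l\<^sup>2" by (simp add: power2_diff)
  then have a_le_1: "a \<le> 1" using assms by (simp add: a_def)
  have "exp (- (l * a)) \<le> 1 - l * a + (l * a)\<^sup>2 / 2"
    using assms a_pos by (intro exp_minus_le_quadratic) auto
  also have "(l * a)\<^sup>2 / 2 = (l - 1) * a"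
    using assms by (simp add: a_def power2_eq_square field_simps)
  finally have "f a \<le> 0" by (simp add: f_def algebra_simps)
  moreover have "0 \<le> f 1" by (simp add: f_def)
  ultimately have "\<exists>y\<ge>a. y \<le> 1 \<and> f y = 0"
    using a_le_1 by (intro IVT') (auto simp: f_def intro!: continuous_intros)
  then obtain y where y_root: "a \<le> y" "y \<le> 1" "1 - y = exp (- l * y)"
    by (auto simp: f_def)
  moreover have "y < 1"
    using y_root(3) exp_gt_zero[of "- l * y"] by linarith
  ultimately show ?thesis
    using a_pos by (intro that[of y]) (auto simp: survival_root_def a_def)
qed

lemma survival_root_le:
  assumes "survival_root l y"
  shows "l * (1 - y) \<le> 1"
proof -
  have y_root: "0 < y" "y < 1" "1 - y = exp (- l * y)"
    using assms by (auto simp: survival_root_def)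
  have "1 + l * y \<le> exp (l * y)" by simp
  also have "exp (l * y) = 1 / (1 - y)" using y_root by (simp add: exp_minus field_simps)
  finally have "(1 + l * y) * (1 - y) \<le> 1" using y_root(2) by (simp add: pos_le_divide_eq)
  then have "y * (l * (1 - y)) \<le> y * 1" by (simp add: algebra_simps)
  then show ?thesis using y_root(1) by (simp only: mult_le_cancel_left_pos)
qed

lemma alive_prob_left_law_le_root:
  assumes root: "survival_root l y" and z_pos: "0 < z" and l_pos: "0 < l"
    and rates: "\<And>i. i < m \<Longrightarrow> 0 < r i" "\<And>i. i < m \<Longrightarrow> r i \<le> l"
  shows "alive_prob (left_law r m) * (1 - exp (- (real m * z\<^sup>2 / 2))) \<le> y + z"
proof (cases "y + z < 1")
  case False
  have "alive_prob (left_law r m) * (1 - exp (- (real m * z\<^sup>2 / 2))) \<le> 1 * 1"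
    using alive_prob_le_1 alive_prob_nonneg by (intro mult_mono) auto
  then show ?thesis using False by simp
next
  case True
  have y_root: "0 < y" "y < 1" "1 - y = exp (- l * y)"
    using root by (auto simp: survival_root_def)
  define w where "w = z / (1 - y)"
  have "l * (1 - y) * z \<le> 1 * z" using z_pos survival_root_le[OF root]
    by (intro mult_right_mono) auto
  then have lz_le: "l * z \<le> w" using y_root(2) by (simp add: w_def pos_le_divide_eq mult_ac)
  have "z \<le> w" using y_root z_pos by (simp add: w_def field_simps)
  then have square_le: "z\<^sup>2 \<le> w\<^sup>2" using z_pos by (intro power_mono) auto
  have w_range: "0 \<le> w" "w \<le> 1" using True y_root z_pos by (auto simp: w_def)
  have "1 - y - z = (1 - y) * (1 - w)" using y_root by (simp add: w_def field_simps)
  also have "\<dots> \<le> (1 - y) * exp (- w - w\<^sup>2 / 2)"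
    using y_root w_range by (intro mult_left_mono one_minus_le_exp_quadratic) auto
  also have "\<dots> \<le> (1 - y) * exp (- (l * z) - z\<^sup>2 / 2)"
    using lz_le square_le y_root by (intro mult_left_mono) auto
  also have "\<dots> = exp (- l * y) * exp (- (l * z) - z\<^sup>2 / 2)"
    by (simp only: y_root(3))
  also have "\<dots> = exp (- (z\<^sup>2 / 2)) * exp (l * ((1 - y - z) - 1))"
    by (simp add: exp_add[symmetric] algebra_simps)
  finally have "1 - y - z \<le> exp (- (z\<^sup>2 / 2)) * exp (l * ((1 - y - z) - 1))" .
  then have "alive_prob (left_law r m) * (1 - exp (- (z\<^sup>2 / 2)) ^ m) \<le> 1 - (1 - y - z)"
    using True y_root z_pos rates by (intro alive_prob_left_law_le[where l = l]) auto
  then show ?thesis by (simp add: exp_of_nat_mult[symmetric])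
qed

lemma ln_one_minus_scale:
  assumes "0 < \<theta>" "\<theta> \<le> 1" "0 \<le> y" "y < (1::real)"
  shows "- ln (1 - \<theta> * y) - \<theta> * y \<le> \<theta>\<^sup>2 * (- ln (1 - y) - y)"
proof -
  define f where "f = (\<lambda>u::real. \<theta>\<^sup>2 * (- ln (1 - u) - u) - (- ln (1 - \<theta> * u) - \<theta> * u))"
  have "f 0 \<le> f y"
  proof (rule DERIV_nonneg_imp_nondecreasing[of 0 y f])
    fix u :: real assume u_range: "0 \<le> u" "u \<le> y"
    have "\<theta> * u \<le> u" using assms u_range by (simp add: mult_left_le_one_le)
    then have u_lt: "u < 1" "\<theta> * u < 1" "\<theta> * u \<le> u" using u_range assms by auto
    have "(f has_real_derivative (\<theta>\<^sup>2 * (1 / (1 - u) - 1) - (\<theta> / (1 - \<theta> * u) - \<theta>))) (at u)"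
      unfolding f_def using u_lt by (auto intro!: derivative_eq_intros)
    moreover have "\<theta>\<^sup>2 * (1 / (1 - u) - 1) - (\<theta> / (1 - \<theta> * u) - \<theta>) =
        \<theta>\<^sup>2 * u * (1 / (1 - u) - 1 / (1 - \<theta> * u))"
      using u_lt by (simp add: divide_simps power2_eq_square) (simp add: algebra_simps)
    moreover have "0 \<le> \<theta>\<^sup>2 * u * (1 / (1 - u) - 1 / (1 - \<theta> * u))"
      using u_lt u_range by (intro mult_nonneg_nonneg) (auto intro!: divide_left_mono)
    ultimately show "\<exists>d. (f has_real_derivative d) (at u) \<and> 0 \<le> d" by metis
  qed (use assms in simp)
  then show ?thesis by (simp add: f_def)
qed

lemma alive_prob_left_law_ge_root:
  assumes root: "survival_root l y" and \<theta>_range: "0 < \<theta>" "\<theta> \<le> 1"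
    and rates: "\<And>i. i < m \<Longrightarrow> 0 < r i" "\<And>i. i < m \<Longrightarrow> 1 + \<theta> * (l - 1) \<le> r i"
  shows "\<theta> * y \<le> alive_prob (left_law r m)"
proof -
  have y_root: "0 < y" "y < 1" "1 - y = exp (- l * y)"
    using root by (auto simp: survival_root_def)
  have "ln (1 - y) = - l * y" using y_root(3) by simp
  then have "- ln (1 - \<theta> * y) \<le> (1 + \<theta> * (l - 1)) * (\<theta> * y)"
    using ln_one_minus_scale[OF \<theta>_range, of y] y_root by (simp add: power2_eq_square algebra_simps)
  moreover have pos: "0 < 1 - \<theta> * y"
    using \<theta>_range y_root mult_left_le_one_le[of y \<theta>] by linarith
  ultimately have "exp (- ((1 + \<theta> * (l - 1)) * (\<theta> * y))) \<le> 1 - \<theta> * y"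
    by (simp add: ln_ge_iff[symmetric])
  then have "1 - (1 - \<theta> * y) \<le> alive_prob (left_law r m)"
    using rates pos y_root \<theta>_range
    by (intro alive_prob_left_law_ge[where l = "1 + \<theta> * (l - 1)"]) auto
  then show ?thesis by simp
qed

lemma inverse_sqrt_le_diff:
  assumes "0 < m"
  shows "1 / sqrt (real m) \<le> 4 * (sqrt (real (Suc m)) - sqrt (real m))"
proof -
  define a b where "a = sqrt (real m)" and "b = sqrt (real (Suc m))"
  have a_eq: "0 < a" "a\<^sup>2 = real m" using assms by (auto simp: a_def)
  have b_eq: "a \<le> b" "b\<^sup>2 = real m + 1" by (auto simp: a_def b_def)
  have "b\<^sup>2 \<le> (2 * a)\<^sup>2" using assms a_eq b_eq by (simp add: power_mult_distrib)
  then have "b \<le> 2 * a" by (rule power2_le_imp_le) (use a_eq in simp)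
  have "1 = (b - a) * (b + a)" using a_eq b_eq by (simp add: power2_eq_square algebra_simps)
  also have "\<dots> \<le> (b - a) * (4 * a)"
    using \<open>b \<le> 2 * a\<close> a_eq b_eq by (intro mult_left_mono) auto
  finally show ?thesis
    using a_eq(1) unfolding a_def[symmetric] b_def[symmetric] by (simp add: field_simps)
qed

lemma alive_prob_left_law_le_root_sqrt:
  assumes root: "survival_root l y" and l_pos: "0 < l" and m_pos: "0 < m"
    and rates: "\<And>i. i < m \<Longrightarrow> 0 < r i" "\<And>i. i < m \<Longrightarrow> r i \<le> l"
  shows "alive_prob (left_law r m) \<le> 2 * y + 3 / sqrt (real m)"
proof -
  define v where "v = alive_prob (left_law r m)"
  have "v * (1 - exp (- (real m * (sqrt (2 / m))\<^sup>2 / 2))) \<le> y + sqrt (2 / m)"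
    unfolding v_def using m_pos rates by (intro alive_prob_left_law_le_root[OF root _ l_pos]) auto
  also have "real m * (sqrt (2 / m))\<^sup>2 / 2 = 1" using m_pos by simp
  finally have "v * (1 - exp (- 1)) \<le> y + sqrt (2 / m)" .
  moreover have "v * (1 / 2) \<le> v * (1 - exp (- 1))"
    using alive_prob_nonneg exp_minus_le_quadratic[of 1]
    by (intro mult_left_mono) (auto simp: v_def)
  moreover have "sqrt (2 / m) \<le> 3 / 2 / sqrt m"
  proof -
    have "sqrt 2 \<le> 3 / 2" by (rule real_le_lsqrt) (auto simp: power2_eq_square)
    then show ?thesis unfolding real_sqrt_divide by (intro divide_right_mono) auto
  qed
  ultimately show ?thesis by (simp add: v_def)
qed

lemma sum_alive_prob_left_law_le:
  assumes root: "survival_root l y" and l_pos: "0 < l"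
    and rates: "\<And>i. i < m \<Longrightarrow> 0 < r i" "\<And>i. i < m \<Longrightarrow> r i \<le> l"
  shows "(\<Sum>i<m. alive_prob (left_law r i)) \<le> 2 * real m * y + 12 * sqrt (real m)"
  using rates
proof (induction m)
  case (Suc m)
  have y_pos: "0 < y" using root by (simp add: survival_root_def)
  have IH: "(\<Sum>i<m. alive_prob (left_law r i)) \<le> 2 * real m * y + 12 * sqrt (real m)"
    using Suc by auto
  show ?case
  proof (cases "m = 0")
    case True
    then show ?thesis using y_pos alive_prob_le_1[of "return_pmf 1"] by (simp add: add_increasing)
  next
    case False
    then have "alive_prob (left_law r m) \<le> 2 * y + 3 / sqrt (real m)"
      using Suc.prems by (intro alive_prob_left_law_le_root_sqrt[OF root l_pos]) auto
    moreover have "3 / sqrt (real m) \<le> 12 * sqrt (real (Suc m)) - 12 * sqrt (real m)"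
      using inverse_sqrt_le_diff[of m] False by simp
    ultimately show ?thesis using IH by (simp add: algebra_simps)
  qed
qed simp

subsection \<open>Walks driven by an infinite Poisson sequence\<close>

primrec chain_state :: "(nat \<Rightarrow> 's \<Rightarrow> nat \<Rightarrow> 's) \<Rightarrow> 's \<Rightarrow> (nat \<Rightarrow> nat) \<Rightarrow> nat \<Rightarrow> 's" where
  "chain_state F s Z 0 = s"
| "chain_state F s Z (Suc n) = F n (chain_state F s Z n) (Z (Suc n))"

lemma chain_state_cong:
  "(\<And>i. i \<in> {1..n} \<Longrightarrow> Z i = Z' i) \<Longrightarrow> chain_state F s Z n = chain_state F s Z' n"
  by (induction n) auto

lemma measurable_chain_state:
  fixes F :: "nat \<Rightarrow> 's::countable \<Rightarrow> nat \<Rightarrow> 's"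
  assumes "{1..n} \<subseteq> I"
  shows "(\<lambda>Z. chain_state F s Z n) \<in> measurable (PiM I (\<lambda>_. measure_pmf Q)) (count_space UNIV)"
  using assms
proof (induction n)
  case (Suc n)
  let ?M = "PiM I (\<lambda>_. measure_pmf Q)"
  have "(\<lambda>Z. Z (Suc n)) \<in> measurable ?M (measure_pmf Q)"
    using Suc.prems by (intro measurable_component_singleton) auto
  then have "(\<lambda>Z. Z (Suc n)) \<in> measurable ?M (count_space UNIV)"
    by (simp add: measurable_def)
  then have "(\<lambda>Z. F n g (Z (Suc n))) \<in> measurable ?M (count_space UNIV)" for g
    by (rule measurable_compose) simp
  moreover have "(\<lambda>Z. chain_state F s Z n) \<in> measurable ?M (count_space UNIV)"
    using Suc.prems by (intro Suc.IH) auto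
  ultimately show ?case unfolding chain_state.simps by (rule measurable_compose_countable)
qed simp

lemma nn_integral_chain_state:
  fixes F :: "nat \<Rightarrow> 's::countable \<Rightarrow> nat \<Rightarrow> 's"
  shows "(\<integral>\<^sup>+Z. f (chain_state F s Z n) \<partial>PiM {1..n} (\<lambda>_. measure_pmf (poisson_pmf l))) =
    (\<integral>\<^sup>+x. f x \<partial>poisson_chain F (\<lambda>_. l) s n)"
proof (induction n arbitrary: f)
  case 0
  show ?case by (simp add: nn_integral_count_space_finite PiM_empty)
next
  case (Suc n)
  let ?M = "\<lambda>I. PiM I (\<lambda>_. measure_pmf (poisson_pmf l))"
  interpret product_sigma_finite "\<lambda>_::nat. measure_pmf (poisson_pmf l)" ..
  have "{1..Suc n} = insert (Suc n) {1..n}" by auto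
  then have "(\<integral>\<^sup>+Z. f (chain_state F s Z (Suc n)) \<partial>?M {1..Suc n}) =
      (\<integral>\<^sup>+Z. f (chain_state F s Z (Suc n)) \<partial>?M (insert (Suc n) {1..n}))"
    by simp
  also have "\<dots> = (\<integral>\<^sup>+Z. (\<integral>\<^sup>+z. f (chain_state F s (Z(Suc n := z)) (Suc n)) \<partial>poisson_pmf l)
      \<partial>?M {1..n})"
  proof (rule product_nn_integral_insert)
    show "(\<lambda>Z. f (chain_state F s Z (Suc n))) \<in> borel_measurable (?M (insert (Suc n) {1..n}))"
      by (rule measurable_compose[OF measurable_chain_state]) auto
  qed auto
  also have "\<dots> = (\<integral>\<^sup>+Z. (\<integral>\<^sup>+z. f (F n (chain_state F s Z n) z) \<partial>poisson_pmf l) \<partial>?M {1..n})"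
  proof (intro nn_integral_cong)
    fix Z :: "nat \<Rightarrow> nat" and z
    have "chain_state F s (Z(Suc n := z)) n = chain_state F s Z n"
      by (rule chain_state_cong) auto
    then show "f (chain_state F s (Z(Suc n := z)) (Suc n)) = f (F n (chain_state F s Z n) z)"
      by simp
  qed
  also have "\<dots> = (\<integral>\<^sup>+x. (\<integral>\<^sup>+z. f (F n x z) \<partial>poisson_pmf l) \<partial>poisson_chain F (\<lambda>_. l) s n)"
    by (rule Suc.IH)
  finally show ?case by simp
qed

lemma prob_space_poisson_steps: "prob_space (poisson_steps l)"
  unfolding poisson_steps_def by (rule prob_space_PiM) (rule prob_space_measure_pmf)

lemma sets_chain_state_alive:
  "{1..n} \<subseteq> I \<Longrightarrow> {Z \<in> space (PiM I (\<lambda>_. measure_pmf Q)). 0 < chain_state F s Z n} \<in>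
    sets (PiM I (\<lambda>_. measure_pmf Q))" for s :: nat
  using measurable_sets[OF measurable_chain_state[of n I F s Q], of "{0<..}"]
  by (simp add: vimage_def Int_def conj_commute)

lemma measure_chain_state_alive:
  "measure (poisson_steps l) {Z \<in> space (poisson_steps l). 0 < chain_state F s Z n} =
    alive_prob (poisson_chain F (\<lambda>_. l) s n)"
proof -
  let ?M = "\<lambda>I. PiM I (\<lambda>_::nat. measure_pmf (poisson_pmf l))"
  let ?E = "\<lambda>I. {Z \<in> space (?M I). 0 < chain_state F s Z n}"
  interpret product_prob_space "\<lambda>_::nat. measure_pmf (poisson_pmf l)" "{1..}" ..
  have "chain_state F s (restrict Z {1..n}) n = chain_state F s Z n" for Z
    by (rule chain_state_cong) auto
  then have restrict: "(\<lambda>x. restrict x {1..n}) -` ?E {1..n} \<inter> space (?M {1..}) = ?E {1..}"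
    by (auto simp: space_PiM)
  have "emeasure (poisson_steps l) (?E {1..}) =
      emeasure (distr (?M {1..}) (?M {1..n}) (\<lambda>x. restrict x {1..n})) (?E {1..n})"
    unfolding poisson_steps_def restrict[symmetric]
    by (intro emeasure_distr[symmetric] measurable_restrict_subset sets_chain_state_alive) auto
  also have "\<dots> = emeasure (?M {1..n}) (?E {1..n})"
    by (subst distr_PiM_restrict_finite) auto
  also have "\<dots> = (\<integral>\<^sup>+Z. indicator {0<..} (chain_state F s Z n) \<partial>?M {1..n})"
    by (subst nn_integral_indicator[OF sets_chain_state_alive[OF order_refl], symmetric])
      (auto intro!: nn_integral_cong split: split_indicator)
  also have "\<dots> = emeasure (poisson_chain F (\<lambda>_. l) s n) {0<..}"
    unfolding nn_integral_chain_state by simp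
  finally show ?thesis by (simp add: measure_def alive_prob_def poisson_steps_def)
qed

lemma alive_prob_tendsto_escape:
  assumes alive: "\<And>Z n. 0 < chain_state F s Z (Suc n) \<longleftrightarrow> (\<forall>i\<in>{1..Suc n}. P Z i)"
  shows "(\<lambda>n. alive_prob (poisson_chain F (\<lambda>_. l) s (Suc n))) \<longlonglongrightarrow>
    measure (poisson_steps l) {Z \<in> space (poisson_steps l). \<forall>i\<ge>1. P Z i}"
proof -
  interpret prob_space "poisson_steps l" by (rule prob_space_poisson_steps)
  define A where "A = (\<lambda>n. {Z \<in> space (poisson_steps l). 0 < chain_state F s Z (Suc n)})"
  have "A n \<in> sets (poisson_steps l)" for n
    unfolding A_def poisson_steps_def by (rule sets_chain_state_alive) auto
  moreover have "decseq A"
    by (rule decseq_SucI) (auto simp: A_def alive simp del: chain_state.simps)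
  ultimately have "(\<lambda>n. measure (poisson_steps l) (A n)) \<longlonglongrightarrow> measure (poisson_steps l) (\<Inter>n. A n)"
    by (intro finite_Lim_measure_decseq) auto
  moreover have "(\<forall>n. \<forall>i\<in>{1..Suc n}. P Z i) \<longleftrightarrow> (\<forall>i\<ge>1. P Z i)" for Z
    by (meson atLeastAtMost_iff le_SucI order_refl)
  then have "(\<Inter>n. A n) = {Z \<in> space (poisson_steps l). \<forall>i\<ge>1. P Z i}"
    unfolding A_def alive by auto
  moreover have "measure (poisson_steps l) (A n) =
      alive_prob (poisson_chain F (\<lambda>_. l) s (Suc n))" for n
    unfolding A_def by (rule measure_chain_state_alive)
  ultimately show ?thesis by simp
qed

lemma killed_step_tracks:
  assumes "0 < g \<Longrightarrow> int g = y"
  shows "0 < killed_step \<sigma> g z \<longleftrightarrow> 0 < g \<and> 0 < y + \<sigma> * (int z - 1)"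
    and "0 < killed_step \<sigma> g z \<Longrightarrow> int (killed_step \<sigma> g z) = y + \<sigma> * (int z - 1)"
  using assms by (auto simp: killed_step_def split: if_splits)

lemma chain_state_leftwalk:
  "(0 < chain_state (\<lambda>_. killed_step 1) 1 Z n \<longleftrightarrow> (\<forall>i\<in>{1..n}. 0 < leftwalk Z i)) \<and>
   (0 < chain_state (\<lambda>_. killed_step 1) 1 Z n \<longrightarrow>
     int (chain_state (\<lambda>_. killed_step 1) 1 Z n) = leftwalk Z n)"
proof (induction n)
  case (Suc n)
  have prefix: "(\<forall>i\<in>{1..Suc n}. 0 < leftwalk Z i) \<longleftrightarrow>
      (\<forall>i\<in>{1..n}. 0 < leftwalk Z i) \<and> 0 < leftwalk Z (Suc n)"
    by (auto simp: le_Suc_eq simp del: leftwalk.simps)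
  have "leftwalk Z (Suc n) = leftwalk Z n + 1 * (int (Z (Suc n)) - 1)" by simp
  then show ?case
    unfolding prefix chain_state.simps
    using Suc killed_step_tracks[of _ "leftwalk Z n" 1 "Z (Suc n)"] by presburger
qed simp

lemma chain_state_rightwalk:
  "(0 < chain_state free_first_step 0 Z (Suc n) \<longleftrightarrow> (\<forall>i\<in>{1..Suc n}. 0 < rightwalk Z i)) \<and>
   (0 < chain_state free_first_step 0 Z (Suc n) \<longrightarrow>
     int (chain_state free_first_step 0 Z (Suc n)) = rightwalk Z (Suc n))"
proof (induction n)
  case 0
  then show ?case by (auto simp: free_first_step_def)
next
  case (Suc n)
  have prefix: "(\<forall>i\<in>{1..Suc (Suc n)}. 0 < rightwalk Z i) \<longleftrightarrow>
      (\<forall>i\<in>{1..Suc n}. 0 < rightwalk Z i) \<and> 0 < rightwalk Z (Suc (Suc n))"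
    by (auto simp: le_Suc_eq simp del: rightwalk.simps)
  have step: "chain_state free_first_step 0 Z (Suc (Suc n)) =
      killed_step (- 1) (chain_state free_first_step 0 Z (Suc n)) (Z (Suc (Suc n)))"
    by (simp add: free_first_step_def)
  have "rightwalk Z (Suc (Suc n)) = rightwalk Z (Suc n) + - 1 * (int (Z (Suc (Suc n))) - 1)"
    by simp
  then show ?case
    unfolding prefix step
    using Suc killed_step_tracks[of _ "rightwalk Z (Suc n)" "- 1" "Z (Suc (Suc n))"]
    by presburger
qed

lemma alive_prob_tendsto_ESC:
  "(\<lambda>n. alive_prob (left_law (\<lambda>_. l) (Suc n))) \<longlonglongrightarrow> measure (poisson_steps l) (ESC l)"
  unfolding ESC_def using chain_state_leftwalk by (intro alive_prob_tendsto_escape) blast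

lemma alive_prob_tendsto_ESC_R:
  "(\<lambda>n. alive_prob (right_law (\<lambda>_. l) (Suc n))) \<longlonglongrightarrow> measure (poisson_steps l) (ESC\<^sub>R l)"
  unfolding ESC\<^sub>R_def using chain_state_rightwalk by (intro alive_prob_tendsto_escape) blast

lemma measure_ESC:
  assumes root: "survival_root l y" and l_pos: "0 < l"
  shows "measure (poisson_steps l) (ESC l) = y"
proof (rule antisym)
  show "y \<le> measure (poisson_steps l) (ESC l)"
    using alive_prob_left_law_ge_root[OF root, of 1 _ "\<lambda>_. l"] l_pos
    by (intro LIMSEQ_le_const[OF alive_prob_tendsto_ESC]) (auto simp del: poisson_chain.simps)
  show "measure (poisson_steps l) (ESC l) \<le> y"
  proof (rule field_le_epsilon)
    fix z :: real assume z_pos: "0 < z"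
    have "filterlim (\<lambda>n. z\<^sup>2 / 2 * real (Suc n)) at_top sequentially"
      using z_pos
      by (intro filterlim_tendsto_pos_mult_at_top[OF tendsto_const]
          filterlim_compose[OF filterlim_real_sequentially filterlim_Suc]) auto
    then have "(\<lambda>n. exp (- (z\<^sup>2 / 2 * real (Suc n)))) \<longlonglongrightarrow> 0"
      by (intro filterlim_compose[OF exp_at_bot]
          filterlim_compose[OF filterlim_uminus_at_bot_at_top])
    then have "(\<lambda>n. alive_prob (left_law (\<lambda>_. l) (Suc n)) *
        (1 - exp (- (z\<^sup>2 / 2 * real (Suc n))))) \<longlonglongrightarrow> measure (poisson_steps l) (ESC l) * (1 - 0)"
      by (intro tendsto_intros alive_prob_tendsto_ESC)
    moreover have "alive_prob (left_law (\<lambda>_. l) (Suc n)) *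
        (1 - exp (- (z\<^sup>2 / 2 * real (Suc n)))) \<le> y + z" for n
    proof -
      have "z\<^sup>2 / 2 * real (Suc n) = real (Suc n) * z\<^sup>2 / 2" by simp
      then show ?thesis
        using alive_prob_left_law_le_root[OF root z_pos l_pos, of "Suc n" "\<lambda>_. l"] l_pos
        by (simp only:)
    qed
    ultimately have "measure (poisson_steps l) (ESC l) * (1 - 0) \<le> y + z"
      by (intro LIMSEQ_le_const2) (auto simp del: poisson_chain.simps of_nat_Suc)
    then show "measure (poisson_steps l) (ESC l) \<le> y + z" by simp
  qed
qed

lemma survival_root_measure_ESC:
  assumes "1 < l"
  shows "survival_root l (measure (poisson_steps l) (ESC l))"
    and "2 * (l - 1) / l\<^sup>2 \<le> measure (poisson_steps l) (ESC l)"
proof -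
  obtain y where y_root: "survival_root l y" "2 * (l - 1) / l\<^sup>2 \<le> y"
    using survival_root_exists[OF assms] .
  have "measure (poisson_steps l) (ESC l) = y"
    using assms by (intro measure_ESC[OF y_root(1)]) simp
  then show "survival_root l (measure (poisson_steps l) (ESC l))"
    "2 * (l - 1) / l\<^sup>2 \<le> measure (poisson_steps l) (ESC l)"
    using y_root by simp_all
qed

lemma measure_ESC_R:
  assumes l_range: "0 < l" "l \<le> 1"
  shows "measure (poisson_steps l) (ESC\<^sub>R l) = 1 - l"
proof (rule antisym)
  show "1 - l \<le> measure (poisson_steps l) (ESC\<^sub>R l)"
    using alive_prob_right_law_ge[of "Suc _" "\<lambda>_. l"] l_range
    by (intro LIMSEQ_le_const[OF alive_prob_tendsto_ESC_R]) (auto simp del: poisson_chain.simps)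
  have "(\<lambda>n. 1 - l + 1 / sqrt (real (Suc n))) \<longlonglongrightarrow> 1 - l + 0"
    by (intro tendsto_add tendsto_const tendsto_divide_0[OF tendsto_const]
        filterlim_at_top_imp_at_infinity filterlim_compose[OF sqrt_at_top]
        filterlim_compose[OF filterlim_real_sequentially filterlim_Suc])
  then show "measure (poisson_steps l) (ESC\<^sub>R l) \<le> 1 - l"
    using alive_prob_right_law_le[of "Suc _" "\<lambda>_. l"] l_range
    by (intro LIMSEQ_le[OF alive_prob_tendsto_ESC_R, of _ "1 - l"])
      (auto simp del: poisson_chain.simps)
qed

section \<open>The tilted rates\<close>

lemma one_minus_power_mult_le_1:
  fixes p :: real
  assumes "0 \<le> p" "p \<le> 1"
  shows "(1 - p) ^ n * (1 + real n * p) \<le> 1"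
proof -
  have "(1 - p) ^ n * (1 + real n * p) \<le> (1 - p) ^ n * (1 + p) ^ n"
    using assms by (intro mult_left_mono Bernoulli_inequality) auto
  also have "\<dots> = (1 - p\<^sup>2) ^ n"
    by (simp add: power_mult_distrib[symmetric] power2_eq_square algebra_simps)
  also have "\<dots> \<le> 1" using assms by (intro power_le_one) (auto simp: power_le_one)
  finally show ?thesis .
qed

lemma geometric_sum_le:
  fixes p :: real
  assumes "0 \<le> p" "p \<le> 1" "1 \<le> k"
  shows "(\<Sum>i<k. (1 - p) ^ i) * (1 + (real k - 1) * p / 2) \<le> real k"
proof -
  define S where "S = (\<lambda>k. \<Sum>i<k. (1 - p) ^ i)"
  have p_S: "p * S n = 1 - (1 - p) ^ n" for n by (simp add: S_def one_diff_power_eq)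
  have "S k + (real k - 1) / 2 * (p * S k) \<le> real k" using assms(3)
  proof (induction k rule: dec_induct)
    case base
    then show ?case by (simp add: S_def)
  next
    case (step n)
    define Q where "Q = (1 - p) ^ n"
    have S_Suc: "S (Suc n) = S n + Q" by (simp add: S_def Q_def)
    have "(\<Sum>i<n. Q) \<le> S n"
      unfolding S_def Q_def using assms by (intro sum_mono power_decreasing) auto
    then have "p * (real n * Q) \<le> p * S n" using assms by (intro mult_left_mono) auto
    then have last: "p * (real n * Q) \<le> 1 - Q" by (simp add: p_S Q_def)
    have IH: "S n + (real n - 1) / 2 * (1 - Q) \<le> real n"
      using step.IH by (simp only: p_S Q_def)
    have "S (Suc n) + (real (Suc n) - 1) / 2 * (p * S (Suc n)) =
        (S n + (real n - 1) / 2 * (1 - Q)) + p * (real n * Q) / 2 + (1 + Q) / 2"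
      unfolding S_Suc distrib_left p_S Q_def[symmetric] by (simp add: field_simps)
    also have "\<dots> \<le> real n + (1 - Q) / 2 + (1 + Q) / 2"
      using IH last by (intro add_mono) auto
    also have "\<dots> = real (Suc n)" by (simp add: field_simps)
    finally show ?case .
  qed
  then have "S k * (1 + (real k - 1) * p / 2) \<le> real k" by (simp add: algebra_simps)
  then show ?thesis by (simp add: S_def)
qed

lemma geometric_sum_ge:
  fixes p :: real
  assumes "0 \<le> p" "p \<le> 1" "1 \<le> k"
  shows "real k * (1 - p) ^ (k - 1) * (1 + (real k - 1) * p / 2) \<le> (\<Sum>i<k. (1 - p) ^ i)"
proof -
  have "(\<Sum>i<k. 1 + real i * p) = real k * (1 + (real k - 1) * p / 2)"
    by (induction k) (simp_all add: field_simps)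
  then have "real k * (1 - p) ^ (k - 1) * (1 + (real k - 1) * p / 2) =
      (\<Sum>i<k. (1 - p) ^ (k - 1) * (1 + real i * p))"
    by (simp add: sum_distrib_left[symmetric])
  also have "\<dots> \<le> (\<Sum>i<k. (1 - p) ^ (k - 1 - i))"
  proof (rule sum_mono)
    fix i assume "i \<in> {..<k}"
    then have "(1 - p) ^ (k - 1) = (1 - p) ^ (k - 1 - i) * (1 - p) ^ i"
      by (simp add: power_add[symmetric])
    then show "(1 - p) ^ (k - 1) * (1 + real i * p) \<le> (1 - p) ^ (k - 1 - i)"
      using mult_left_mono[OF one_minus_power_mult_le_1[OF assms(1,2), of i],
          of "(1 - p) ^ (k - 1 - i)"] assms by (simp add: mult.assoc)
  qed
  also have "\<dots> = (\<Sum>i<k. (1 - p) ^ i)"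
    by (rule sum.reindex_bij_witness[where i = "\<lambda>i. k - 1 - i" and j = "\<lambda>i. k - 1 - i"]) auto
  finally show ?thesis .
qed

lemma tilted_rate_0: "tilted_rate p k 0 = rate_left p k"
  by (simp add: tilted_rate_def)

lemma rev_tilted_rate_0: "rev_rates k (tilted_rate p k) 0 = rate_right p k"
  by (simp add: rev_rates_def tilted_rate_def rate_left_def rate_right_def)

context
  fixes p :: real and k :: nat
  assumes tilt: "0 < p" "p < 1" and k_ge_2: "2 \<le> k"
begin

lemma geometric_sum_pos: "0 < (\<Sum>i<k. (1 - p) ^ i)"
  using tilt k_ge_2 by (intro sum_pos) (auto simp: lessThan_empty_iff)

lemma rate_left_eq: "rate_left p k = (real k - 1) / (\<Sum>i<k. (1 - p) ^ i)"
  using tilt by (simp add: rate_left_def one_diff_power_eq)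

lemma rate_right_eq: "rate_right p k = (real k - 1) * (1 - p) ^ (k - 1) / (\<Sum>i<k. (1 - p) ^ i)"
  using tilt by (simp add: rate_right_def one_diff_power_eq)

lemma rate_right_pos: "0 < rate_right p k"
  using geometric_sum_pos tilt k_ge_2 by (simp add: rate_right_eq)

lemma rate_left_ge: "(1 - 1 / k) * (1 + (real k - 1) * p / 2) \<le> rate_left p k"
proof -
  have "1 + (real k - 1) * p / 2 \<le> real k / (\<Sum>i<k. (1 - p) ^ i)"
    using geometric_sum_le[of p k] geometric_sum_pos tilt k_ge_2
    by (simp add: pos_le_divide_eq mult.commute)
  then have "(1 - 1 / k) * (1 + (real k - 1) * p / 2) \<le>
      (1 - 1 / k) * (real k / (\<Sum>i<k. (1 - p) ^ i))"
    using k_ge_2 by (intro mult_left_mono) auto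
  also have "\<dots> = (1 - 1 / k) * real k / (\<Sum>i<k. (1 - p) ^ i)" by simp
  also have "(1 - 1 / k) * real k = real k - 1" using k_ge_2 by (simp add: field_simps)
  also have "\<dots> / (\<Sum>i<k. (1 - p) ^ i) = rate_left p k" by (rule rate_left_eq[symmetric])
  finally show ?thesis .
qed

lemma rate_left_le: "rate_left p k \<le> 1 + p * real k"
proof -
  have "p * real k \<le> (1 + p * real k) * (1 - (1 - p) ^ k)"
    using one_minus_power_mult_le_1[of p k] tilt by (simp add: algebra_simps)
  also have "\<dots> = p * ((1 + p * real k) * (\<Sum>i<k. (1 - p) ^ i))"
    by (simp add: one_diff_power_eq)
  finally have "p * real k \<le> p * ((1 + p * real k) * (\<Sum>i<k. (1 - p) ^ i))" .
  then have "real k - 1 \<le> (1 + p * real k) * (\<Sum>i<k. (1 - p) ^ i)"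
    using tilt by (simp only: mult_le_cancel_left_pos)
  then show ?thesis
    using geometric_sum_pos by (simp add: rate_left_eq pos_divide_le_eq)
qed

lemma rate_right_le: "rate_right p k \<le> 1 / (1 + (real k - 1) * p / 2)"
proof -
  have growth: "0 < 1 + (real k - 1) * p / 2" using tilt k_ge_2 by (intro add_pos_nonneg) auto
  have "(real k - 1) * ((1 - p) ^ (k - 1) * (1 + (real k - 1) * p / 2)) \<le>
      real k * ((1 - p) ^ (k - 1) * (1 + (real k - 1) * p / 2))"
    using tilt growth by (intro mult_right_mono) auto
  also have "\<dots> \<le> (\<Sum>i<k. (1 - p) ^ i)"
    using geometric_sum_ge[of p k] tilt k_ge_2 by (simp add: mult.assoc)
  finally show ?thesis
    using growth geometric_sum_pos
    by (simp add: rate_right_eq pos_divide_le_eq pos_le_divide_eq mult_ac)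
qed

lemma tilted_rate_pos: "0 < tilted_rate p k i"
  using rate_left_pos[OF tilt k_ge_2] tilt by (simp add: tilted_rate_def)

lemma tilted_rate_antimono: "i \<le> j \<Longrightarrow> tilted_rate p k j \<le> tilted_rate p k i"
  unfolding tilted_rate_def using rate_left_pos[OF tilt k_ge_2] tilt
  by (intro mult_left_mono power_decreasing) auto

lemma tilted_rate_add_ge: "tilted_rate p k i * (1 - real j * p) \<le> tilted_rate p k (i + j)"
proof -
  have "1 + real j * (- p) \<le> (1 + (- p)) ^ j" using tilt by (intro Bernoulli_inequality) auto
  then have "tilted_rate p k i * (1 - real j * p) \<le> tilted_rate p k i * (1 - p) ^ j"
    using tilted_rate_pos[of i] by (intro mult_left_mono) auto
  then show ?thesis by (simp add: tilted_rate_def power_add mult.assoc)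
qed

lemma rev_tilted_rate_le:
  assumes "j \<le> k - 1"
  shows "rev_rates k (tilted_rate p k) j * (1 - real j * p) \<le> rate_right p k"
proof -
  have "k - 1 - j + j = k - 1" using assms by simp
  then show ?thesis
    using tilted_rate_add_ge[of "k - 1 - j" j] rev_tilted_rate_0[of k p]
    by (simp only: rev_rates_def diff_zero)
qed

end

abbreviation (input) esc_prob :: "real \<Rightarrow> nat \<Rightarrow> real" where
  "esc_prob p k \<equiv> measure (poisson_steps (rate_left p k)) (ESC (rate_left p k))"

abbreviation (input) esc_prob_right :: "real \<Rightarrow> nat \<Rightarrow> real" where
  "esc_prob_right p k \<equiv> measure (poisson_steps (rate_right p k)) (ESC\<^sub>R (rate_right p k))"

lemma esc_prob_right_eq:
  assumes "0 < p" "p < 1" "2 \<le> k"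
  shows "esc_prob_right p k = 1 - rate_right p k"
proof -
  have "rate_right p k \<le> 1 / (1 + (real k - 1) * p / 2)" by (rule rate_right_le[OF assms])
  also have "\<dots> \<le> 1 / 1"
    using assms by (intro divide_left_mono) (auto intro!: add_pos_nonneg)
  finally show ?thesis using rate_right_pos[OF assms] by (simp add: measure_ESC_R)
qed

section \<open>Bounded tilt\<close>

locale bounded_tilt =
  fixes p :: real and k :: nat and B :: real
  assumes tilt: "0 < p" "p < 1" and B_ge: "1 + p * real k \<le> B" and k_ge: "64 * B \<le> real k"
    and tilt_ge: "7 \<le> p * real k * sqrt (real k)"
begin

lemma B_gt_1: "1 < B"
proof -
  have "k \<noteq> 0" using tilt_ge by (intro notI) simp
  then have "0 < p * real k" using tilt by simp
  then show ?thesis using B_ge by simp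
qed

lemma k_ge_64: "64 \<le> real k"
  using B_gt_1 k_ge by simp

lemma k_ge_2: "2 \<le> k"
  using k_ge_64 by simp

lemma pk_pos: "0 < p * real k"
  using tilt k_ge_64 by simp

lemma half_growth_ge: "p * real k / 4 \<le> (real k - 1) * p / 2"
proof -
  define c where "c = p * real k"
  have "p * 2 \<le> c" unfolding c_def using tilt k_ge_64 by (intro mult_left_mono) auto
  then have "c / 4 \<le> (c - p) / 2" by simp
  then show ?thesis by (simp add: c_def algebra_simps)
qed

lemma rate_left_le_B: "rate_left p k \<le> B"
  using rate_left_le[OF tilt k_ge_2] B_ge by simp

lemma rate_left_minus_1_ge: "p * real k / 4 \<le> rate_left p k - 1"
proof -
  define c where "c = p * real k"
  define u where "u = 1 / real k"
  have u_range: "0 < u" "u \<le> 1 / 64" using k_ge_64 by (auto simp: u_def field_simps)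
  have "c * sqrt (real k) \<le> c * real k"
    using pk_pos k_ge_64 by (intro mult_left_mono real_le_lsqrt) (auto simp: c_def self_le_power)
  then have "7 \<le> c * real k" using tilt_ge by (simp add: c_def)
  then have c_ge: "7 * u \<le> c" using k_ge_64 by (simp add: u_def field_simps)
  have "(1 - u) * (1 + (1 - u) * c / 2) = (1 - 1 / k) * (1 + (real k - 1) * p / 2)"
    using k_ge_64 by (simp add: u_def c_def field_simps)
  also have "\<dots> \<le> rate_left p k" by (rule rate_left_ge[OF tilt k_ge_2])
  finally have "1 - u + (1 - u)\<^sup>2 * c / 2 \<le> rate_left p k"
    by (simp add: power2_eq_square algebra_simps)
  moreover have "(63 / 64)\<^sup>2 * c \<le> (1 - u)\<^sup>2 * c"
    using u_range c_ge by (intro mult_right_mono power_mono) auto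
  moreover have "(63 / 64)\<^sup>2 * c = 3969 / 4096 * c" by (simp add: power2_eq_square)
  ultimately show ?thesis using c_ge u_range unfolding c_def[symmetric] by linarith
qed

lemma rate_left_gt_1: "1 < rate_left p k"
  using rate_left_minus_1_ge pk_pos by simp

lemma survival_root_esc_prob: "survival_root (rate_left p k) (esc_prob p k)"
  by (rule survival_root_measure_ESC[OF rate_left_gt_1])

lemma esc_prob_pos: "0 < esc_prob p k"
  using survival_root_esc_prob by (simp add: survival_root_def)

lemma esc_prob_ge: "p * real k \<le> 2 * B\<^sup>2 * esc_prob p k"
proof -
  have "p * real k / (2 * B\<^sup>2) = 2 * (p * real k / 4) / B\<^sup>2" by simp
  also have "\<dots> \<le> 2 * (rate_left p k - 1) / B\<^sup>2"
    using rate_left_minus_1_ge by (intro divide_right_mono) auto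
  also have "\<dots> \<le> 2 * (rate_left p k - 1) / (rate_left p k)\<^sup>2"
    using rate_left_gt_1 rate_left_le_B by (intro divide_left_mono power_mono) auto
  also have "\<dots> \<le> esc_prob p k" by (rule survival_root_measure_ESC[OF rate_left_gt_1])
  finally show ?thesis using B_gt_1 by (simp add: field_simps)
qed

lemma esc_prob_right_ge: "p * real k \<le> 4 * B * esc_prob_right p k"
proof -
  define c where "c = p * real k"
  have c_range: "0 < c" "1 + c \<le> B" using pk_pos B_ge by (auto simp: c_def)
  have "rate_right p k \<le> 1 / (1 + (real k - 1) * p / 2)" by (rule rate_right_le[OF tilt k_ge_2])
  also have "\<dots> \<le> 1 / (1 + c / 4)"
    using half_growth_ge c_range by (intro divide_left_mono) (auto simp: c_def)
  also have "\<dots> = 1 - (c / 4) / (1 + c / 4)" using c_range by (simp add: field_simps)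
  finally have "(c / 4) / (1 + c / 4) \<le> esc_prob_right p k"
    using esc_prob_right_eq[OF tilt k_ge_2] by simp
  moreover have "c / 4 / B \<le> (c / 4) / (1 + c / 4)" using c_range by (intro divide_left_mono) auto
  ultimately have "c / 4 / B \<le> esc_prob_right p k" by linarith
  then show ?thesis using B_gt_1 unfolding c_def[symmetric] by (simp add: field_simps)
qed

lemma esc_prob_right_pos: "0 < esc_prob_right p k"
proof -
  have "0 < 4 * B * esc_prob_right p k" using esc_prob_right_ge pk_pos by linarith
  then show ?thesis using B_gt_1 by (simp add: zero_less_mult_iff)
qed

lemma esc_prob_right_lt_1: "esc_prob_right p k < 1"
  using esc_prob_right_eq[OF tilt k_ge_2] rate_right_pos[OF tilt k_ge_2] by simp

end

text \<open>With \<open>C = p k\<^sup>3\<^sup>/\<^sup>2\<close>, the factors by which the bounds for the tree probability differ from the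
  product of the escape probabilities; they tend to \<open>1\<close> if first \<open>C \<rightarrow> \<infinity>\<close> and then \<open>\<eta> \<rightarrow> 0\<close>.\<close>

definition upper_factor :: "real \<Rightarrow> real \<Rightarrow> real \<Rightarrow> real" where
  "upper_factor B \<eta> C = sqrt (1 / (1 - 3 * B * \<eta> ^ 4)) *
     ((1 + \<eta>) / (1 - exp (- (\<eta> ^ 6 * C\<^sup>2 / (16 * B ^ 4))))) * (1 + 8 * B / (\<eta>\<^sup>2 * C))"

definition left_factor :: "real \<Rightarrow> real \<Rightarrow> real \<Rightarrow> real" where
  "left_factor B \<eta> C = 1 - 4 * B * \<eta> ^ 4 - 2 * B * \<eta>\<^sup>2 - 24 * B ^ 3 / C"

definition right_factor :: "real \<Rightarrow> real \<Rightarrow> real \<Rightarrow> real" where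
  "right_factor B \<eta> C = (1 - 4 * B * \<eta> ^ 4) * (1 - \<eta>\<^sup>2) - 4 * B / (\<eta> * C)"

definition excess_factor :: "real \<Rightarrow> real \<Rightarrow> real \<Rightarrow> real" where
  "excess_factor B \<eta> C = \<eta> ^ 4 * C / (16 * B) - \<eta>"

definition middle_factor :: "real \<Rightarrow> real \<Rightarrow> real \<Rightarrow> real" where
  "middle_factor B \<eta> C =
     exp (- (4 * \<eta>\<^sup>2 / (1 - 3 * B * \<eta> ^ 4))) - 1 / (excess_factor B \<eta> C)\<^sup>2 * sqrt (64 * B)"

definition lower_factor :: "real \<Rightarrow> real \<Rightarrow> real \<Rightarrow> real" where
  "lower_factor B \<eta> C = left_factor B \<eta> C * right_factor B \<eta> C * middle_factor B \<eta> C"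

text \<open>The blocks at both ends have length about \<open>\<eta>\<^sup>4 k\<close> and the walk is controlled up to deviations
  \<open>\<eta> k\<^sup>1\<^sup>/\<^sup>2\<close>, which dominate the fluctuations over a block but not its drift.\<close>

locale tilt_window = bounded_tilt +
  fixes \<eta> :: real
  assumes \<eta>_range: "0 < \<eta>" "16 * B * \<eta> ^ 4 \<le> 1" "2 \<le> \<eta> ^ 4 * real k" "4 * \<eta> \<le> sqrt (real k)"
begin

abbreviation (input) "r \<equiv> tilted_rate p k"
abbreviation (input) "rev_r \<equiv> rev_rates k r"
abbreviation (input) "C \<equiv> p * real k * sqrt (real k)"

definition m :: nat where "m = nat \<lfloor>\<eta> ^ 4 * real k\<rfloor>"
definition \<theta> :: real where "\<theta> = 1 - 4 * B * \<eta> ^ 4"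

lemma m_le: "real m \<le> \<eta> ^ 4 * real k" and m_ge: "\<eta> ^ 4 * real k / 2 \<le> real m" and m_pos: "0 < m"
proof -
  have "0 \<le> \<eta> ^ 4 * real k" using \<eta>_range by simp
  then have floor: "real m \<le> \<eta> ^ 4 * real k" "\<eta> ^ 4 * real k - 1 \<le> real m"
    unfolding m_def by linarith+
  then show "real m \<le> \<eta> ^ 4 * real k" "\<eta> ^ 4 * real k / 2 \<le> real m" using \<eta>_range by auto
  then show "0 < m" using \<eta>_range by (intro gr0I) simp
qed

lemma m_B_le: "16 * B * real m \<le> real k"
proof -
  have "16 * B * real m \<le> 16 * B * (\<eta> ^ 4 * real k)"
    using m_le B_gt_1 by (intro mult_left_mono) auto
  also have "\<dots> = (16 * B * \<eta> ^ 4) * real k" by simp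
  also have "\<dots> \<le> 1 * real k" using \<eta>_range by (intro mult_right_mono) auto
  finally show ?thesis by simp
qed

lemma \<theta>_ge: "1 / 2 \<le> \<theta>" and \<theta>_le_1: "\<theta> \<le> 1"
  using \<eta>_range B_gt_1 by (auto simp: \<theta>_def)

lemma mp_le: "real m * p \<le> \<eta> ^ 4 * (p * real k)"
  using mult_right_mono[OF m_le, of p] tilt by (simp add: mult_ac)

lemma rate_pos: "0 < r i"
  by (rule tilted_rate_pos[OF tilt k_ge_2])

lemma rate_le_left: "r i \<le> rate_left p k"
  using tilted_rate_antimono[OF tilt k_ge_2, of 0 i] by (simp add: tilted_rate_0)

lemma rate_ge: "rate_left p k - rate_left p k * (real i * p) \<le> r i"
  using tilted_rate_add_ge[OF tilt k_ge_2, of 0 i] by (simp add: tilted_rate_0 algebra_simps)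

lemma rev_rate_pos: "0 < rev_r i"
  unfolding rev_rates_def by (rule rate_pos)

lemma rev_rate_0: "rev_r 0 = 1 - esc_prob_right p k"
  using rev_tilted_rate_0 esc_prob_right_eq[OF tilt k_ge_2] by simp

lemma rev_rate_mono: "i \<le> j \<Longrightarrow> rev_r i \<le> rev_r j"
  unfolding rev_rates_def by (intro tilted_rate_antimono[OF tilt k_ge_2]) auto

lemma rev_rate_le: "j \<le> k - 1 \<Longrightarrow> rev_r j * (1 - real j * p) \<le> 1 - esc_prob_right p k"
  using rev_tilted_rate_le[OF tilt k_ge_2] esc_prob_right_eq[OF tilt k_ge_2] by simp

lemma sum_rates: "(\<Sum>i<k. r i) = real (k - 1)"
  using sum_tilted_rate[OF tilt, of k] k_ge_2 by simp

lemma left_block_rate_ge: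
  assumes "i < m"
  shows "1 + \<theta> * (rate_left p k - 1) \<le> r i"
proof -
  have "rate_left p k * (real i * p) \<le> B * (real m * p)"
    using assms rate_left_le_B rate_left_gt_1 tilt by (intro mult_mono) auto
  also have "\<dots> \<le> B * (\<eta> ^ 4 * (p * real k))" using mp_le B_gt_1 by (intro mult_left_mono) auto
  also have "\<dots> = B * \<eta> ^ 4 * (p * real k)" by simp
  also have "\<dots> \<le> B * \<eta> ^ 4 * (4 * (rate_left p k - 1))"
    using rate_left_minus_1_ge B_gt_1 by (intro mult_left_mono) auto
  finally have "rate_left p k * (real i * p) \<le> 4 * B * \<eta> ^ 4 * (rate_left p k - 1)"
    by (simp only: mult_ac)
  then show ?thesis using rate_ge[of i] by (simp add: \<theta>_def algebra_simps)
qed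

subsection \<open>The index where the rates cross \<open>1\<close>\<close>

definition crossing :: nat where "crossing = (LEAST i. r i < 1)"
definition margin :: nat where "margin = nat \<lfloor>real k / (8 * B)\<rfloor>"

lemma rate_ge_1_before_crossing: "i < crossing \<Longrightarrow> 1 \<le> r i"
  using not_less_Least[of i "\<lambda>i. r i < 1"] by (simp add: crossing_def)

lemma rate_lt_1_after_crossing:
  assumes "crossing \<le> i"
  shows "r i < 1"
proof -
  have "r (k - 1) < 1"
    using rev_rate_0 esc_prob_right_pos by (simp add: rev_rates_def)
  then have "r crossing < 1" unfolding crossing_def by (rule LeastI)
  then show ?thesis using tilted_rate_antimono[OF tilt k_ge_2 assms] by simp
qed

lemma margin_le: "real margin \<le> real k / (8 * B)"
  and margin_ge: "real k / (8 * B) - 1 \<le> real margin"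
  unfolding margin_def using B_gt_1 k_ge_64 by auto

lemma m_margin_less: "real (m + margin) < real k / (4 * B)"
proof -
  have "real m \<le> real k / (16 * B)" using m_B_le B_gt_1 by (simp add: field_simps)
  moreover have "real k / (4 * B) = 4 * (real k / (16 * B))"
    "real k / (8 * B) = 2 * (real k / (16 * B))" by auto
  moreover have "0 < real k / (16 * B)" using k_ge_64 B_gt_1 by simp
  ultimately show ?thesis using margin_le by simp
qed

lemma crossing_ge: "m + margin \<le> crossing"
proof (rule ccontr)
  assume "\<not> m + margin \<le> crossing"
  then have "real crossing \<le> real k / (4 * B)" using m_margin_less by simp
  then have "real crossing * p \<le> p * real k / (4 * B)"
    using mult_right_mono[of "real crossing" "real k / (4 * B)" p] tilt by (simp add: mult_ac)
  then have "rate_left p k * (real crossing * p) \<le> B * (p * real k / (4 * B))"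
    using rate_left_le_B rate_left_gt_1 tilt by (intro mult_mono) auto
  also have "\<dots> \<le> rate_left p k - 1" using rate_left_minus_1_ge B_gt_1 by simp
  finally have "1 \<le> r crossing" using rate_ge[of crossing] by simp
  then show False using rate_lt_1_after_crossing[of crossing] by simp
qed

lemma crossing_le: "crossing + (m + margin) \<le> k - 1"
proof -
  define j where "j = m + margin"
  have j_less: "real j < real k / (4 * B)" using m_margin_less by (simp add: j_def)
  have "real k / (4 * B) \<le> real k / 4" using B_gt_1 k_ge_64 by (intro divide_left_mono) auto
  then have j_le: "j \<le> k - 1" using j_less k_ge_64 by linarith
  have "real j * p < p * real k / (4 * B)"
    using mult_strict_right_mono[OF j_less, of p] tilt by (simp add: mult_ac)
  also have "\<dots> \<le> esc_prob_right p k"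
    using esc_prob_right_ge B_gt_1 by (simp add: field_simps)
  finally have jp_less: "real j * p < esc_prob_right p k" .
  have "rev_r j * (1 - real j * p) < 1 * (1 - real j * p)"
    using rev_rate_le[OF j_le] jp_less by simp
  then have "rev_r j < 1" using jp_less esc_prob_right_lt_1
    by (simp only: mult_less_cancel_right_pos)
  then have "\<not> k - 1 - j < crossing"
    using rate_ge_1_before_crossing[of "k - 1 - j"] by (auto simp: rev_rates_def)
  then show ?thesis using j_le by (simp add: j_def)
qed

lemma right_block_rate_le:
  assumes "j < m"
  shows "rev_r j \<le> 1 - \<theta> * esc_prob_right p k"
proof -
  have j_range: "j \<le> k - 1" "crossing \<le> k - 1 - j" using crossing_le assms by auto
  have "real j * p \<le> real m * p" using assms tilt by (intro mult_right_mono) auto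
  also have "\<dots> \<le> \<eta> ^ 4 * (4 * B * esc_prob_right p k)"
    using mp_le mult_left_mono[OF esc_prob_right_ge, of "\<eta> ^ 4"] by simp
  finally have jp_le: "real j * p \<le> (1 - \<theta>) * esc_prob_right p k" by (simp add: \<theta>_def mult_ac)
  have "rev_r j * (real j * p) \<le> 1 * (real j * p)"
    using rate_lt_1_after_crossing[OF j_range(2)] tilt
    by (intro mult_right_mono) (auto simp: rev_rates_def)
  then have "rev_r j \<le> 1 - esc_prob_right p k + real j * p"
    using rev_rate_le[OF j_range(1)] by (simp add: algebra_simps)
  then show ?thesis using jp_le by (simp add: algebra_simps)
qed

lemma sum_right_block_le: "(\<Sum>i<m. rev_r i) \<le> real m * (1 - \<theta> * esc_prob_right p k)"
  using sum_mono[of "{..<m}" rev_r "\<lambda>_. 1 - \<theta> * esc_prob_right p k"] right_block_rate_le by simp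

lemma sum_middle_ge: "real k * (1 - 3 * B * \<eta> ^ 4) + 1 \<le> (\<Sum>i\<in>{m..<k - m}. r i)"
proof -
  have m_range: "m \<le> k - m" "k - m \<le> k" using crossing_le crossing_ge by auto
  have blocks: "(\<Sum>i\<in>{0..<m}. r i) + (\<Sum>i\<in>{m..<k - m}. r i) + (\<Sum>i\<in>{k - m..<k}. r i) =
      (\<Sum>i\<in>{0..<k}. r i)"
    using m_range by (simp add: sum.atLeastLessThan_concat)
  have left: "(\<Sum>i\<in>{0..<m}. r i) \<le> real m * B"
    using sum_mono[of "{0..<m}" r "\<lambda>_. B"] order_trans[OF rate_le_left rate_left_le_B] by simp
  have right: "(\<Sum>i\<in>{k - m..<k}. r i) \<le> real m"
    using sum_mono[of "{k - m..<k}" r "\<lambda>_. 1"] rate_lt_1_after_crossing crossing_le m_range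
    by (force simp: less_imp_le)
  have "real m * (B + 1) \<le> \<eta> ^ 4 * real k * (B + 1)"
    using m_le B_gt_1 by (intro mult_right_mono) auto
  moreover have "2 * 1 \<le> \<eta> ^ 4 * real k * (2 * B - 1)"
    using \<eta>_range(3) B_gt_1 by (intro mult_mono) auto
  ultimately show ?thesis
    using blocks left right sum_rates k_ge_2
    by (simp add: of_nat_diff atLeast0LessThan algebra_simps)
qed

lemma middle_ratio_ge: "13 / 16 \<le> 1 - 3 * B * \<eta> ^ 4"
  using \<eta>_range(2) by simp

subsection \<open>Upper bound\<close>

lemma alive_prob_left_block_le:
  "alive_prob (left_law r m) \<le>
    (1 + \<eta>) / (1 - exp (- (\<eta> ^ 6 * C\<^sup>2 / (16 * B ^ 4)))) * esc_prob p k"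
proof -
  let ?v = "alive_prob (left_law r m)" and ?y = "esc_prob p k"
  have "\<eta> ^ 6 * C\<^sup>2 / (16 * B ^ 4) = \<eta> ^ 6 * real k * (p * real k / (2 * B\<^sup>2))\<^sup>2 / 4"
    using B_gt_1 by (simp add: power_mult_distrib power_divide field_simps)
  also have "\<dots> \<le> \<eta> ^ 6 * real k * ?y\<^sup>2 / 4"
    using esc_prob_ge pk_pos B_gt_1
    by (intro divide_right_mono mult_left_mono power_mono) (auto simp: field_simps)
  also have "\<dots> = \<eta> ^ 4 * real k / 2 * (\<eta> * ?y)\<^sup>2 / 2"
    by (simp add: power_mult_distrib power2_eq_square eval_nat_numeral)
  also have "\<dots> \<le> real m * (\<eta> * ?y)\<^sup>2 / 2"
    using m_ge by (intro divide_right_mono mult_right_mono) auto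
  finally have exponent: "\<eta> ^ 6 * C\<^sup>2 / (16 * B ^ 4) \<le> real m * (\<eta> * ?y)\<^sup>2 / 2" .
  have "?v * (1 - exp (- (\<eta> ^ 6 * C\<^sup>2 / (16 * B ^ 4)))) \<le>
      ?v * (1 - exp (- (real m * (\<eta> * ?y)\<^sup>2 / 2)))"
    using exponent alive_prob_nonneg by (intro mult_left_mono) auto
  also have "\<dots> \<le> ?y + \<eta> * ?y"
    using \<eta>_range(1) esc_prob_pos rate_left_gt_1 rate_pos rate_le_left
    by (intro alive_prob_left_law_le_root[OF survival_root_esc_prob]) auto
  finally have "?v * (1 - exp (- (\<eta> ^ 6 * C\<^sup>2 / (16 * B ^ 4)))) \<le> (1 + \<eta>) * ?y"
    by (simp add: algebra_simps)
  moreover have "0 < 1 - exp (- (\<eta> ^ 6 * C\<^sup>2 / (16 * B ^ 4)))"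
    using \<eta>_range(1) tilt k_ge_64 B_gt_1 by simp
  ultimately show ?thesis by (simp add: pos_le_divide_eq)
qed

lemma inverse_sqrt_k_le: "1 / sqrt (real k) \<le> esc_prob_right p k * (4 * B / C)"
proof -
  have "1 / sqrt (real k) = p * real k / C" using tilt k_ge_64 by simp
  also have "\<dots> \<le> 4 * B * esc_prob_right p k / C"
    using esc_prob_right_ge pk_pos by (intro divide_right_mono) auto
  finally show ?thesis by (simp add: mult_ac)
qed

lemma alive_prob_right_block_le:
  "alive_prob (right_law rev_r m) \<le> (1 + 8 * B / (\<eta>\<^sup>2 * C)) * esc_prob_right p k"
proof -
  have k_pos: "0 < real k" using k_ge_64 by simp
  have "alive_prob (right_law rev_r m) \<le> 1 - rev_r 0 + 1 / sqrt (real m)"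
    using m_pos rev_rate_0 esc_prob_right_pos rev_rate_pos
    by (intro alive_prob_right_law_le rev_rate_mono) auto
  also have "1 / sqrt (real m) \<le> 1 / (\<eta>\<^sup>2 / 2 * sqrt (real k))"
  proof (rule divide_left_mono)
    have "(\<eta>\<^sup>2 / 2 * sqrt (real k))\<^sup>2 \<le> real m"
      using m_ge by (simp add: power_mult_distrib power_divide power_mult[symmetric])
    then show "\<eta>\<^sup>2 / 2 * sqrt (real k) \<le> sqrt (real m)" by (rule real_le_rsqrt)
  qed (use m_pos \<eta>_range(1) k_pos in auto)
  also have "1 / (\<eta>\<^sup>2 / 2 * sqrt (real k)) = 2 / \<eta>\<^sup>2 * (1 / sqrt (real k))" by simp
  also have "\<dots> \<le> 2 / \<eta>\<^sup>2 * (esc_prob_right p k * (4 * B / C))"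
    by (intro mult_left_mono inverse_sqrt_k_le) auto
  finally show ?thesis using rev_rate_0 by (simp add: algebra_simps)
qed

lemma tree_prob_le: "tree_prob p k \<le> upper_factor B \<eta> C * (esc_prob p k * esc_prob_right p k)"
proof -
  define M where "M = nat \<lfloor>\<Sum>i\<in>{m..<k - m}. r i\<rfloor>"
  have ratio_pos: "0 < 1 - 3 * B * \<eta> ^ 4" using middle_ratio_ge by simp
  then have "0 < real k * (1 - 3 * B * \<eta> ^ 4)" using k_ge_64 by simp
  then have M_range: "1 \<le> M" "real M \<le> (\<Sum>i\<in>{m..<k - m}. r i)"
    "real k * (1 - 3 * B * \<eta> ^ 4) \<le> real M"
    unfolding M_def using sum_middle_ge by (auto simp: le_nat_iff le_floor_iff) linarith+
  have "tree_prob p k * poisson_peak (k - 1) \<le> sqrt (real (k - 1) / real M) * poisson_peak (k - 1) *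
      alive_prob (left_law r m) * alive_prob (right_law rev_r m)"
    unfolding prob_TREE_eq_first_passage_weight[OF tilt k_ge_2]
    using M_range m_pos crossing_ge crossing_le rate_pos sum_rates
    by (intro first_passage_weight_le) auto
  then have "tree_prob p k * poisson_peak (k - 1) \<le> (sqrt (real (k - 1) / real M) *
      alive_prob (left_law r m) * alive_prob (right_law rev_r m)) * poisson_peak (k - 1)"
    by (simp only: mult_ac)
  then have "tree_prob p k \<le>
      sqrt (real (k - 1) / real M) * alive_prob (left_law r m) * alive_prob (right_law rev_r m)"
    using poisson_peak_pos by (simp only: mult_le_cancel_right_pos)
  also have "\<dots> \<le> sqrt (1 / (1 - 3 * B * \<eta> ^ 4)) *
      ((1 + \<eta>) / (1 - exp (- (\<eta> ^ 6 * C\<^sup>2 / (16 * B ^ 4)))) * esc_prob p k) *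
      ((1 + 8 * B / (\<eta>\<^sup>2 * C)) * esc_prob_right p k)"
  proof (intro mult_mono alive_prob_left_block_le alive_prob_right_block_le)
    have "real (k - 1) * (1 - 3 * B * \<eta> ^ 4) \<le> real k * (1 - 3 * B * \<eta> ^ 4)"
      using ratio_pos by (intro mult_right_mono) auto
    then show "sqrt (real (k - 1) / real M) \<le> sqrt (1 / (1 - 3 * B * \<eta> ^ 4))"
      using M_range ratio_pos by (intro real_sqrt_le_mono) (simp add: field_simps)
  qed (use ratio_pos alive_prob_nonneg esc_prob_pos \<eta>_range(1) in
      \<open>auto intro!: mult_nonneg_nonneg divide_nonneg_nonneg\<close>)
  finally show ?thesis by (simp only: upper_factor_def mult_ac)
qed

subsection \<open>Lower bound\<close>

lemma sum_left_block_alive_le: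
  "(\<Sum>i<m. r i * alive_prob (left_law r i)) \<le>
    B * (2 * (\<eta> ^ 4 * real k) * esc_prob p k + 12 * (\<eta>\<^sup>2 * sqrt (real k)))"
proof -
  have "(\<Sum>i<m. r i * alive_prob (left_law r i)) \<le> B * (\<Sum>i<m. alive_prob (left_law r i))"
    unfolding sum_distrib_left
    by (intro sum_mono mult_right_mono order_trans[OF rate_le_left rate_left_le_B]
        alive_prob_nonneg)
  also have "\<dots> \<le> B * (2 * real m * esc_prob p k + 12 * sqrt (real m))"
    using rate_left_gt_1 rate_pos rate_le_left B_gt_1
    by (intro mult_left_mono sum_alive_prob_left_law_le[OF survival_root_esc_prob]) auto
  also have "\<dots> \<le> B * (2 * (\<eta> ^ 4 * real k) * esc_prob p k + 12 * (\<eta>\<^sup>2 * sqrt (real k)))"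
  proof -
    have "sqrt (real m) \<le> \<eta>\<^sup>2 * sqrt (real k)"
      using m_le by (intro real_le_lsqrt) (auto simp: power_mult_distrib power_mult[symmetric])
    then show ?thesis
      using m_le esc_prob_pos B_gt_1 by (intro mult_left_mono add_mono mult_right_mono) auto
  qed
  finally show ?thesis .
qed

lemma alive_near_left_block_ge:
  "left_factor B \<eta> C * esc_prob p k \<le>
    alive_near (left_law r m) (walk_mean 1 r 1 m) (\<eta> * sqrt (real k))"
proof -
  let ?y = "esc_prob p k" and ?S = "\<Sum>i<m. r i * alive_prob (left_law r i)"
  have k_pos: "0 < real k" using k_ge_64 by simp
  have x_square: "(\<eta> * sqrt (real k))\<^sup>2 = \<eta>\<^sup>2 * real k" "\<eta>\<^sup>2 * real k \<noteq> 0"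
    using \<eta>_range(1) k_pos by (auto simp: power_mult_distrib)
  have "?S / (\<eta> * sqrt (real k))\<^sup>2 \<le>
      B * (2 * (\<eta> ^ 4 * real k) * ?y + 12 * (\<eta>\<^sup>2 * sqrt (real k))) / (\<eta> * sqrt (real k))\<^sup>2"
    by (intro divide_right_mono sum_left_block_alive_le) auto
  also have "\<dots> = 2 * B * \<eta>\<^sup>2 * ?y + 12 * B * (1 / sqrt (real k))"
  proof -
    have "B * (2 * (\<eta> ^ 4 * real k) * ?y) = (2 * B * \<eta>\<^sup>2 * ?y) * (\<eta>\<^sup>2 * real k)"
      by (simp add: power4_eq_xxxx power2_eq_square)
    moreover have "B * (12 * (\<eta>\<^sup>2 * sqrt (real k))) = 12 * B * (1 / sqrt (real k)) * (\<eta>\<^sup>2 * real k)"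
      using k_pos by (simp add: field_simps)
    ultimately show ?thesis
      using x_square by (simp only: distrib_left distrib_right[symmetric]) simp
  qed
  also have "1 / sqrt (real k) = p * real k / C" using tilt k_pos by simp
  also have "12 * B * (p * real k / C) \<le> 12 * B * (2 * B\<^sup>2 * ?y / C)"
    using esc_prob_ge pk_pos B_gt_1 by (intro mult_left_mono divide_right_mono) auto
  finally have "?S / (\<eta> * sqrt (real k))\<^sup>2 \<le> 2 * B * \<eta>\<^sup>2 * ?y + 24 * B ^ 3 / C * ?y"
    by (simp add: power2_eq_square power3_eq_cube mult_ac)
  moreover have "\<theta> * ?y \<le> alive_prob (left_law r m)"
    using \<theta>_ge \<theta>_le_1 rate_pos left_block_rate_ge
    by (intro alive_prob_left_law_ge_root[OF survival_root_esc_prob]) auto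
  moreover have "alive_prob (left_law r m) - ?S / (\<eta> * sqrt (real k))\<^sup>2 \<le>
      alive_near (left_law r m) (walk_mean 1 r 1 m) (\<eta> * sqrt (real k))"
    using rate_pos \<eta>_range(1) k_pos by (intro alive_near_ge) auto
  ultimately show ?thesis by (simp add: left_factor_def \<theta>_def algebra_simps)
qed

lemma \<eta>_square_le_1: "\<eta>\<^sup>2 \<le> 1"
proof -
  have "1 * \<eta> ^ 4 \<le> 16 * B * \<eta> ^ 4" using B_gt_1 by (intro mult_right_mono) auto
  then have "(\<eta>\<^sup>2)\<^sup>2 \<le> 1\<^sup>2" using \<eta>_range(2) by (simp add: power_mult[symmetric])
  then show ?thesis by (rule power2_le_imp_le) simp
qed

lemma alive_near_right_block_ge:
  "right_factor B \<eta> C * esc_prob_right p k \<le>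
    alive_near (right_law rev_r m) (walk_mean (- 1) rev_r 0 m) (\<eta> * sqrt (real k))"
proof -
  let ?e = "esc_prob_right p k"
  define R where "R = (\<Sum>i<m. rev_r i)"
  have k_pos: "0 < real k" using k_ge_64 by simp
  have R_ratio: "R / m \<le> 1 - \<theta> * ?e"
    using sum_right_block_le m_pos by (simp add: R_def field_simps)
  have "0 \<le> \<theta> * ?e" using \<theta>_ge esc_prob_right_pos by simp
  then have "R / m \<le> 1" using R_ratio by linarith
  then have R_le: "R \<le> real m" using m_pos by (simp add: pos_divide_le_eq)
  have "R / (\<eta> * sqrt (real k))\<^sup>2 \<le> \<eta> ^ 4 * real k / (\<eta> * sqrt (real k))\<^sup>2"
    using R_le m_le by (intro divide_right_mono) auto
  also have "\<dots> = \<eta>\<^sup>2"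
    using \<eta>_range(1) k_pos by (simp add: power_mult_distrib power4_eq_xxxx power2_eq_square)
  finally have "\<theta> * ?e * (1 - \<eta>\<^sup>2) \<le> (1 - R / m) * (1 - R / (\<eta> * sqrt (real k))\<^sup>2)"
    using R_ratio R_le \<open>0 \<le> \<theta> * ?e\<close> \<eta>_square_le_1 m_pos by (intro mult_mono) auto
  moreover have "1 / (\<eta> * sqrt (real k)) \<le> ?e * (4 * B / (\<eta> * C))"
    using mult_left_mono[OF inverse_sqrt_k_le, of "1 / \<eta>"] \<eta>_range(1) by (simp add: mult_ac)
  moreover have "(1 - R / m) * (1 - R / (\<eta> * sqrt (real k))\<^sup>2) - 1 / (\<eta> * sqrt (real k)) \<le>
      alive_near (right_law rev_r m) (walk_mean (- 1) rev_r 0 m) (\<eta> * sqrt (real k))"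
    unfolding R_def using R_le \<eta>_range(1) k_pos m_pos rev_rate_pos rev_rate_mono
    by (intro alive_near_right_law_ge) (auto simp: R_def)
  moreover have "right_factor B \<eta> C * ?e = \<theta> * ?e * (1 - \<eta>\<^sup>2) - ?e * (4 * B / (\<eta> * C))"
    unfolding right_factor_def \<theta>_def by (simp add: left_diff_distrib right_diff_distrib mult_ac)
  ultimately show ?thesis by linarith
qed

lemma walk_mean_left_block_ge:
  "sqrt (real k) * excess_factor B \<eta> C + \<eta> * sqrt (real k) \<le> walk_mean 1 r 1 m"
  and walk_mean_right_block_ge:
  "sqrt (real k) * excess_factor B \<eta> C + \<eta> * sqrt (real k) \<le> walk_mean (- 1) rev_r 0 m"
proof -
  have "sqrt (real k) * (\<eta> ^ 4 * C / (16 * B)) = \<eta> ^ 4 * real k / 2 * (p * real k / (8 * B))"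
    using real_sqrt_mult_self[of "real k"] by (simp add: mult_ac)
  then have excess: "sqrt (real k) * excess_factor B \<eta> C + \<eta> * sqrt (real k) =
      \<eta> ^ 4 * real k / 2 * (p * real k / (8 * B))"
    by (simp add: excess_factor_def algebra_simps)
  have ratio_nonneg: "0 \<le> p * real k / (8 * B)" using pk_pos B_gt_1 by simp
  have "p * real k / (8 * B) \<le> p * real k / 8"
    using B_gt_1 pk_pos by (intro divide_left_mono) auto
  also have "\<dots> \<le> 1 / 2 * (rate_left p k - 1)" using rate_left_minus_1_ge by simp
  also have "\<dots> \<le> \<theta> * (rate_left p k - 1)"
    using \<theta>_ge rate_left_gt_1 by (intro mult_right_mono) auto
  finally have "\<eta> ^ 4 * real k / 2 * (p * real k / (8 * B)) \<le> real m * (\<theta> * (rate_left p k - 1))"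
    using m_ge ratio_nonneg by (intro mult_mono) auto
  moreover have "real m * (\<theta> * (rate_left p k - 1)) \<le> (\<Sum>i<m. r i - 1)"
    using sum_mono[of "{..<m}" "\<lambda>_. \<theta> * (rate_left p k - 1)" "\<lambda>i. r i - 1"] left_block_rate_ge
    by force
  ultimately show "sqrt (real k) * excess_factor B \<eta> C + \<eta> * sqrt (real k) \<le> walk_mean 1 r 1 m"
    unfolding excess by (simp add: walk_mean_def)
  have "p * real k / (8 * B) \<le> 1 / 2 * esc_prob_right p k"
    using esc_prob_right_ge B_gt_1 by (simp add: field_simps)
  also have "\<dots> \<le> \<theta> * esc_prob_right p k"
    using \<theta>_ge esc_prob_right_pos by (intro mult_right_mono) auto
  finally have "\<eta> ^ 4 * real k / 2 * (p * real k / (8 * B)) \<le> real m * (\<theta> * esc_prob_right p k)"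
    using m_ge ratio_nonneg by (intro mult_mono) auto
  then show "sqrt (real k) * excess_factor B \<eta> C + \<eta> * sqrt (real k) \<le> walk_mean (- 1) rev_r 0 m"
    unfolding excess
    using sum_right_block_le by (simp add: walk_mean_def sum_subtractf algebra_simps)
qed

lemma rate_ge_half_after_crossing:
  assumes "crossing \<le> i" "i < crossing + margin"
  shows "1 / 2 \<le> r i"
proof -
  define j where "j = i - (crossing - 1)"
  have j_range: "crossing - 1 + j = i" "j \<le> margin" "0 < crossing"
    using assms crossing_ge m_pos by (auto simp: j_def)
  have "real j * p \<le> real k / (8 * B) * p"
    using j_range margin_le tilt by (intro mult_right_mono) auto
  also have "\<dots> \<le> 1 / 2" using B_ge B_gt_1 by (simp add: field_simps)
  finally have jp_le: "1 / 2 \<le> 1 - real j * p" by simp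
  also have "\<dots> \<le> r (crossing - 1) * (1 - real j * p)"
    using rate_ge_1_before_crossing[of "crossing - 1"] j_range jp_le by simp
  also have "\<dots> \<le> r (crossing - 1 + j)" by (rule tilted_rate_add_ge[OF tilt k_ge_2])
  finally show ?thesis by (simp only: j_range)
qed

lemma sum_around_crossing_ge:
  assumes "2 * n \<le> margin"
  shows "real n \<le> (\<Sum>i\<in>{m..<crossing}. r i)" "real n \<le> (\<Sum>i\<in>{crossing..<k - m}. r i)"
proof -
  have "real n \<le> real (crossing - m)" using assms crossing_ge by linarith
  also have "\<dots> \<le> (\<Sum>i\<in>{m..<crossing}. r i)"
    using sum_mono[of "{m..<crossing}" "\<lambda>_. 1" r] rate_ge_1_before_crossing by simp
  finally show "real n \<le> (\<Sum>i\<in>{m..<crossing}. r i)" .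
  have "real n \<le> (\<Sum>i\<in>{crossing..<crossing + margin}. 1 / 2)" using assms by simp
  also have "\<dots> \<le> (\<Sum>i\<in>{crossing..<crossing + margin}. r i)"
    by (intro sum_mono rate_ge_half_after_crossing) auto
  also have "\<dots> \<le> (\<Sum>i\<in>{crossing..<k - m}. r i)"
    using crossing_le rate_pos by (intro sum_mono2) (auto intro!: less_imp_le)
  finally show "real n \<le> (\<Sum>i\<in>{crossing..<k - m}. r i)" .
qed

lemma linear_mass_below_margin:
  obtains n where "1 \<le> n" "2 * n \<le> margin" "real k / real n \<le> 64 * B"
proof -
  define t where "t = real k / (32 * B)"
  define n where "n = nat \<lfloor>t\<rfloor>"
  have t_ge: "2 \<le> t" using k_ge B_gt_1 by (simp add: t_def field_simps)
  have n_near: "real n \<le> t" "t - 1 \<le> real n" unfolding n_def using t_ge by auto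
  then have n_ge: "1 \<le> n" "t / 2 \<le> real n" using t_ge by linarith+
  have "real k / (8 * B) = 4 * t" by (simp add: t_def)
  then have "2 * n \<le> margin" using margin_ge n_near t_ge by linarith
  moreover have "real k \<le> 64 * B * real n" using n_ge B_gt_1 by (simp add: t_def field_simps)
  then have "real k / real n \<le> 64 * B" using n_ge by (simp add: field_simps)
  ultimately show ?thesis using that n_ge by blast
qed

lemma middle_factor_le:
  assumes "0 < excess_factor B \<eta> C" "real k / real n \<le> 64 * B"
  shows "middle_factor B \<eta> C \<le> exp (- (2 * (\<eta> * sqrt (real k)))\<^sup>2 / (\<Sum>i\<in>{m..<k - m}. r i)) -
    real (k - 1) / (sqrt (real k) * excess_factor B \<eta> C)\<^sup>2 * sqrt (real (k - 1) / real n)"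
proof -
  have k_pos: "0 < real k" using k_ge_64 by simp
  have mean_ge_pos: "0 < real k * (1 - 3 * B * \<eta> ^ 4)" using middle_ratio_ge k_pos by simp
  have "4 * (\<eta>\<^sup>2 * real k) / (\<Sum>i\<in>{m..<k - m}. r i) \<le>
      4 * (\<eta>\<^sup>2 * real k) / (real k * (1 - 3 * B * \<eta> ^ 4))"
  proof (rule divide_left_mono)
    have "0 < (\<Sum>i\<in>{m..<k - m}. r i)" using sum_middle_ge mean_ge_pos by linarith
    then show "0 < (\<Sum>i\<in>{m..<k - m}. r i) * (real k * (1 - 3 * B * \<eta> ^ 4))"
      using mean_ge_pos by (rule mult_pos_pos)
  qed (use sum_middle_ge in auto)
  also have "\<dots> = 4 * \<eta>\<^sup>2 / (1 - 3 * B * \<eta> ^ 4)" using k_pos by simp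
  finally have "exp (- (4 * \<eta>\<^sup>2 / (1 - 3 * B * \<eta> ^ 4))) \<le>
      exp (- (2 * (\<eta> * sqrt (real k)))\<^sup>2 / (\<Sum>i\<in>{m..<k - m}. r i))"
    by (simp add: power_mult_distrib)
  moreover have "real (k - 1) / (sqrt (real k) * excess_factor B \<eta> C)\<^sup>2 *
      sqrt (real (k - 1) / real n) \<le> 1 / (excess_factor B \<eta> C)\<^sup>2 * sqrt (64 * B)"
  proof (intro mult_mono)
    have "real (k - 1) / (sqrt (real k) * excess_factor B \<eta> C)\<^sup>2 \<le>
        real k / (sqrt (real k) * excess_factor B \<eta> C)\<^sup>2"
      by (intro divide_right_mono) auto
    then show "real (k - 1) / (sqrt (real k) * excess_factor B \<eta> C)\<^sup>2 \<le> 1 / (excess_factor B \<eta> C)\<^sup>2"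
      using k_pos by (simp add: power_mult_distrib)
    have "real (k - 1) / real n \<le> real k / real n" by (intro divide_right_mono) auto
    then show "sqrt (real (k - 1) / real n) \<le> sqrt (64 * B)"
      using assms(2) by (intro real_sqrt_le_mono) simp
  qed auto
  ultimately show ?thesis unfolding middle_factor_def by linarith
qed

lemma tree_prob_ge:
  assumes excess: "0 < excess_factor B \<eta> C"
    and factors: "0 \<le> left_factor B \<eta> C" "0 \<le> right_factor B \<eta> C" "0 \<le> middle_factor B \<eta> C"
  shows "lower_factor B \<eta> C * (esc_prob p k * esc_prob_right p k) \<le> tree_prob p k"
proof -
  obtain n where n_range: "1 \<le> n" "2 * n \<le> margin" "real k / real n \<le> 64 * B"
    using linear_mass_below_margin .
  define x X \<mu> where "x = \<eta> * sqrt (real k)"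
    and "X = sqrt (real k) * excess_factor B \<eta> C" and "\<mu> = (\<Sum>i\<in>{m..<k - m}. r i)"
  let ?near_left = "alive_near (left_law r m) (walk_mean 1 r 1 m) x"
  let ?near_right = "alive_near (right_law rev_r m) (walk_mean (- 1) rev_r 0 m) x"
  let ?bridge = "exp (- (2 * x)\<^sup>2 / \<mu>) - real (k - 1) / X\<^sup>2 * sqrt (real (k - 1) / real n)"
  have "2 * x \<le> real k * (1 / 2)"
    using mult_right_mono[OF \<eta>_range(4), of "sqrt (real k)"] by (simp add: x_def)
  also have "\<dots> \<le> real k * (1 - 3 * B * \<eta> ^ 4)" using middle_ratio_ge by (intro mult_left_mono) auto
  finally have x_le: "2 * x \<le> \<mu>" using sum_middle_ge by (simp add: \<mu>_def)
  have "?near_left * ?near_right * (poisson_peak (k - 1) * ?bridge) \<le>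
      first_passage_weight r k"
    unfolding \<mu>_def
  proof (rule first_passage_weight_ge)
    show "m \<le> crossing" "crossing \<le> k - m" "m \<le> k" using crossing_ge crossing_le by auto
    show "0 < x" "0 < X" using \<eta>_range(1) k_ge_64 excess by (auto simp: x_def X_def)
    show "X + x \<le> walk_mean 1 r 1 m" "X + x \<le> walk_mean (- 1) rev_r 0 m"
      unfolding X_def x_def by (rule walk_mean_left_block_ge, rule walk_mean_right_block_ge)
  qed (use n_range x_le m_pos rate_pos sum_rates rate_ge_1_before_crossing rate_lt_1_after_crossing
      sum_around_crossing_ge[OF n_range(2)] in \<open>auto simp: \<mu>_def less_imp_le\<close>)
  then have "(?near_left * ?near_right * ?bridge) * poisson_peak (k - 1) \<le>
      tree_prob p k * poisson_peak (k - 1)"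
    unfolding prob_TREE_eq_first_passage_weight[OF tilt k_ge_2] by (simp only: mult_ac)
  then have "?near_left * ?near_right * ?bridge \<le> tree_prob p k"
    using poisson_peak_pos by (simp only: mult_le_cancel_right_pos)
  moreover have "(left_factor B \<eta> C * esc_prob p k) * (right_factor B \<eta> C * esc_prob_right p k) *
      middle_factor B \<eta> C \<le> ?near_left * ?near_right * ?bridge"
    unfolding x_def X_def \<mu>_def
    by (intro mult_mono alive_near_left_block_ge alive_near_right_block_ge middle_factor_le)
      (use factors excess n_range esc_prob_pos esc_prob_right_pos in
        \<open>auto simp: alive_near_def intro!: mult_nonneg_nonneg\<close>)
  ultimately show ?thesis by (simp add: lower_factor_def mult_ac)
qed

end

section \<open>Asymptotics\<close>

lemma tendsto_if_parametric_bounds: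
  fixes f :: "'a \<Rightarrow> 'b::linorder_topology"
  assumes G_nontrivial: "G \<noteq> bot"
    and lower: "\<forall>\<^sub>F \<eta> in G. \<forall>\<^sub>F k in F. l \<eta> k \<le> f k" "\<forall>\<^sub>F \<eta> in G. (l \<eta> \<longlongrightarrow> \<alpha> \<eta>) F" "(\<alpha> \<longlongrightarrow> L) G"
    and upper: "\<forall>\<^sub>F \<eta> in G. \<forall>\<^sub>F k in F. f k \<le> u \<eta> k" "\<forall>\<^sub>F \<eta> in G. (u \<eta> \<longlongrightarrow> \<beta> \<eta>) F" "(\<beta> \<longlongrightarrow> L) G"
  shows "(f \<longlongrightarrow> L) F"
proof (rule order_tendstoI)
  fix a assume "a < L"
  then have "\<forall>\<^sub>F \<eta> in G. (\<forall>\<^sub>F k in F. l \<eta> k \<le> f k) \<and> (l \<eta> \<longlongrightarrow> \<alpha> \<eta>) F \<and> a < \<alpha> \<eta>"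
    using lower order_tendstoD(1)[OF lower(3)] by (intro eventually_conj)
  then obtain \<eta> where \<eta>_bounds: "\<forall>\<^sub>F k in F. l \<eta> k \<le> f k" "(l \<eta> \<longlongrightarrow> \<alpha> \<eta>) F" "a < \<alpha> \<eta>"
    using eventually_happens[of _ G] G_nontrivial by auto
  show "\<forall>\<^sub>F k in F. a < f k"
    using \<eta>_bounds(1) order_tendstoD(1)[OF \<eta>_bounds(2,3)] by eventually_elim simp
next
  fix a assume "L < a"
  then have "\<forall>\<^sub>F \<eta> in G. (\<forall>\<^sub>F k in F. f k \<le> u \<eta> k) \<and> (u \<eta> \<longlongrightarrow> \<beta> \<eta>) F \<and> \<beta> \<eta> < a"
    using upper order_tendstoD(2)[OF upper(3)] by (intro eventually_conj)
  then obtain \<eta> where \<eta>_bounds: "\<forall>\<^sub>F k in F. f k \<le> u \<eta> k" "(u \<eta> \<longlongrightarrow> \<beta> \<eta>) F" "\<beta> \<eta> < a"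
    using eventually_happens[of _ G] G_nontrivial by auto
  show "\<forall>\<^sub>F k in F. f k < a"
    using \<eta>_bounds(1) order_tendstoD(2)[OF \<eta>_bounds(2,3)] by eventually_elim simp
qed

definition upper_limit :: "real \<Rightarrow> real \<Rightarrow> real" where
  "upper_limit B \<eta> = sqrt (1 / (1 - 3 * B * \<eta> ^ 4)) * (1 + \<eta>)"

definition lower_limit :: "real \<Rightarrow> real \<Rightarrow> real" where
  "lower_limit B \<eta> = (1 - 4 * B * \<eta> ^ 4 - 2 * B * \<eta>\<^sup>2) * ((1 - 4 * B * \<eta> ^ 4) * (1 - \<eta>\<^sup>2)) *
     exp (- (4 * \<eta>\<^sup>2 / (1 - 3 * B * \<eta> ^ 4)))"

lemma upper_factor_tendsto:
  assumes "0 < B" "0 < \<eta>" "16 * B * \<eta> ^ 4 < 1"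
  shows "(upper_factor B \<eta> \<longlongrightarrow> upper_limit B \<eta>) at_top"
proof -
  have "3 * B * \<eta> ^ 4 < 1" using assms by simp
  with assms show ?thesis unfolding upper_factor_def upper_limit_def sqrt_def by real_asymp
qed

lemma lower_factor_tendsto:
  assumes "0 < B" "0 < \<eta>" "16 * B * \<eta> ^ 4 < 1"
  shows "(lower_factor B \<eta> \<longlongrightarrow> lower_limit B \<eta>) at_top"
  unfolding lower_factor_def lower_limit_def
proof (intro tendsto_mult)
  show "(left_factor B \<eta> \<longlongrightarrow> 1 - 4 * B * \<eta> ^ 4 - 2 * B * \<eta>\<^sup>2) at_top"
    unfolding left_factor_def by real_asymp
  show "(right_factor B \<eta> \<longlongrightarrow> (1 - 4 * B * \<eta> ^ 4) * (1 - \<eta>\<^sup>2)) at_top"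
    using assms unfolding right_factor_def by real_asymp
  show "(middle_factor B \<eta> \<longlongrightarrow> exp (- (4 * \<eta>\<^sup>2 / (1 - 3 * B * \<eta> ^ 4)))) at_top"
    using assms unfolding middle_factor_def excess_factor_def by real_asymp
qed

lemma upper_limit_tendsto: "0 < B \<Longrightarrow> (upper_limit B \<longlongrightarrow> 1) (at_right 0)"
  unfolding upper_limit_def by real_asymp

lemma lower_limit_tendsto: "0 < B \<Longrightarrow> (lower_limit B \<longlongrightarrow> 1) (at_right 0)"
  unfolding lower_limit_def by real_asymp

lemma eventually_factors_pos:
  assumes "0 < B" "0 < \<eta>" "\<eta> < 1" "4 * B * \<eta> ^ 4 + 2 * B * \<eta>\<^sup>2 < 1"
  shows "\<forall>\<^sub>F C in at_top. 0 < excess_factor B \<eta> C \<and> 0 < left_factor B \<eta> C \<and>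
    0 < right_factor B \<eta> C \<and> 0 < middle_factor B \<eta> C"
proof (intro eventually_conj)
  show "\<forall>\<^sub>F C in at_top. 0 < excess_factor B \<eta> C"
    using assms unfolding excess_factor_def by real_asymp
  have "0 < 1 - 4 * B * \<eta> ^ 4 - 2 * B * \<eta>\<^sup>2" using assms by simp
  then show "\<forall>\<^sub>F C in at_top. 0 < left_factor B \<eta> C"
    using assms unfolding left_factor_def by real_asymp
  have "4 * B * \<eta> ^ 4 < 1" "\<eta>\<^sup>2 < 1"
    using assms power_strict_mono[of \<eta> 1 2] by (auto intro: le_less_trans[rotated])
  then have "0 < (1 - 4 * B * \<eta> ^ 4) * (1 - \<eta>\<^sup>2)" by simp
  then show "\<forall>\<^sub>F C in at_top. 0 < right_factor B \<eta> C"
    using assms unfolding right_factor_def by real_asymp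
  show "\<forall>\<^sub>F C in at_top. 0 < middle_factor B \<eta> C"
    using assms unfolding middle_factor_def excess_factor_def by real_asymp
qed

definition tree_ratio :: "real \<Rightarrow> nat \<Rightarrow> real" where
  "tree_ratio p k = tree_prob p k / (esc_prob p k * esc_prob_right p k)"

lemma (in tilt_window) tree_ratio_le:
  "tree_ratio p k \<le> upper_factor B \<eta> (p * real k * sqrt (real k))"
  using tree_prob_le esc_prob_pos esc_prob_right_pos by (simp add: tree_ratio_def pos_divide_le_eq)

lemma (in tilt_window) tree_ratio_ge:
  assumes "0 < excess_factor B \<eta> (p * real k * sqrt (real k))"
    and "0 < left_factor B \<eta> (p * real k * sqrt (real k))"
    and "0 < right_factor B \<eta> (p * real k * sqrt (real k))"
    and "0 < middle_factor B \<eta> (p * real k * sqrt (real k))"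
  shows "lower_factor B \<eta> (p * real k * sqrt (real k)) \<le> tree_ratio p k"
  using tree_prob_ge assms esc_prob_pos esc_prob_right_pos
  by (simp add: tree_ratio_def pos_le_divide_eq)

lemma powr_three_halves: "0 < x \<Longrightarrow> x powr (3 / 2) = x * sqrt x" for x :: real
  using powr_add[of x 1 "1 / 2"] by (simp add: powr_half_sqrt)

context
  fixes p :: "nat \<Rightarrow> real" and c B :: real
  assumes tilt_lim: "filterlim (\<lambda>k. p k * real k powr (3 / 2)) at_top sequentially"
    and bounded: "\<forall>\<^sub>F k in sequentially. p k * real k \<le> c"
    and B_def: "B = 2 + \<bar>c\<bar>"
begin

lemma eventually_tilt_window:
  assumes \<eta>_range: "0 < \<eta>" "16 * B * \<eta> ^ 4 < 1"
  shows "\<forall>\<^sub>F k in sequentially. tilt_window (p k) k B \<eta>"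
proof -
  have k_ge: "\<forall>\<^sub>F k in sequentially. x \<le> real k" for x
    using filterlim_real_sequentially by (simp add: filterlim_at_top)
  have "\<forall>\<^sub>F k in sequentially. 4 * \<eta> \<le> sqrt (real k)"
    using filterlim_compose[OF sqrt_at_top filterlim_real_sequentially]
    by (simp add: filterlim_at_top)
  moreover have "\<forall>\<^sub>F k in sequentially. 7 \<le> p k * real k powr (3 / 2)"
    using tilt_lim by (simp add: filterlim_at_top)
  ultimately show ?thesis
    using bounded k_ge[of "64 * B"] k_ge[of "2 / \<eta> ^ 4"]
  proof eventually_elim
    case (elim k)
    have k_pos: "0 < real k" using elim B_def by linarith
    have tilt: "7 \<le> p k * real k * sqrt (real k)"
      using elim k_pos by (simp add: powr_three_halves)
    then have "0 < p k * (real k * sqrt (real k))" by simp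
    then have p_pos: "0 < p k" by (rule zero_less_mult_pos2) (use k_pos in simp)
    have "p k * real k < 1 * real k" using elim B_def by linarith
    then have "p k < 1" using k_pos by (simp only: mult_less_cancel_right_pos)
    moreover have "2 \<le> \<eta> ^ 4 * real k" using elim \<eta>_range by (simp add: field_simps)
    ultimately show ?case
      using p_pos tilt elim B_def \<eta>_range by unfold_locales auto
  qed
qed

lemma filterlim_tilt_mult_sqrt: "filterlim (\<lambda>k. p k * real k * sqrt (real k)) at_top sequentially"
  using tilt_lim
  by (rule filterlim_mono_eventually[OF _ order_refl order_refl])
    (auto simp: powr_three_halves intro!: eventually_mono[OF eventually_gt_at_top[of 0]])

lemma eventually_tree_ratio_ge_lower_factor:
  assumes \<eta>_range: "0 < \<eta>" "\<eta> < 1" "16 * B * \<eta> ^ 4 < 1" "4 * B * \<eta> ^ 4 + 2 * B * \<eta>\<^sup>2 < 1"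
  shows "\<forall>\<^sub>F k in sequentially.
    lower_factor B \<eta> (p k * real k * sqrt (real k)) \<le> tree_ratio (p k) k"
proof -
  have "\<forall>\<^sub>F C in at_top. 0 < excess_factor B \<eta> C \<and> 0 < left_factor B \<eta> C \<and>
      0 < right_factor B \<eta> C \<and> 0 < middle_factor B \<eta> C"
    using \<eta>_range B_def by (intro eventually_factors_pos) auto
  from eventually_compose_filterlim[OF this filterlim_tilt_mult_sqrt]
    eventually_tilt_window[OF \<eta>_range(1,3)]
  show ?thesis by eventually_elim (auto intro: tilt_window.tree_ratio_ge)
qed

lemma tree_ratio_tendsto_1_bounded: "(\<lambda>k. tree_ratio (p k) k) \<longlonglongrightarrow> 1"
proof (rule tendsto_if_parametric_bounds)
  let ?C = "\<lambda>k. p k * real k * sqrt (real k)"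
  have B_pos: "0 < B" by (simp add: B_def)
  have "\<forall>\<^sub>F \<eta> in at_right 0. 16 * B * \<eta> ^ 4 < 1" "\<forall>\<^sub>F \<eta> in at_right 0. (\<eta>::real) < 1"
    "\<forall>\<^sub>F \<eta> in at_right 0. 4 * B * \<eta> ^ 4 + 2 * B * \<eta>\<^sup>2 < 1"
    by real_asymp+
  with eventually_at_right_less[of "0::real"]
  have \<eta>_small: "\<forall>\<^sub>F \<eta> in at_right 0. 0 < \<eta> \<and> \<eta> < 1 \<and> 16 * B * \<eta> ^ 4 < 1 \<and>
      4 * B * \<eta> ^ 4 + 2 * B * \<eta>\<^sup>2 < 1"
    by eventually_elim simp
  show "\<forall>\<^sub>F \<eta> in at_right 0. \<forall>\<^sub>F k in sequentially. lower_factor B \<eta> (?C k) \<le> tree_ratio (p k) k"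
    using \<eta>_small by eventually_elim (simp add: eventually_tree_ratio_ge_lower_factor)
  show "\<forall>\<^sub>F \<eta> in at_right 0. \<forall>\<^sub>F k in sequentially. tree_ratio (p k) k \<le> upper_factor B \<eta> (?C k)"
    using \<eta>_small
  proof eventually_elim
    case (elim \<eta>)
    then have "\<forall>\<^sub>F k in sequentially. tilt_window (p k) k B \<eta>" by (simp add: eventually_tilt_window)
    then show ?case by eventually_elim (rule tilt_window.tree_ratio_le)
  qed
  show "\<forall>\<^sub>F \<eta> in at_right 0. (\<lambda>k. lower_factor B \<eta> (?C k)) \<longlonglongrightarrow> lower_limit B \<eta>"
    using \<eta>_small
    by eventually_elim
      (auto intro!: filterlim_compose[OF lower_factor_tendsto filterlim_tilt_mult_sqrt] B_pos)
  show "\<forall>\<^sub>F \<eta> in at_right 0. (\<lambda>k. upper_factor B \<eta> (?C k)) \<longlonglongrightarrow> upper_limit B \<eta>"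
    using \<eta>_small
    by eventually_elim
      (auto intro!: filterlim_compose[OF upper_factor_tendsto filterlim_tilt_mult_sqrt] B_pos)
qed (simp_all add: B_def lower_limit_tendsto upper_limit_tendsto)

end

subsection \<open>Large tilt\<close>

lemma escape_product_ge:
  assumes tilt: "0 < p" "p < 1" and k_ge_2: "2 \<le> k" and c_range: "12 \<le> c" "c \<le> p * real k"
  shows "1 - 12 / c \<le> esc_prob p k * esc_prob_right p k"
proof -
  define growth where "growth = (real k - 1) * p / 2"
  let ?l = "rate_left p k" and ?y = "esc_prob p k"
  have "1 * p \<le> real k / 2 * p" using k_ge_2 tilt by (intro mult_right_mono) auto
  then have growth: "c / 4 \<le> growth" using c_range by (simp add: growth_def algebra_simps)
  have "1 / 2 * (1 + growth) \<le> (1 - 1 / k) * (1 + growth)"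
    using k_ge_2 growth c_range by (intro mult_right_mono) (auto simp: field_simps)
  also have "\<dots> \<le> ?l" unfolding growth_def by (rule rate_left_ge[OF tilt k_ge_2])
  finally have l_ge: "c / 8 \<le> ?l" using growth by simp
  then have root: "survival_root ?l ?y" using c_range by (intro survival_root_measure_ESC) simp
  then have y_range: "0 < ?y" "?y < 1" by (auto simp: survival_root_def)
  have "(1 - ?y) * (c / 8) \<le> (1 - ?y) * ?l" using l_ge y_range(2) by (intro mult_left_mono) auto
  also have "\<dots> \<le> 1" using survival_root_le[OF root] by (simp only: mult.commute)
  finally have left: "1 - 8 / c \<le> ?y" using c_range by (simp add: field_simps)
  have "rate_right p k \<le> 1 / (1 + growth)" unfolding growth_def
    by (rule rate_right_le[OF tilt k_ge_2])
  also have "\<dots> \<le> 1 / (c / 4)" using growth c_range by (intro divide_left_mono) auto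
  finally have right: "1 - 4 / c \<le> esc_prob_right p k" using esc_prob_right_eq[OF tilt k_ge_2]
    by simp
  have "1 - 12 / c \<le> (1 - 8 / c) * (1 - 4 / c)" using c_range by (simp add: field_simps)
  also have "\<dots> \<le> ?y * esc_prob_right p k" using c_range y_range left right by (intro mult_mono) auto
  finally show ?thesis .
qed

lemma measure_poisson_steps_le_1: "measure (poisson_steps l) A \<le> 1"
  using prob_space.prob_le_1[OF prob_space_poisson_steps] .

lemma tree_ratio_nonneg: "0 \<le> tree_ratio p k"
  by (simp add: tree_ratio_def)

lemma tree_ratio_min_bounds:
  assumes tilt: "0 < p" "p < 1" and k_ge_2: "2 \<le> k" and c_gt: "12 < c"
  shows "(1 - 12 / c) * tree_ratio (min p (c / real k)) k \<le> tree_ratio p k"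
    and "tree_ratio p k \<le> max (tree_ratio (min p (c / real k)) k) (1 / (1 - 12 / c))"
proof -
  define s where "s = 1 - 12 / c"
  have s_range: "0 < s" "s \<le> 1" using c_gt by (auto simp: s_def)
  have "s * tree_ratio (min p (c / real k)) k \<le> tree_ratio p k \<and>
      tree_ratio p k \<le> max (tree_ratio (min p (c / real k)) k) (1 / s)"
  proof (cases "p \<le> c / real k")
    case True
    then show ?thesis using s_range tree_ratio_nonneg by (simp add: mult_left_le_one_le)
  next
    case False
    define p' where "p' = c / real k"
    define g g' where "g = esc_prob p k * esc_prob_right p k"
      and "g' = esc_prob p' k * esc_prob_right p' k"
    have p'_range: "0 < p'" "p' < p" "p' * real k = c" "c \<le> p * real k"
      using False c_gt k_ge_2 by (auto simp: p'_def field_simps)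
    have g_range: "s \<le> g" "g \<le> 1" and g'_ge: "s \<le> g'"
      unfolding g_def g'_def s_def using tilt p'_range k_ge_2 c_gt
      by (auto intro!: escape_product_ge mult_le_one measure_poisson_steps_le_1)
    have "s * (tree_prob p' k / g') \<le> g' * (tree_prob p' k / g')"
      using g'_ge s_range by (intro mult_right_mono) auto
    also have "\<dots> = tree_prob p' k" using g'_ge s_range by simp
    also have "\<dots> \<le> tree_prob p k" using tilt p'_range k_ge_2 by (intro prob_TREE_mono) auto
    also have "\<dots> \<le> tree_prob p k / g" using g_range s_range
      by (simp add: pos_le_divide_eq mult_left_le)
    finally have "s * tree_ratio p' k \<le> tree_ratio p k"
      by (simp add: tree_ratio_def g_def g'_def)
    moreover have "tree_ratio p k \<le> 1 / s"
      unfolding tree_ratio_def g_def[symmetric] using g_range s_range by (intro frac_le) auto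
    ultimately show ?thesis using p'_range by (simp add: min_absorb2 flip: p'_def)
  qed
  then show "(1 - 12 / c) * tree_ratio (min p (c / real k)) k \<le> tree_ratio p k"
    "tree_ratio p k \<le> max (tree_ratio (min p (c / real k)) k) (1 / (1 - 12 / c))"
    by (simp_all add: s_def)
qed

lemma tree_ratio_min_tendsto_1:
  fixes p :: "nat \<Rightarrow> real"
  assumes "filterlim (\<lambda>k. p k * real k powr (3 / 2)) at_top sequentially" "0 < c"
  shows "(\<lambda>k. tree_ratio (min (p k) (c / real k)) k) \<longlonglongrightarrow> 1"
proof (rule tree_ratio_tendsto_1_bounded[OF _ _ refl])
  show "\<forall>\<^sub>F k in sequentially. min (p k) (c / real k) * real k \<le> c"
    using eventually_gt_at_top[of 0] by eventually_elim (auto simp: min_def field_simps)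
  have cut: "filterlim (\<lambda>k. c / real k * real k powr (3 / 2)) at_top sequentially"
    using assms(2) by real_asymp
  show "filterlim (\<lambda>k. min (p k) (c / real k) * real k powr (3 / 2)) at_top sequentially"
    unfolding filterlim_at_top
  proof
    fix Z :: real
    have "\<forall>\<^sub>F k in sequentially. Z \<le> c / real k * real k powr (3 / 2)"
      using cut unfolding filterlim_at_top by (rule spec)
    moreover have "\<forall>\<^sub>F k in sequentially. Z \<le> p k * real k powr (3 / 2)"
      using assms(1) unfolding filterlim_at_top by (rule spec)
    ultimately show "\<forall>\<^sub>F k in sequentially. Z \<le> min (p k) (c / real k) * real k powr (3 / 2)"
      by eventually_elim (simp add: min_def)
  qed
qed

lemma eventually_tilt_in_unit_interval:
  fixes p :: "nat \<Rightarrow> real"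
  assumes "filterlim (\<lambda>k. p k * real k powr (3 / 2)) at_top sequentially"
    and "\<forall>\<^sub>F k in sequentially. p k \<le> 10 * (ln (real k) / real k)"
  shows "\<forall>\<^sub>F k in sequentially. 0 < p k \<and> p k < 1"
proof -
  have "\<forall>\<^sub>F k in sequentially. 0 < p k * real k powr (3 / 2)"
    using assms(1) by (simp add: filterlim_at_top_dense)
  moreover have "\<forall>\<^sub>F k in sequentially. 10 * (ln (real k) / real k) < 1" by real_asymp
  ultimately show ?thesis
    using assms(2)
  proof eventually_elim
    case (elim k)
    have "p k < 1" using elim(2,3) by linarith
    then show ?case using elim(1) by (auto simp: zero_less_mult_iff)
  qed
qed

theorem theorem2:
  fixes p :: "nat \<Rightarrow> real"
  assumes "filterlim (\<lambda>k. p k * real k powr (3/2)) at_top sequentially"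
    and "\<forall>\<^sub>F k in sequentially. p k \<le> 10 * (ln (real k) / real k)"
  shows "(\<lambda>k. measure_pmf.prob (placement_pmf (p k) k) (TREE k))
    \<sim>[sequentially]
    (\<lambda>k. measure (poisson_steps (rate_left (p k) k)) (ESC (rate_left (p k) k)) *
          measure (poisson_steps (rate_right (p k) k)) (ESC\<^sub>R (rate_right (p k) k)))"
proof (rule asymp_equivI', fold tree_ratio_def, rule tendsto_if_parametric_bounds)
  let ?cut = "\<lambda>c k. tree_ratio (min (p k) (c / real k)) k"
  have p_range: "\<forall>\<^sub>F k in sequentially. 0 < p k \<and> p k < 1 \<and> 2 \<le> k"
    using eventually_tilt_in_unit_interval[OF assms] eventually_ge_at_top[of 2]
    by eventually_elim simp
  have c_gt: "\<forall>\<^sub>F c in at_top. (12::real) < c" by (rule eventually_gt_at_top)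
  show "\<forall>\<^sub>F c in at_top. \<forall>\<^sub>F k in sequentially. (1 - 12 / c) * ?cut c k \<le> tree_ratio (p k) k"
    using c_gt
    by eventually_elim (use p_range in \<open>eventually_elim, auto intro: tree_ratio_min_bounds\<close>)
  show "\<forall>\<^sub>F c in at_top. \<forall>\<^sub>F k in sequentially.
      tree_ratio (p k) k \<le> max (?cut c k) (1 / (1 - 12 / c))"
    using c_gt
    by eventually_elim (use p_range in \<open>eventually_elim, auto intro: tree_ratio_min_bounds\<close>)
  show "\<forall>\<^sub>F c in at_top. (\<lambda>k. (1 - 12 / c) * ?cut c k) \<longlonglongrightarrow> (1 - 12 / c) * 1"
    using c_gt by eventually_elim (intro tendsto_intros tree_ratio_min_tendsto_1 assms, simp)
  show "\<forall>\<^sub>F c in at_top. (\<lambda>k. max (?cut c k) (1 / (1 - 12 / c))) \<longlonglongrightarrow> max 1 (1 / (1 - 12 / c))"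
    using c_gt by eventually_elim (intro tendsto_intros tree_ratio_min_tendsto_1 assms, simp)
  show "((\<lambda>c. (1 - 12 / c) * 1) \<longlongrightarrow> (1::real)) at_top" by real_asymp
  show "((\<lambda>c. max 1 (1 / (1 - 12 / c))) \<longlongrightarrow> (1::real)) at_top" by real_asymp
qed simp

end
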